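(* Let $W$ be an $L^1$ graphon. (a) We have $d_1(\mathbf{H}(n,W),W)\to0$ as $n\to\infty$ with probability $1$. (b) If $\rho_n>0$ satisfies $\rho_n\to0$ and $n\rho_n\to\infty$ as $n\to\infty$, then $$d_\square\big(\rho_n^{-1}\mathbf{G}(n,W,\rho_n),\,W\big)\to0$$ as $n\to\infty$ with probability $1$.
   Context: A graphon is a symmetric (Borel) measurable integrable function $W:[0,1]^2\to\mathbb{R}$ (so every graphon is an $L^1$ graphon). $d_1(U,W)=\|U-W\|_1=\int_{[0,1]^2}|U-W|$, and $d_\square(U,W)=\|U-W\|_\square$, where $\|W\|_\square=\sup_{S,T\subseteq[0,1]\text{ measurable}}\left|\int_{S\times T}W\right|$. Let $x_1,x_2,\dots$ be i.i.d. uniform on $[0,1]$; the same sequence is used for all $n$. $\mathbf{H}(n,W)$ is the random weighted graph on vertex set $\{1,\dots,n\}$, all vertex weights $1$, with edge weight $\beta_{ij}=W(x_i,x_j)$ for distinct $i,j$ and $\beta_{ii}=0$. For a weighted graph $H$ on $\{1,\dots,n\}$ with all vertex weights $1$, edge weights $\beta_{ij}$ and $\beta_{ii}=0$, and for $\rho>0$, $\mathbf{G}(H,\rho)$ is the random graph on $\{1,\dots,n\}$ in which, independently over unordered pairs $ij$, $ij$ is an edge with probability $\min\{\rho|\beta_{ij}|,1\}$, in which case its edge weight is $+1$ if $\beta_{ij}>0$ and $-1$ if $\beta_{ij}<0$ (non-edges have weight $0$). Define $\mathbf{G}(n,W,\rho):=\mathbf{G}(\mathbf{H}(n,W),\rho)$,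 i.e. generated from the same $x_1,\dots,x_n$, with edges conditionally independent given these. Multiplying a graph by a scalar multiplies all its edge weights. These graphs on $n$ vertices are viewed as graphons as follows: the vertices are ordered according to the order of $x_1,\dots,x_n$ as real numbers, the $k$-th vertex in this order is represented by the $k$-th of the $n$ consecutive intervals of length $1/n$ partitioning $[0,1]$, and the graphon takes the constant value given by the edge weight of $ij$ on the product of the intervals of $i$ and $j$. *)

theory Defs
  imports "HOL-Probability.Probability"
begin

text \<open>
  Kernels on $[0,1]^2$ are functions \<open>real \<Rightarrow> real \<Rightarrow> real\<close>; only the values on the unit square
  matter. \<open>set_integrable lborel\<close> entails Borel measurability on the square.
\<close>

definition graphon :: "(real \<Rightarrow> real \<Rightarrow> real) \<Rightarrow> bool" where
  "graphon W \<longleftrightarrow>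
     set_integrable lborel ({0..1} \<times> {0..1}) (\<lambda>(s, t). W s t) \<and>
     (\<forall>s\<in>{0..1}. \<forall>t\<in>{0..1}. W s t = W t s)"

definition L1_norm :: "(real \<Rightarrow> real \<Rightarrow> real) \<Rightarrow> real" where
  "L1_norm W = set_lebesgue_integral lborel ({0..1} \<times> {0..1}) (\<lambda>(s, t). \<bar>W s t\<bar>)"

text \<open>
  For integrable \<open>W\<close> the supremum is over a nonempty set bounded above by \<open>L1_norm W\<close>.
\<close>

definition cut_norm :: "(real \<Rightarrow> real \<Rightarrow> real) \<Rightarrow> real" where
  "cut_norm W =
     (SUP (S, T) \<in> {S \<in> sets borel. S \<subseteq> {0..1}} \<times> {T \<in> sets borel. T \<subseteq> {0..1}}.
        \<bar>set_lebesgue_integral lborel (S \<times> T) (\<lambda>(s, t). W s t)\<bar>)"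

definition d1 :: "(real \<Rightarrow> real \<Rightarrow> real) \<Rightarrow> (real \<Rightarrow> real \<Rightarrow> real) \<Rightarrow> real" where
  "d1 U W = L1_norm (\<lambda>s t. U s t - W s t)"

definition d_cut :: "(real \<Rightarrow> real \<Rightarrow> real) \<Rightarrow> (real \<Rightarrow> real \<Rightarrow> real) \<Rightarrow> real" where
  "d_cut U W = cut_norm (\<lambda>s t. U s t - W s t)"

text \<open>
  A weighted graph on $\{1,\dots,n\}$ with unit vertex weights is given by its matrix of edge
  weights, which vanishes outside the vertex set; non-edges have weight 0.
\<close>

type_synonym wgraph = "nat \<Rightarrow> nat \<Rightarrow> real"

definition H_graph :: "nat \<Rightarrow> (real \<Rightarrow> real \<Rightarrow> real) \<Rightarrow> (nat \<Rightarrow> real) \<Rightarrow> wgraph" where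
  "H_graph n W x i j = (if i \<in> {1..n} \<and> j \<in> {1..n} \<and> i \<noteq> j then W (x i) (x j) else 0)"

definition edge_pmf :: "real \<Rightarrow> real \<Rightarrow> real pmf" where
  "edge_pmf \<rho> b =
     map_pmf (\<lambda>present. if present then sgn b else 0) (bernoulli_pmf (min (\<rho> * \<bar>b\<bar>) 1))"

text \<open>
  The law of $\mathbf{G}(H,\rho)$: the edges are sampled independently over the pairs \<open>i < j\<close>, and
  the outcome is then symmetrised.
\<close>

definition G_pmf :: "nat \<Rightarrow> wgraph \<Rightarrow> real \<Rightarrow> wgraph pmf" where
  "G_pmf n \<beta> \<rho> =
     map_pmf (\<lambda>g i j. if i < j then g (i, j) else if j < i then g (j, i) else 0)
       (Pi_pmf {(i, j). 1 \<le> i \<and> i < j \<and> j \<le> n} 0 (\<lambda>(i, j). edge_pmf \<rho> (\<beta> i j)))"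

text \<open>
  The position of vertex \<open>i\<close>, counted from 1, in the order of \<open>x 1, \<dots>, x n\<close>. Ties, which have
  probability zero below, are broken by index, so that this is always a permutation of \<open>{1..n}\<close>.
\<close>

definition vertex_rank :: "nat \<Rightarrow> (nat \<Rightarrow> real) \<Rightarrow> nat \<Rightarrow> nat" where
  "vertex_rank n x i = card {j \<in> {1..n}. x j < x i \<or> x j = x i \<and> j \<le> i}"

definition block :: "nat \<Rightarrow> nat \<Rightarrow> real set" where
  "block n k = {(real k - 1) / real n ..< real k / real n} \<union> (if k = n then {1} else {})"

definition graph_graphon :: "nat \<Rightarrow> (nat \<Rightarrow> real) \<Rightarrow> wgraph \<Rightarrow> real \<Rightarrow> real \<Rightarrow> real" where
  "graph_graphon n x \<beta> s t =
     (\<Sum>i\<in>{1..n}. \<Sum>j\<in>{1..n}.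
        \<beta> i j * indicator (block n (vertex_rank n x i)) s
              * indicator (block n (vertex_rank n x j)) t)"

definition iid_uniform :: "'a measure \<Rightarrow> (nat \<Rightarrow> 'a \<Rightarrow> real) \<Rightarrow> bool" where
  "iid_uniform M x \<longleftrightarrow>
     prob_space.indep_vars M (\<lambda>_. borel) x {1..} \<and>
     (\<forall>i\<ge>1. distr M lborel (x i) = uniform_measure lborel {0..1})"

text \<open>
  \<open>K \<omega>\<close> is a version of the conditional law given \<open>F\<close> of the discrete random variable \<open>X\<close>.
\<close>

definition has_cond_pmf ::
  "'a measure \<Rightarrow> 'a measure \<Rightarrow> ('a \<Rightarrow> 'b) \<Rightarrow> ('a \<Rightarrow> 'b pmf) \<Rightarrow> bool" where
  "has_cond_pmf M F X K \<longleftrightarrow>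
     X \<in> measurable M (count_space UNIV) \<and>
     (\<forall>b. AE \<omega> in M. real_cond_exp M F (indicator {\<omega>. X \<omega> = b}) \<omega> = pmf (K \<omega>) b)"

definition sample_algebra :: "'a measure \<Rightarrow> (nat \<Rightarrow> 'a \<Rightarrow> real) \<Rightarrow> nat \<Rightarrow> 'a measure" where
  "sample_algebra M x n =
     vimage_algebra (space M) (\<lambda>\<omega>. \<lambda>i\<in>{1..n}. x i \<omega>) (\<Pi>\<^sub>M i\<in>{1..n}. borel)"

text \<open>
  \<open>G\<close> is distributed as $\mathbf{G}(n,W,\rho)$ generated from the given points \<open>x 1, \<dots>, x n\<close>.
  Only the conditional law of the single graph \<open>G\<close> is prescribed: for a sequence of such graphs,
  one for each \<open>n\<close>, the dependence between different \<open>n\<close> is arbitrary.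
\<close>

definition is_G_graph ::
  "'a measure \<Rightarrow> (nat \<Rightarrow> 'a \<Rightarrow> real) \<Rightarrow> nat \<Rightarrow> (real \<Rightarrow> real \<Rightarrow> real) \<Rightarrow> real \<Rightarrow> ('a \<Rightarrow> wgraph) \<Rightarrow> bool"
where
  "is_G_graph M x n W \<rho> G \<longleftrightarrow>
     has_cond_pmf M (sample_algebra M x n) G
       (\<lambda>\<omega>. G_pmf n (H_graph n W (\<lambda>i. x i \<omega>)) \<rho>)"

end

theory Submission
  imports Defs "HOL-Combinatorics.Permutations" "HOL-Real_Asymp.Real_Asymp"
begin

text \<open>
  Both parts rest on a weak-type maximal inequality for U-statistics: for \<open>f \<ge> 0\<close> the averages of
  \<open>f (x i) (x j)\<close> over the pairs \<open>i \<noteq> j\<close> in \<open>{1..n}\<close> form a reverse martingale, so their supremum over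
  \<open>n\<close> exceeds \<open>u\<close> with probability at most \<open>L1_norm f / u\<close>. Applied to \<open>\<bar>W - U k\<bar>\<close> for continuous
  \<open>U k\<close> that converge to \<open>W\<close> geometrically fast in \<open>L1\<close>, it reduces (a) to continuous kernels, for
  which the claim follows from uniform continuity and the convergence of the empirical distribution.

  For (b), the conditional mean of \<open>\<rho>\<inverse> G\<close> is \<open>H\<close> truncated at \<open>1 / \<rho>\<close>; the truncation costs at most
  \<open>\<bar>W - U k\<bar>\<close> once \<open>\<bar>U k\<bar> \<le> 1 / \<rho>\<close>. By bilinearity the cut norm of a step function is attained on
  unions of blocks, and for each of these \<open>4 ^ n\<close> pairs of vertex sets a Chernoff bound gives a deviation
  probability \<open>exp (- c \<rho> n\<^sup>2)\<close>. As \<open>n \<rho> \<longlonglongrightarrow> \<infinity>\<close>, this beats the union bound and is summable, so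
  Borel--Cantelli applies whatever the dependence between different \<open>n\<close>.
\<close>

section \<open>Graphons of finite graphs\<close>

text \<open>An L1 graphon has no moments beyond the first, so tail bounds summable over n are out of
  reach for the weights \<open>W (x i) (x j)\<close> themselves. Borel--Cantelli over n is reserved
  for bounded variables, namely the indicators behind the empirical distribution and the edges; for
  the approximation error it runs over the index k instead, and the maximal inequality covers all n
  at once. In (b), treating an edge merely as a variable with values in [-1, 1] would give deviation
  probabilities exp (- c \<rho>^2 n^2), which need not beat 4^n when only n \<rho> tends to
  infinity. The variance of an edge is of order \<rho>, and this turns \<rho>^2 into \<rho>. The
  constant in the exponent still depends on the average of \<bar>W (x i) (x j)\<bar>, a random
  quantity; each integer bound for it is treated separately, and countably many almost sure events
  are intersected.\<close>

lemma vertex_rank_bij: "bij_betw (vertex_rank n x) {1..n} {1..n}"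
proof -
  let ?A = "\<lambda>i. {j \<in> {1..n}. x j < x i \<or> x j = x i \<and> j \<le> i}"
  \<comment> \<open>Ties broken by index make the order of the pairs \<open>(x i, i)\<close> total
    and strict, and the rank is strictly increasing for it. Injectivity follows, and an injective
    self-map of a finite set is onto.\<close>
  have less: "vertex_rank n x i < vertex_rank n x k"
    if "i \<in> {1..n}" "k \<in> {1..n}" "x i < x k \<or> x i = x k \<and> i < k" for i k
    unfolding vertex_rank_def
  proof (rule psubset_card_mono)
    have "k \<in> ?A k" "k \<notin> ?A i" using that by auto
    moreover have "?A i \<subseteq> ?A k" using that by auto
    ultimately show "?A i \<subset> ?A k" by blast
  qed simp
  have inj: "inj_on (vertex_rank n x) {1..n}"
  proof (rule inj_onI)
    fix i k assume "i \<in> {1..n}" "k \<in> {1..n}" "vertex_rank n x i = vertex_rank n x k"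
    with less[of i k] less[of k i] show "i = k"
      by (cases "x i" "x k" rule: linorder_cases; cases i k rule: linorder_cases) auto
  qed
  have "vertex_rank n x ` {1..n} \<subseteq> {1..n}"
  proof safe
    fix i assume i: "i \<in> {1..n}"
    have "card (?A i) \<le> card {1..n}" by (rule card_mono) auto
    moreover have "card (?A i) > 0" using i by (subst card_gt_0_iff) auto
    ultimately show "vertex_rank n x i \<in> {1..n}" unfolding vertex_rank_def by auto
  qed
  with inj show ?thesis
    by (simp add: bij_betw_def endo_inj_surj)
qed

lemma vertex_rank_in: "i \<in> {1..n} \<Longrightarrow> vertex_rank n x i \<in> {1..n}"
  using vertex_rank_bij[of n x] bij_betwE by blast

lemma block_borel [measurable]: "block n k \<in> sets borel"
  unfolding block_def by simp

lemma block_subset: "k \<in> {1..n} \<Longrightarrow> block n k \<subseteq> {0..1}"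
proof
  fix s assume k: "k \<in> {1..n}" and s: "s \<in> block n k"
  have "real k / real n \<le> 1" "0 \<le> (real k - 1) / real n" using k by auto
  with s show "s \<in> {0..1}" unfolding block_def
    by (cases "k = n") (simp_all, linarith+)
qed

lemma block_le: "s \<in> block n k \<Longrightarrow> (real k - 1) / real n \<le> s \<and> s \<le> real k / real n" if "n \<ge> 1"
proof -
  have "real k / real n = 1" if "k = n" using that \<open>n \<ge> 1\<close> by simp
  moreover have "(real k - 1) / real n \<le> real k / real n" by (simp add: divide_right_mono)
  ultimately show "(real k - 1) / real n \<le> s \<and> s \<le> real k / real n" if "s \<in> block n k"
    using that unfolding block_def by (auto split: if_splits)
qed

lemma measure_block: "measure lborel (block n k) = 1 / real n" if "n \<ge> 1"
proof -
  have "measure lborel (block n k) = measure lborel {(real k - 1) / real n ..< real k / real n}"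
  proof (intro measure_eq_AE)
    show "AE s in lborel. (s \<in> block n k) = (s \<in> {(real k - 1) / real n..<real k / real n})"
      using AE_lborel_singleton[of "1::real"] by eventually_elim (auto simp: block_def)
  qed auto
  also have "\<dots> = 1 / real n"
    by (simp add: divide_right_mono diff_divide_distrib)
  finally show ?thesis .
qed

lemma ex1_block:
  assumes "n \<ge> 1" "s \<in> {0..1}"
  shows "\<exists>!k. k \<in> {1..n} \<and> s \<in> block n k"
proof (rule ex_ex1I)
  show "\<exists>k. k \<in> {1..n} \<and> s \<in> block n k"
  \<comment> \<open>At s = 1 the floor formula would point to block n + 1, so block n has been given
    this endpoint. Elsewhere the + 1 accounts for blocks being counted from 1.\<close>
  proof (cases "s = 1")
    case True
    then show ?thesis using assms by (intro exI[of _ n]) (auto simp: block_def)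
  next
    case False
    let ?k = "nat \<lfloor>s * n\<rfloor> + 1"
    have fl: "real (nat \<lfloor>s * n\<rfloor>) = of_int \<lfloor>s * n\<rfloor>" using assms by simp
    have "s * n < n" using False assms by simp
    then have "\<lfloor>s * n\<rfloor> < int n" by (simp add: floor_less_iff)
    then have "?k \<le> n" using assms by simp
    moreover have "s \<in> block n ?k"
      using assms fl of_int_floor_le[of "s*n"] floor_correct[of "s * n"] unfolding block_def by (auto simp: field_simps)
    ultimately show ?thesis by (intro exI[of _ ?k]) auto
  qed
next
  \<comment> \<open>Block k with k < l \<le> n excludes its right end, and this end is at most the
    left end of block l.\<close>
  have *: False if "k < l" "l \<le> n" "s \<in> block n k" "s \<in> block n l" for k l
  proof -
    have "s < real k / n" using that by (auto simp: block_def split: if_splits)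
    moreover have "(real l - 1) / n \<le> s" using block_le[OF assms(1) that(4)] by auto
    moreover have "real k / n \<le> (real l - 1) / n" using that by (intro divide_right_mono) auto
    ultimately show False by linarith
  qed
  fix k l assume "k \<in> {1..n} \<and> s \<in> block n k" "l \<in> {1..n} \<and> s \<in> block n l"
  with *[of k l] *[of l k] show "k = l" by (cases k l rule: linorder_cases) auto
qed

lemma ex1_vertex_block:
  assumes "n \<ge> 1" "s \<in> {0..1}"
  shows "\<exists>!i. i \<in> {1..n} \<and> s \<in> block n (vertex_rank n x i)"
proof -
  obtain k where k: "k \<in> {1..n}" "s \<in> block n k" "\<And>l. l \<in> {1..n} \<Longrightarrow> s \<in> block n l \<Longrightarrow> l = k"
    using ex1_block[OF assms] by blast
  have "k \<in> vertex_rank n x ` {1..n}"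
    using bij_betw_imp_surj_on[OF vertex_rank_bij] k(1) by simp
  then obtain i where i: "i \<in> {1..n}" "vertex_rank n x i = k" by blast
  show ?thesis
  proof (rule ex1I[of _ i])
    fix j assume j: "j \<in> {1..n} \<and> s \<in> block n (vertex_rank n x j)"
    then have "vertex_rank n x j = k"
      by (intro k(3) vertex_rank_in) auto
    with i have "vertex_rank n x j = vertex_rank n x i" by simp
    then show "j = i"
      by (rule inj_onD[OF bij_betw_imp_inj_on[OF vertex_rank_bij]]) (use i j in auto)
  qed (use i k(1,2) in auto)
qed

lemma graph_graphon_eq:
  assumes "n \<ge> 1" "i \<in> {1..n}" "s \<in> block n (vertex_rank n x i)"
    "j \<in> {1..n}" "t \<in> block n (vertex_rank n x j)"
  shows "graph_graphon n x \<beta> s t = \<beta> i j"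
proof -
  have st: "s \<in> {0..1}" "t \<in> {0..1}"
    using assms(3,5) block_subset[OF vertex_rank_in[OF assms(2), of x]]
      block_subset[OF vertex_rank_in[OF assms(4), of x]] by blast+
  have si: "indicator (block n (vertex_rank n x k)) s = (if k = i then 1 else 0 :: real)"
    if "k \<in> {1..n}" for k
    using ex1_vertex_block[OF assms(1) st(1), of x] assms that by (auto simp: indicator_def)
  have tj: "indicator (block n (vertex_rank n x k)) t = (if k = j then 1 else 0 :: real)"
    if "k \<in> {1..n}" for k
    using ex1_vertex_block[OF assms(1) st(2), of x] assms that by (auto simp: indicator_def)
  have "graph_graphon n x \<beta> s t =
    (\<Sum>k\<in>{1..n}. \<Sum>l\<in>{1..n}. if k = i then if l = j then \<beta> k l else 0 else 0)"
    unfolding graph_graphon_def by (intro sum.cong refl) (simp add: si tj)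
  also have "\<dots> = (\<Sum>k\<in>{1..n}. if k = i then \<beta> k j else 0)"
    using assms by (intro sum.cong refl) auto
  also have "\<dots> = \<beta> i j" using assms by simp
  finally show ?thesis .
qed

text \<open>The vertices come from the point alone: the same \<open>i\<close> and \<open>j\<close>
  serve for every \<open>\<beta>\<close>, so that several graphs on one sample can be compared at a
  point.\<close>

lemma graph_graphon_cases:
  assumes "n \<ge> 1" "s \<in> {0..1}" "t \<in> {0..1}"
  obtains i j where "i \<in> {1..n}" "j \<in> {1..n}"
    "s \<in> block n (vertex_rank n x i)" "t \<in> block n (vertex_rank n x j)"
    "\<And>\<beta>. graph_graphon n x \<beta> s t = \<beta> i j"
proof -
  obtain i where i: "i \<in> {1..n}" "s \<in> block n (vertex_rank n x i)"
    using ex1_vertex_block[OF assms(1,2)] by blast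
  obtain j where j: "j \<in> {1..n}" "t \<in> block n (vertex_rank n x j)"
    using ex1_vertex_block[OF assms(1,3)] by blast
  show thesis by (rule that[OF i(1) j(1) i(2) j(2)]) (rule graph_graphon_eq[OF assms(1) i j])
qed

lemma graph_graphon_diff:
  "graph_graphon n x \<beta> s t - graph_graphon n x \<gamma> s t = graph_graphon n x (\<lambda>i j. \<beta> i j - \<gamma> i j) s t"
  unfolding graph_graphon_def by (simp add: left_diff_distrib sum_subtractf)

lemma graph_graphon_has_integral:
  assumes [measurable]: "S \<in> sets borel" "T \<in> sets borel" and ST: "S \<subseteq> {0..1}" "T \<subseteq> {0..1}"
  shows "set_integrable lborel (S \<times> T) (\<lambda>(s, t). graph_graphon n x \<beta> s t)" (is ?int)
    and "set_lebesgue_integral lborel (S \<times> T) (\<lambda>(s, t). graph_graphon n x \<beta> s t) =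
      (\<Sum>i\<in>{1..n}. \<Sum>j\<in>{1..n}. \<beta> i j *
        (measure lborel (S \<inter> block n (vertex_rank n x i)) * measure lborel (T \<inter> block n (vertex_rank n x j))))"
      (is ?eq)
proof -
  let ?B = "\<lambda>i. block n (vertex_rank n x i)"
  have fin: "emeasure lborel A < \<infinity>" if "A \<subseteq> {0..1::real}" for A
    using emeasure_mono[OF that, of lborel] by (auto simp: top.not_eq_extremum intro: order.strict_trans1)
  have hbi: "has_bochner_integral lborel
      (\<lambda>z. \<beta> i j * indicator ((S \<inter> ?B i) \<times> (T \<inter> ?B j)) z)
      (\<beta> i j * (measure lborel (S \<inter> ?B i) * measure lborel (T \<inter> ?B j)))" for i j
  proof -
    have em: "emeasure lborel ((S \<inter> ?B i) \<times> (T \<inter> ?B j)) =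
        emeasure lborel (S \<inter> ?B i) * emeasure lborel (T \<inter> ?B j)"
      by (subst lborel_prod[symmetric], subst lborel.emeasure_pair_measure_Times) auto
    have "has_bochner_integral lborel (indicator ((S \<inter> ?B i) \<times> (T \<inter> ?B j)))
       (measure lborel ((S \<inter> ?B i) \<times> (T \<inter> ?B j)))"
    proof (rule has_bochner_integral_real_indicator)
      show "(S \<inter> ?B i) \<times> (T \<inter> ?B j) \<in> sets lborel"
        by (simp add: borel_prod[symmetric] del: borel_prod)
      show "emeasure lborel ((S \<inter> ?B i) \<times> (T \<inter> ?B j)) < \<infinity>"
        unfolding em using fin[of "S \<inter> ?B i"] fin[of "T \<inter> ?B j"] ST
        by (auto simp: ennreal_mult_less_top)
    qed
    also have "measure lborel ((S \<inter> ?B i) \<times> (T \<inter> ?B j)) = measure lborel (S \<inter> ?B i) * measure lborel (T \<inter> ?B j)"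
      by (simp add: measure_def em enn2real_mult)
    finally show ?thesis by (rule has_bochner_integral_mult_right)
  qed
  have "has_bochner_integral lborel
      (\<lambda>z. \<Sum>i\<in>{1..n}. \<Sum>j\<in>{1..n}. \<beta> i j * indicator ((S \<inter> ?B i) \<times> (T \<inter> ?B j)) z)
      (\<Sum>i\<in>{1..n}. \<Sum>j\<in>{1..n}. \<beta> i j * (measure lborel (S \<inter> ?B i) * measure lborel (T \<inter> ?B j)))"
    by (intro has_bochner_integral_sum hbi)
  also have "(\<lambda>z. \<Sum>i\<in>{1..n}. \<Sum>j\<in>{1..n}. \<beta> i j * indicator ((S \<inter> ?B i) \<times> (T \<inter> ?B j)) z) =
     (\<lambda>z. indicator (S \<times> T) z *\<^sub>R (case z of (s, t) \<Rightarrow> graph_graphon n x \<beta> s t))"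
    unfolding graph_graphon_def
    by (auto simp: fun_eq_iff sum_distrib_left indicator_inter_arith intro!: sum.cong split: split_indicator)
  finally show ?int ?eq
    unfolding set_integrable_def set_lebesgue_integral_def
    by (auto simp: has_bochner_integral_iff)
qed

lemma L1_norm_nonneg: "L1_norm A \<ge> 0"
  unfolding L1_norm_def set_lebesgue_integral_def
  by (rule Bochner_Integration.integral_nonneg) (auto split: split_indicator)

text \<open>The graphon is constant on each cell, so the absolute value passes to the weights, and
  every cell has area 1 / n^2.\<close>

lemma L1_norm_graph_graphon_le:
  assumes "n \<ge> 1"
  shows "L1_norm (graph_graphon n x \<beta>) \<le> (\<Sum>i\<in>{1..n}. \<Sum>j\<in>{1..n}. \<bar>\<beta> i j\<bar>) / (real n)\<^sup>2"
proof -
  have "L1_norm (graph_graphon n x \<beta>) =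
     set_lebesgue_integral lborel ({0..1} \<times> {0..1}) (\<lambda>(s, t). graph_graphon n x (\<lambda>i j. \<bar>\<beta> i j\<bar>) s t)"
    unfolding L1_norm_def
  proof (rule set_lebesgue_integral_cong)
    show "\<forall>z. z \<in> {0..1} \<times> {0..1} \<longrightarrow> (case z of (s, t) \<Rightarrow> \<bar>graph_graphon n x \<beta> s t\<bar>) =
        (case z of (s, t) \<Rightarrow> graph_graphon n x (\<lambda>i j. \<bar>\<beta> i j\<bar>) s t)"
    proof safe
      fix s t :: real assume "s \<in> {0..1}" "t \<in> {0..1}"
      then obtain i j where "\<And>\<beta>. graph_graphon n x \<beta> s t = \<beta> i j"
        by (rule graph_graphon_cases[OF assms]) blast
      then show "\<bar>graph_graphon n x \<beta> s t\<bar> = graph_graphon n x (\<lambda>i j. \<bar>\<beta> i j\<bar>) s t" by simp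
    qed
  qed (simp add: borel_prod[symmetric] del: borel_prod)
  also have "\<dots> = (\<Sum>i\<in>{1..n}. \<Sum>j\<in>{1..n}. \<bar>\<beta> i j\<bar> * (1 / real n * (1 / real n)))"
  proof -
    have "{0..1} \<inter> block n (vertex_rank n x i) = block n (vertex_rank n x i)" if "i \<in> {1..n}" for i
      using block_subset[OF vertex_rank_in[OF that, of x]] by blast
    then show ?thesis
      by (subst graph_graphon_has_integral(2)) (auto simp: measure_block assms)
  qed
  also have "\<dots> = (\<Sum>i\<in>{1..n}. \<Sum>j\<in>{1..n}. \<bar>\<beta> i j\<bar>) / (real n)\<^sup>2"
    by (simp add: sum_divide_distrib power2_eq_square)
  finally show ?thesis by simp
qed

section \<open>Bilinear forms on cubes and rectangle integrals of step functions\<close>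

lemma linear_box_bound:
  fixes c u :: "'b \<Rightarrow> real"
  assumes "finite I" "\<And>i. i \<in> I \<Longrightarrow> u i \<in> {0..1}"
  obtains S where "S \<subseteq> I" "(\<Sum>i\<in>I. c i * u i) \<le> sum c S"
proof
  \<comment> \<open>A linear form on the unit cube is maximised at the vertex that selects exactly
    the positive coefficients.\<close>
  show "{i\<in>I. c i > 0} \<subseteq> I" by auto
  have "(\<Sum>i\<in>I. c i * u i) \<le> (\<Sum>i\<in>I. if c i > 0 then c i else 0)"
    using assms by (intro sum_mono) (auto intro: mult_left_le mult_nonpos_nonneg)
  also have "\<dots> = sum c {i\<in>I. c i > 0}"
    using assms(1) by (simp add: sum.inter_filter)
  finally show "(\<Sum>i\<in>I. c i * u i) \<le> sum c {i\<in>I. c i > 0}" .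
qed

text \<open>The form is linear in each variable separately, so first \<open>u\<close> and then
  \<open>v\<close> can be moved to a vertex of its cube without decreasing the value; a pair of
  vertices is a pair of index sets.\<close>

lemma bilinear_box_bound:
  fixes a :: "'b \<Rightarrow> 'c \<Rightarrow> real"
  assumes fin: "finite I" "finite J"
    and u: "\<And>i. i \<in> I \<Longrightarrow> u i \<in> {0..1}" and v: "\<And>j. j \<in> J \<Longrightarrow> v j \<in> {0..1}"
    and le: "\<And>S T. S \<subseteq> I \<Longrightarrow> T \<subseteq> J \<Longrightarrow> \<bar>\<Sum>i\<in>S. \<Sum>j\<in>T. a i j\<bar> \<le> c"
  shows "\<bar>\<Sum>i\<in>I. \<Sum>j\<in>J. a i j * (u i * v j)\<bar> \<le> c"
proof -
  have *: "(\<Sum>i\<in>I. \<Sum>j\<in>J. a i j * (u i * v j)) \<le> c"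
    if le: "\<And>S T. S \<subseteq> I \<Longrightarrow> T \<subseteq> J \<Longrightarrow> \<bar>\<Sum>i\<in>S. \<Sum>j\<in>T. a i j\<bar> \<le> c" for a :: "'b \<Rightarrow> 'c \<Rightarrow> real"
  proof -
    obtain S where S: "S \<subseteq> I" "(\<Sum>i\<in>I. (\<Sum>j\<in>J. a i j * v j) * u i) \<le> (\<Sum>i\<in>S. \<Sum>j\<in>J. a i j * v j)"
      using linear_box_bound[OF fin(1) u] .
    obtain T where T: "T \<subseteq> J" "(\<Sum>j\<in>J. (\<Sum>i\<in>S. a i j) * v j) \<le> (\<Sum>j\<in>T. \<Sum>i\<in>S. a i j)"
      using linear_box_bound[OF fin(2) v] .
    have "(\<Sum>i\<in>I. \<Sum>j\<in>J. a i j * (u i * v j)) = (\<Sum>i\<in>I. (\<Sum>j\<in>J. a i j * v j) * u i)"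
      by (simp add: sum_distrib_left mult_ac)
    also note S(2)
    also have "(\<Sum>i\<in>S. \<Sum>j\<in>J. a i j * v j) = (\<Sum>j\<in>J. (\<Sum>i\<in>S. a i j) * v j)"
      by (subst sum.swap) (simp add: sum_distrib_right)
    also note T(2)
    also have "(\<Sum>j\<in>T. \<Sum>i\<in>S. a i j) = (\<Sum>i\<in>S. \<Sum>j\<in>T. a i j)" by (rule sum.swap)
    also have "\<dots> \<le> c" using le[OF S(1) T(1)] by linarith
    finally show ?thesis .
  qed
  \<comment> \<open>The lower bound is the upper bound for \<open>- a\<close>, whose subset sums
    have the same absolute values.\<close>
  have "(\<Sum>i\<in>I. \<Sum>j\<in>J. - a i j * (u i * v j)) \<le> c"
    by (rule *) (use le in \<open>simp add: sum_negf\<close>)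
  with *[OF le] show ?thesis by (simp add: sum_negf abs_le_iff)
qed

text \<open>The integral sees \<open>S\<close> and \<open>T\<close> only through the fraction of
  each block that they cover. The fractions are points of the unit cube, so arbitrary Borel sets
  reduce to unions of blocks.\<close>

lemma graph_graphon_cut_le:
  assumes n: "n \<ge> 1"
    and le: "\<And>S T. S \<subseteq> {1..n} \<Longrightarrow> T \<subseteq> {1..n} \<Longrightarrow> \<bar>\<Sum>i\<in>S. \<Sum>j\<in>T. \<beta> i j\<bar> \<le> c * (real n)\<^sup>2"
    and ST: "S \<in> sets borel" "T \<in> sets borel" "S \<subseteq> {0..1}" "T \<subseteq> {0..1}"
  shows "\<bar>set_lebesgue_integral lborel (S \<times> T) (\<lambda>(s, t). graph_graphon n x \<beta> s t)\<bar> \<le> c"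
proof -
  define w where "w A i = real n * measure lborel (A \<inter> block n (vertex_rank n x i))" for A i
  have w: "w A i \<in> {0..1}" if "A \<in> sets borel" "A \<subseteq> {0..1}" for A i
  proof -
    \<comment> \<open>Only finiteness matters here: it makes the block \<open>fmeasurable\<close>,
      as monotonicity of \<open>measure\<close> requires.\<close>
    have "emeasure lborel (block n k) \<le> 2" for k
    proof -
      have "emeasure lborel (block n k) \<le> emeasure lborel ({(real k - 1) / real n ..< real k / real n} \<union> {1})"
        by (rule emeasure_mono) (auto simp: block_def)
      also have "\<dots> \<le> emeasure lborel {(real k - 1) / real n ..< real k / real n} + emeasure lborel {1::real}"
        by (rule emeasure_subadditive) auto
      also have "\<dots> \<le> ennreal (1 / real n)"
        by (simp add: divide_right_mono diff_divide_distrib)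
      also have "\<dots> \<le> ennreal 2" using n by (intro ennreal_leI) (auto simp: field_simps)
      finally show ?thesis by simp
    qed
    then have "block n (vertex_rank n x i) \<in> fmeasurable lborel"
      by (intro fmeasurableI) (auto intro: le_less_trans[OF \<open>emeasure lborel (block n (vertex_rank n x i)) \<le> 2\<close>])
    then have "measure lborel (A \<inter> block n (vertex_rank n x i)) \<le> measure lborel (block n (vertex_rank n x i))"
      using that by (intro measure_mono_fmeasurable) auto
    then show ?thesis using n by (auto simp: w_def measure_block field_simps)
  qed
  have "set_lebesgue_integral lborel (S \<times> T) (\<lambda>(s, t). graph_graphon n x \<beta> s t) =
      (\<Sum>i\<in>{1..n}. \<Sum>j\<in>{1..n}. \<beta> i j * (w S i * w T j)) / (real n)\<^sup>2"
    unfolding graph_graphon_has_integral(2)[OF ST] sum_divide_distrib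
    using n by (intro sum.cong refl) (simp add: w_def power2_eq_square)
  moreover have "\<bar>\<Sum>i\<in>{1..n}. \<Sum>j\<in>{1..n}. \<beta> i j * (w S i * w T j)\<bar> \<le> c * (real n)\<^sup>2"
    by (rule bilinear_box_bound) (use le w ST in auto)
  ultimately show ?thesis using n by (simp add: abs_divide divide_le_eq)
qed

lemma set_integral_rectangle_le_L1_norm:
  assumes int: "set_integrable lborel ({0..1} \<times> {0..1}) (\<lambda>(s, t). U s t)"
    and ST: "S \<in> sets borel" "T \<in> sets borel" "S \<subseteq> {0..1}" "T \<subseteq> {0..1}"
  shows "\<bar>set_lebesgue_integral lborel (S \<times> T) (\<lambda>(s, t). U s t)\<bar> \<le> L1_norm U"
proof -
  have meas [measurable]: "S \<times> T \<in> sets lborel"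
    unfolding sets_lborel borel_prod[symmetric] using ST by (intro pair_measureI)
  have i: "set_integrable lborel (S \<times> T) (\<lambda>(s, t). U s t)"
    by (rule set_integrable_subset[OF int]) (use ST meas in auto)
  have "\<bar>set_lebesgue_integral lborel (S \<times> T) (\<lambda>(s, t). U s t)\<bar> \<le>
      (LINT z|lborel. norm (indicator (S \<times> T) z *\<^sub>R (case z of (s, t) \<Rightarrow> U s t)))"
    unfolding set_lebesgue_integral_def real_norm_def[symmetric] by (rule integral_norm_bound)
  also have "\<dots> \<le> L1_norm U"
    unfolding L1_norm_def set_lebesgue_integral_def
  proof (rule integral_mono)
    show "integrable lborel (\<lambda>z. norm (indicator (S \<times> T) z *\<^sub>R (case z of (s, t) \<Rightarrow> U s t)))"
      using i unfolding set_integrable_def by (rule integrable_norm)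
    have "set_integrable lborel ({0..1} \<times> {0..1}) (\<lambda>z. \<bar>case z of (s, t) \<Rightarrow> U s t\<bar>)"
      using int by (rule set_integrable_abs)
    then show "integrable lborel (\<lambda>z. indicator ({0..1} \<times> {0..1}) z *\<^sub>R (case z of (s, t) \<Rightarrow> \<bar>U s t\<bar>))"
      unfolding set_integrable_def by (simp add: case_prod_unfold)
  qed (use ST in \<open>auto simp: indicator_def split: prod.splits\<close>)
  finally show ?thesis .
qed

text \<open>\<open>cut_norm\<close> is a supremum of reals, so even the lower estimate rests on the
  uniform bound: boundedness makes the supremum an upper bound, and the empty rectangle contributes
  0.\<close>

lemma d_cut_bounds:
  assumes "\<And>S T. S \<in> sets borel \<Longrightarrow> T \<in> sets borel \<Longrightarrow> S \<subseteq> {0..1} \<Longrightarrow> T \<subseteq> {0..1} \<Longrightarrow>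
     \<bar>set_lebesgue_integral lborel (S \<times> T) (\<lambda>(s, t). U s t - W s t)\<bar> \<le> c"
  shows "0 \<le> d_cut U W" "d_cut U W \<le> c"
proof -
  let ?F = "{S \<in> sets borel. S \<subseteq> {0..1::real}}"
  have ne: "({}, {}) \<in> ?F \<times> ?F" by simp
  have bdd: "bdd_above ((\<lambda>(S, T). \<bar>set_lebesgue_integral lborel (S \<times> T) (\<lambda>(s, t). U s t - W s t)\<bar>) ` (?F \<times> ?F))"
    by (rule bdd_aboveI[of _ c]) (use assms in auto)
  show "d_cut U W \<le> c"
    unfolding d_cut_def cut_norm_def by (rule cSUP_least) (use ne assms in auto)
  show "0 \<le> d_cut U W"
    unfolding d_cut_def cut_norm_def
    by (rule order_trans[OF _ cSUP_upper[OF ne bdd]]) simp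
qed

section \<open>Approximation by continuous functions\<close>

text \<open>Measurability provides continuous functions converging almost everywhere, but nothing
  that dominates them. Clipping at a high level m makes dominated convergence available on a set of
  finite measure; clipping and approximating each cost less than e / 2.\<close>

lemma continuous_L1_approx:
  fixes f :: "'a::euclidean_space \<Rightarrow> real"
  assumes f: "set_integrable lborel S f" and S [measurable]: "S \<in> sets borel"
    and fin: "emeasure lborel S < \<infinity>" and e: "e > 0"
  obtains g where "continuous_on UNIV g" "set_integrable lborel S g"
    "(LINT z:S|lborel. \<bar>f z - g z\<bar>) < e"
proof -
  define h where "h z = indicator S z * f z" for z
  have h: "integrable lborel h" using f by (simp add: h_def[abs_def] set_integrable_def)
  then have [measurable]: "h \<in> borel_measurable borel" by simp
  \<comment> \<open>Clipping to [-m, m] is continuous and idempotent, so applying it to the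
    approximants keeps them continuous and leaves their limit \<open>c m (h z)\<close>
    unchanged.\<close>
  define c where "c m y = max (- real m) (min (real m) y)" for m and y :: real
  have c [measurable]: "c m \<in> borel_measurable borel" for m by (simp add: c_def[abs_def])
  have c_bd: "\<bar>c m y\<bar> \<le> real m" for m y by (auto simp: c_def)
  have c_diff: "\<bar>y - c m y\<bar> \<le> \<bar>y\<bar>" for m y by (auto simp: c_def)
  have c_idem: "c m (c m y) = c m y" for m y by (auto simp: c_def)
  have c_cont: "continuous_on UNIV (c m)" for m
    unfolding c_def[abs_def] by (intro continuous_on_max continuous_on_min continuous_on_const continuous_on_id)
  have intS: "integrable lborel (indicator S :: 'a \<Rightarrow> real)"
    using fin by (simp add: integrable_indicator_iff)
  have "(\<lambda>m. LINT z|lborel. \<bar>h z - c m (h z)\<bar>) \<longlonglongrightarrow> (LINT z|(lborel :: 'a measure). 0 :: real)"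
  proof (rule integral_dominated_convergence[where w = "\<lambda>z. \<bar>h z\<bar>"])
    show "AE z in lborel. (\<lambda>m. \<bar>h z - c m (h z)\<bar>) \<longlonglongrightarrow> 0"
    proof (rule AE_I2)
      fix z
      have "eventually (\<lambda>m. \<bar>h z\<bar> \<le> real m) sequentially"
        using filterlim_real_sequentially unfolding filterlim_at_top by blast
      then have "eventually (\<lambda>m. \<bar>h z - c m (h z)\<bar> = 0) sequentially"
        by eventually_elim (auto simp: c_def)
      then show "(\<lambda>m. \<bar>h z - c m (h z)\<bar>) \<longlonglongrightarrow> 0" by (rule tendsto_eventually)
    qed
    show "AE z in lborel. norm \<bar>h z - c m (h z)\<bar> \<le> \<bar>h z\<bar>" for m by (simp add: c_diff)
  qed (use h in auto)
  then have "eventually (\<lambda>m. (LINT z|lborel. \<bar>h z - c m (h z)\<bar>) < e / 2) sequentially"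
    by (rule order_tendstoD(2)) (use e in simp)
  then obtain m where m: "(LINT z|lborel. \<bar>h z - c m (h z)\<bar>) < e / 2"
    using eventually_happens by fastforce
  \<comment> \<open>\<open>measurable_on\<close> means being the limit of continuous functions off a
    negligible set; that set is null for the completed measure, and the almost everywhere statement
    is carried back to \<open>lborel\<close>.\<close>
  have "(\<lambda>z. c m (h z)) measurable_on UNIV"
    by (rule lebesgue_measurable_imp_measurable_on) (auto intro: measurable_completion)
  then obtain N g where N: "negligible N" and g: "\<And>k. continuous_on UNIV (g k)"
    and lim: "\<And>z. z \<notin> N \<Longrightarrow> (\<lambda>k. g k z) \<longlonglongrightarrow> c m (h z)"
    unfolding measurable_on_def by auto
  have [measurable]: "g k \<in> borel_measurable borel" for k
    using g by (rule borel_measurable_continuous_onI)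
  have "AE z in lebesgue. z \<notin> N"
    using N unfolding negligible_iff_null_sets by (rule AE_not_in)
  then have AE_N: "AE z in lborel. z \<notin> N" unfolding AE_completion_iff .
  have "(\<lambda>k. LINT z|lborel. indicator S z * \<bar>c m (h z) - c m (g k z)\<bar>) \<longlonglongrightarrow> (LINT z|(lborel :: 'a measure). 0 :: real)"
  proof (rule integral_dominated_convergence[where w = "\<lambda>z. 2 * real m * indicator S z"])
    show "AE z in lborel. (\<lambda>k. indicator S z * \<bar>c m (h z) - c m (g k z)\<bar>) \<longlonglongrightarrow> 0"
      using AE_N
    proof eventually_elim
      case (elim z)
      have "(\<lambda>k. indicator S z * \<bar>c m (h z) - c m (g k z)\<bar>) \<longlonglongrightarrow> indicator S z * \<bar>c m (h z) - c m (c m (h z))\<bar>"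
        by (intro tendsto_intros continuous_on_tendsto_compose[OF c_cont lim[OF elim]]) auto
      then show ?case by (simp add: c_idem)
    qed
    show "AE z in lborel. norm (indicator S z * \<bar>c m (h z) - c m (g k z)\<bar>) \<le> 2 * real m * indicator S z" for k
    proof (rule AE_I2)
      fix z
      have "\<bar>c m (h z) - c m (g k z)\<bar> \<le> 2 * real m"
        using c_bd[of m "h z"] c_bd[of m "g k z"] by linarith
      then show "norm (indicator S z * \<bar>c m (h z) - c m (g k z)\<bar>) \<le> 2 * real m * indicator S z"
        by (simp split: split_indicator)
    qed
  qed (use intS in auto)
  then have "eventually (\<lambda>k. (LINT z|lborel. indicator S z * \<bar>c m (h z) - c m (g k z)\<bar>) < e / 2) sequentially"
    by (rule order_tendstoD(2)) (use e in simp)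
  then obtain k where k: "(LINT z|lborel. indicator S z * \<bar>c m (h z) - c m (g k z)\<bar>) < e / 2"
    using eventually_happens by fastforce
  define G where "G z = c m (g k z)" for z
  have [measurable]: "G \<in> borel_measurable borel" unfolding G_def by (rule measurable_compose[OF _ c]) simp
  have intG: "integrable lborel (\<lambda>z. indicator S z * G z)"
    by (rule Bochner_Integration.integrable_bound[OF integrable_mult_right[OF intS, of "real m"]])
       (use c_bd in \<open>simp_all add: G_def split: split_indicator\<close>)
  have inth: "integrable lborel (\<lambda>z. indicator S z * c m (h z))"
    by (rule Bochner_Integration.integrable_bound[OF integrable_mult_right[OF intS, of "real m"]])
       (use c_bd in \<open>simp_all split: split_indicator\<close>)
  \<comment> \<open>\<open>h\<close> vanishes off \<open>S\<close>, and clipping fixes 0.\<close>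
  have ch: "c m (h z) = indicator S z * c m (h z)" for z by (auto simp: h_def c_def indicator_def)
  have int1: "integrable lborel (\<lambda>z. \<bar>h z - c m (h z)\<bar>)"
    by (subst ch) (intro integrable_abs Bochner_Integration.integrable_diff h inth)
  have int2: "integrable lborel (\<lambda>z. indicator S z * \<bar>c m (h z) - G z\<bar>)"
  proof -
    have "integrable lborel (\<lambda>z. \<bar>indicator S z * c m (h z) - indicator S z * G z\<bar>)"
      by (intro integrable_abs Bochner_Integration.integrable_diff inth intG)
    also have "(\<lambda>z. \<bar>indicator S z * c m (h z) - indicator S z * G z\<bar>) =
        (\<lambda>z. indicator S z * \<bar>c m (h z) - G z\<bar>)"
      by (auto simp: indicator_def)
    finally show ?thesis .
  qed
  show thesis
  proof
    show "continuous_on UNIV G"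
      unfolding G_def by (rule continuous_on_compose2[OF c_cont g]) auto
    show sG: "set_integrable lborel S G" using intG by (simp add: set_integrable_def)
    have "(LINT z:S|lborel. \<bar>f z - G z\<bar>) \<le>
        (LINT z|lborel. \<bar>h z - c m (h z)\<bar> + indicator S z * \<bar>c m (h z) - G z\<bar>)"
      unfolding set_lebesgue_integral_def
    proof (rule integral_mono)
      show "integrable lborel (\<lambda>z. indicator S z *\<^sub>R \<bar>f z - G z\<bar>)"
        using set_integrable_abs[OF set_integral_diff(1)[OF f sG]] by (simp add: set_integrable_def)
      show "integrable lborel (\<lambda>z. \<bar>h z - c m (h z)\<bar> + indicator S z * \<bar>c m (h z) - G z\<bar>)"
        by (intro Bochner_Integration.integrable_add int1 int2)
    qed (auto simp: h_def indicator_def)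
    also have "\<dots> = (LINT z|lborel. \<bar>h z - c m (h z)\<bar>) + (LINT z|lborel. indicator S z * \<bar>c m (h z) - G z\<bar>)"
      by (rule Bochner_Integration.integral_add[OF int1 int2])
    also have "\<dots> < e" using m k by (simp add: G_def)
    finally show "(LINT z:S|lborel. \<bar>f z - G z\<bar>) < e" .
  qed
qed

section \<open>The maximal inequality\<close>

definition offdiag_sum :: "('b \<Rightarrow> 'b \<Rightarrow> real) \<Rightarrow> nat \<Rightarrow> (nat \<Rightarrow> 'b) \<Rightarrow> real" where
  "offdiag_sum f n y = (\<Sum>i\<in>{1..n}. \<Sum>j\<in>{1..n}. if i = j then 0 else f (y i) (y j))"

lemma offdiag_sum_permute:
  assumes "\<pi> permutes {1..n}"
  shows "offdiag_sum f n (\<lambda>i. y (\<pi> i)) = offdiag_sum f n y"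
proof -
  have bij: "bij_betw \<pi> {1..n} {1..n}" using assms by (rule permutes_imp_bij)
  have inj: "\<pi> i = \<pi> j \<longleftrightarrow> i = j" for i j using permutes_inj[OF assms] by (auto dest: injD)
  have "offdiag_sum f n (\<lambda>i. y (\<pi> i)) =
      (\<Sum>i\<in>{1..n}. \<Sum>j\<in>{1..n}. if \<pi> i = \<pi> j then 0 else f (y (\<pi> i)) (y (\<pi> j)))"
    by (simp add: offdiag_sum_def inj)
  also have "\<dots> = (\<Sum>i\<in>{1..n}. \<Sum>j\<in>{1..n}. if \<pi> i = j then 0 else f (y (\<pi> i)) (y j))"
    by (intro sum.cong refl sum.reindex_bij_betw[OF bij, where g = "\<lambda>j. if \<pi> i = j then 0 else f (y (\<pi> i)) (y j)" for i])
  also have "\<dots> = offdiag_sum f n y"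
    unfolding offdiag_sum_def
    by (rule sum.reindex_bij_betw[OF bij, where g = "\<lambda>i. \<Sum>j\<in>{1..n}. if i = j then 0 else f (y i) (y j)"])
  finally show ?thesis .
qed

text \<open>Compose two transpositions: the first sends \<open>a\<close> to \<open>i\<close>, the
  second sends the image of \<open>b\<close> to \<open>j\<close>. The second leaves \<open>i\<close>
  alone, since neither \<open>j\<close> nor the image of \<open>b\<close> equals \<open>i\<close>.
  This brings any pair of sample points to positions 1 and 2.\<close>

lemma ex_permutes_pair:
  assumes "i \<in> A" "j \<in> A" "i \<noteq> j" "a \<in> A" "b \<in> A" "a \<noteq> b"
  obtains \<pi> where "\<pi> permutes A" "\<pi> a = i" "\<pi> b = j"
proof
  let ?\<sigma> = "Transposition.transpose a i"
  let ?\<tau> = "Transposition.transpose (?\<sigma> b) j"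
  have \<sigma>: "?\<sigma> permutes A" using assms by (intro permutes_swap_id)
  have \<sigma>b: "?\<sigma> b \<in> A" using assms by (auto simp: Transposition.transpose_def)
  show "(?\<tau> \<circ> ?\<sigma>) permutes A"
    by (intro permutes_compose \<sigma> permutes_swap_id \<sigma>b assms)
  show "(?\<tau> \<circ> ?\<sigma>) a = i" "(?\<tau> \<circ> ?\<sigma>) b = j"
    using assms by (auto simp: Transposition.transpose_def)
qed

section \<open>Joint law and exchangeability of the sample\<close>

locale iid_uniform_seq = prob_space M for M :: "'a measure" +
  fixes x :: "nat \<Rightarrow> 'a \<Rightarrow> real"
  assumes iid: "iid_uniform M x"
begin

lemma indep: "indep_vars (\<lambda>_. borel) x {1..}"
  using iid by (simp add: iid_uniform_def)

lemma rv: "i \<ge> 1 \<Longrightarrow> x i \<in> borel_measurable M"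
  using indep by (auto simp: indep_vars_def)

lemma distr_x:
  assumes "i \<ge> 1" shows "distr M borel (x i) = uniform_measure lborel {0..1}"
proof -
  have "distr M borel (x i) = distr M lborel (x i)" by (rule distr_cong) auto
  then show ?thesis using iid assms by (simp add: iid_uniform_def)
qed

lemma prob_space_U: "prob_space (uniform_measure lborel {0..1::real})"
  by (rule prob_space_uniform_measure) auto

lemma uniform_density: "uniform_measure lborel {0..1::real} = density lborel (indicator {0..1})"
  unfolding uniform_measure_def by (rule density_cong) (auto simp: divide_ennreal_def)

lemma AE_range: "AE \<omega> in M. \<forall>i\<ge>1. x i \<omega> \<in> {0..1}"
proof -
  have "AE \<omega> in M. x i \<omega> \<in> {0..1}" if "i \<ge> 1" for i
  proof -
    have "AE y in distr M borel (x i). y \<in> {0..1}"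
      unfolding distr_x[OF that] by (rule AE_uniform_measureI) auto
    then show ?thesis by (subst (asm) AE_distr_iff) (use rv[OF that] in auto)
  qed
  then have "AE \<omega> in M. 1 \<le> i \<longrightarrow> x i \<omega> \<in> {0..1}" for i by (cases "1 \<le> i") auto
  then show ?thesis unfolding AE_all_countable by blast
qed

lemma joint_distr:
  assumes "I \<noteq> {}" "I \<subseteq> {1..}"
  shows "distr M (PiM I (\<lambda>_. borel)) (\<lambda>\<omega>. \<lambda>i\<in>I. x i \<omega>) =
    PiM I (\<lambda>_. uniform_measure lborel {0..1})"
proof -
  have ge: "1 \<le> i" if "i \<in> I" for i using assms(2) that by auto
  have "distr M (PiM I (\<lambda>_. borel)) (\<lambda>\<omega>. \<lambda>i\<in>I. x i \<omega>) =
     PiM I (\<lambda>i. distr M borel (x i))"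
    by (rule iffD1[OF indep_vars_iff_distr_eq_PiM' indep_vars_subset[OF indep assms(2)]])
       (rule assms(1), rule rv[OF ge])
  also have "\<dots> = PiM I (\<lambda>_. uniform_measure lborel {0..1})"
    by (intro PiM_cong refl distr_x ge)
  finally show ?thesis .
qed

text \<open>The joint law is a power of a single measure, hence invariant under reindexing. Points
  of \<open>PiM I\<close> are extensional, so \<open>\<phi>\<close> has to ignore the coordinates
  outside \<open>I\<close>; this is what the condition on \<open>restrict\<close> expresses.\<close>

lemma exchangeable:
  assumes I: "I \<noteq> {}" "I \<subseteq> {1..}" and \<pi>: "\<pi> permutes I"
    and [measurable]: "\<phi> \<in> borel_measurable (PiM I (\<lambda>_. borel))"
    and \<phi>: "\<And>y. \<phi> (restrict y I) = \<phi> y"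
  shows "(\<integral>\<^sup>+\<omega>. \<phi> (\<lambda>i. x (\<pi> i) \<omega>) \<partial>M) = (\<integral>\<^sup>+\<omega>. \<phi> (\<lambda>i. x i \<omega>) \<partial>M)"
proof -
  let ?U = "uniform_measure lborel {0..1::real}"
  let ?P = "PiM I (\<lambda>_::nat. ?U)"
  let ?B = "PiM I (\<lambda>_::nat. borel :: real measure)"
  have setsP: "sets ?P = sets ?B" by (intro sets_PiM_cong) auto
  have [measurable]: "x i \<in> borel_measurable M" if "i \<in> I" for i using rv that I by auto
  have [measurable]: "(\<lambda>\<omega>. \<lambda>i\<in>I. x i \<omega>) \<in> measurable M ?B" by measurable
  have \<pi>n: "\<pi> i \<in> I" if "i \<in> I" for i using permutes_in_image[OF \<pi>] that by blast
  have m\<pi>: "(\<lambda>y. \<lambda>i\<in>I. y (\<pi> i)) \<in> measurable ?P ?B"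
    unfolding measurable_cong_sets[OF setsP refl]
    by (intro measurable_restrict measurable_component_singleton \<pi>n)
  have "(\<integral>\<^sup>+\<omega>. \<phi> (\<lambda>i. x (\<pi> i) \<omega>) \<partial>M) =
      (\<integral>\<^sup>+\<omega>. \<phi> (\<lambda>i\<in>I. (\<lambda>i\<in>I. x i \<omega>) (\<pi> i)) \<partial>M)"
  proof (intro nn_integral_cong)
    fix \<omega>
    have "(\<lambda>i\<in>I. (\<lambda>i\<in>I. x i \<omega>) (\<pi> i)) = restrict (\<lambda>i. x (\<pi> i) \<omega>) I"
      using \<pi>n by (auto simp: fun_eq_iff)
    then show "\<phi> (\<lambda>i. x (\<pi> i) \<omega>) = \<phi> (\<lambda>i\<in>I. (\<lambda>i\<in>I. x i \<omega>) (\<pi> i))"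
      by (simp only: \<phi>)
  qed
  also have "\<dots> = (\<integral>\<^sup>+y. \<phi> (\<lambda>i\<in>I. y (\<pi> i)) \<partial>distr M ?B (\<lambda>\<omega>. \<lambda>i\<in>I. x i \<omega>))"
    by (subst nn_integral_distr)
       (auto intro!: measurable_compose[OF m\<pi>[unfolded measurable_cong_sets[OF setsP refl]]])
  also have "\<dots> = (\<integral>\<^sup>+y. \<phi> (\<lambda>i\<in>I. y (\<pi> i)) \<partial>?P)"
    by (simp only: joint_distr[OF I])
  also have "\<dots> = (\<integral>\<^sup>+y. \<phi> y \<partial>distr ?P ?B (\<lambda>y. \<lambda>i\<in>I. y (\<pi> i)))"
    by (subst nn_integral_distr[OF m\<pi>]) auto
  also have "distr ?P ?B (\<lambda>y. \<lambda>i\<in>I. y (\<pi> i)) = distr ?P ?P (\<lambda>y. \<lambda>i\<in>I. y (\<pi> i))"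
    by (rule distr_cong) (simp_all add: setsP)
  also have "\<dots> = ?P"
    by (rule distr_PiM_reindex) (use prob_space_U \<pi>n permutes_inj_on[OF \<pi>] in auto)
  also have "\<dots> = distr M ?B (\<lambda>\<omega>. \<lambda>i\<in>I. x i \<omega>)"
    by (simp only: joint_distr[OF I])
  also have "(\<integral>\<^sup>+y. \<phi> y \<partial>\<dots>) = (\<integral>\<^sup>+\<omega>. \<phi> (\<lambda>i\<in>I. x i \<omega>) \<partial>M)"
    by (subst nn_integral_distr) auto
  also have "\<dots> = (\<integral>\<^sup>+\<omega>. \<phi> (\<lambda>i. x i \<omega>) \<partial>M)" by (simp only: \<phi>)
  finally show ?thesis .
qed

end

lemma sum_offdiag_const:
  "(\<Sum>i\<in>{1..n}. \<Sum>j\<in>{1..n}. if i = j then 0 else c) = (of_nat (n * (n - 1)) * c :: ennreal)"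
proof -
  have "(\<Sum>j\<in>{1..n}. if i = j then 0 else c) = of_nat (n - 1) * c" if "i \<in> {1..n}" for i
  proof -
    have "(\<Sum>j\<in>{1..n}. if i = j then 0 else c) = (\<Sum>j\<in>{1..n} - {i}. c)"
      by (rule sum.mono_neutral_cong_right) auto
    also have "\<dots> = of_nat (n - 1) * c" using that by simp
    finally show ?thesis .
  qed
  then have "(\<Sum>i\<in>{1..n}. \<Sum>j\<in>{1..n}. if i = j then 0 else c) = (\<Sum>i\<in>{1..n}. of_nat (n - 1) * c)"
    by (rule sum.cong[OF refl])
  then show ?thesis by (simp add: mult.assoc)
qed

lemma offdiag_sum_measurable:
  assumes f: "(\<lambda>(s, t). f s t) \<in> borel_measurable (borel :: (real \<times> real) measure)"
    and y: "\<And>i. i \<in> {1..n} \<Longrightarrow> (\<lambda>\<omega>. y \<omega> i) \<in> borel_measurable N"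
  shows "(\<lambda>\<omega>. offdiag_sum f n (y \<omega>)) \<in> borel_measurable N"
  unfolding offdiag_sum_def
proof (intro borel_measurable_sum)
  fix i j assume ij: "i \<in> {1..n}" "j \<in> {1..n}"
  have "(\<lambda>\<omega>. (y \<omega> i, y \<omega> j)) \<in> borel_measurable N"
    by (intro borel_measurable_Pair y ij)
  from measurable_compose[OF this f]
  show "(\<lambda>\<omega>. if i = j then 0 else f (y \<omega> i) (y \<omega> j)) \<in> borel_measurable N" by simp
qed

context iid_uniform_seq
begin

lemma pair_nn_integral:
  assumes f [measurable]: "f \<in> borel_measurable (borel :: (real \<times> real) measure)"
  shows "(\<integral>\<^sup>+\<omega>. f (x 1 \<omega>, x 2 \<omega>) \<partial>M) = (\<integral>\<^sup>+z. f z * indicator ({0..1} \<times> {0..1}) z \<partial>lborel)"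
proof -
  let ?U = "uniform_measure lborel {0..1::real}"
  \<comment> \<open>Written as an insertion so that the product integral splits off coordinate 2 and
    leaves a one-point product.\<close>
  let ?I = "insert 2 {1::nat}"
  let ?B = "PiM ?I (\<lambda>_. borel :: real measure)"
  interpret U: product_sigma_finite "\<lambda>_::nat. ?U"
    by (intro product_sigma_finite.intro prob_space_imp_sigma_finite prob_space_U)
  have [measurable]: "x 1 \<in> borel_measurable M" "x 2 \<in> borel_measurable M" by (simp_all add: rv)
  have J: "(\<lambda>\<omega>. \<lambda>i\<in>?I. x i \<omega>) \<in> measurable M ?B"
    by (rule measurable_restrict) (auto simp: rv)
  have f' [measurable]: "(\<lambda>z. f z) \<in> borel_measurable (borel \<Otimes>\<^sub>M borel)"
    using f unfolding borel_prod .
  have mB: "(\<lambda>y. f (y 1, y 2)) \<in> borel_measurable ?B"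
    by (rule measurable_compose[OF _ f'])
       (intro measurable_Pair measurable_component_singleton, auto)
  have mP: "(\<lambda>y. f (y 1, y 2)) \<in> borel_measurable (PiM ?I (\<lambda>_. ?U))"
    using mB by (subst measurable_cong_sets[OF sets_PiM_cong refl]) auto
  have "(\<integral>\<^sup>+\<omega>. f (x 1 \<omega>, x 2 \<omega>) \<partial>M) =
      (\<integral>\<^sup>+y. f (y 1, y 2) \<partial>distr M ?B (\<lambda>\<omega>. \<lambda>i\<in>?I. x i \<omega>))"
    by (subst nn_integral_distr[OF J]) (use mB in simp_all)
  also have "\<dots> = (\<integral>\<^sup>+y. f (y 1, y 2) \<partial>PiM ?I (\<lambda>_. ?U))"
    by (subst joint_distr) auto
  also have "\<dots> = (\<integral>\<^sup>+y. \<integral>\<^sup>+t. f (y 1, t) \<partial>?U \<partial>PiM {1::nat} (\<lambda>_. ?U))"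
    by (subst U.product_nn_integral_insert) (use mP in auto)
  also have "\<dots> = (\<integral>\<^sup>+s. \<integral>\<^sup>+t. f (s, t) \<partial>?U \<partial>?U)"
    by (rule U.product_nn_integral_singleton[where f = "\<lambda>s. \<integral>\<^sup>+t. f (s, t) \<partial>?U"])
       (simp add: uniform_density nn_integral_density)
  also have "\<dots> = (\<integral>\<^sup>+s. \<integral>\<^sup>+t. f (s, t) * indicator ({0..1} \<times> {0..1}) (s, t) \<partial>lborel \<partial>lborel)"
    unfolding uniform_density
    by (simp add: nn_integral_density)
       (auto intro!: nn_integral_cong split: split_indicator)
  also have "\<dots> = (\<integral>\<^sup>+z. f z * indicator ({0..1} \<times> {0..1}) z \<partial>(lborel \<Otimes>\<^sub>M lborel))"
    by (rule lborel.nn_integral_fst[where f = "\<lambda>z. f z * indicator ({0..1} \<times> {0..1}) z"]) measurable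
  finally show ?thesis by (simp add: lborel_prod)
qed

text \<open>
  As in Doob's inequality, decompose according to the last time \<open>n \<le> N\<close> at which \<open>u\<close> is exceeded: that event is invariant under
  permutations of \<open>x 1, \<dots>, x n\<close>, so on it the average may be replaced by \<open>f (x 1) (x 2)\<close>.
\<close>

lemma maximal_ineq_finite:
  assumes f: "(\<lambda>(s, t). f s t) \<in> borel_measurable (borel :: (real \<times> real) measure)"
    and f0: "\<And>s t. f s t \<ge> 0" and l: "u > 0"
  shows "ennreal u * emeasure M {\<omega>\<in>space M. \<exists>n\<in>{2..N}. u * real (n * (n - 1)) < offdiag_sum f n (\<lambda>i. x i \<omega>)}
    \<le> (\<integral>\<^sup>+\<omega>. ennreal (f (x 1 \<omega>) (x 2 \<omega>)) \<partial>M)"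
proof -
  define S where "S = offdiag_sum f"
  \<comment> \<open>The last exceedance, not the first: \<open>Q n\<close> involves only
    \<open>S m\<close> with m \<ge> n, and a permutation of {1..n} also permutes {1..m}. The sums
    with m < n would not be invariant.\<close>
  define Q where "Q n y \<longleftrightarrow> u * real (n * (n - 1)) < S n y \<and> (\<forall>m\<in>{n<..N}. S m y \<le> u * real (m * (m - 1)))"
    for n y
  define E where "E n = {\<omega>\<in>space M. Q n (\<lambda>i. x i \<omega>)}" for n
  have S_meas: "(\<lambda>y. S n y) \<in> borel_measurable (PiM {1..N} (\<lambda>_. borel))" if "n \<le> N" for n
    unfolding S_def
    by (rule offdiag_sum_measurable[OF f]) (use that in \<open>auto intro!: measurable_component_singleton\<close>)
  have S_meas' [measurable]: "(\<lambda>\<omega>. S n (\<lambda>i. x i \<omega>)) \<in> borel_measurable M" for n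
    unfolding S_def by (rule offdiag_sum_measurable[OF f]) (simp add: rv)
  have E [measurable]: "E n \<in> sets M" for n
    unfolding E_def Q_def by measurable
  have f_meas: "(\<lambda>\<omega>. f (y \<omega> i) (y \<omega> j)) \<in> borel_measurable K"
    if "(\<lambda>\<omega>. y \<omega> i) \<in> borel_measurable K" "(\<lambda>\<omega>. y \<omega> j) \<in> borel_measurable K"
    for y :: "'c \<Rightarrow> nat \<Rightarrow> real" and i j K
    using measurable_compose[OF borel_measurable_Pair[OF that] f] by simp
  have restr: "S m (restrict y {1..N}) = S m y" if "m \<le> N" for m y
    unfolding S_def offdiag_sum_def using that by (intro sum.cong refl) auto
  have step: "ennreal u * emeasure M (E n) \<le> (\<integral>\<^sup>+\<omega>. ennreal (f (x 1 \<omega>) (x 2 \<omega>)) * indicator (E n) \<omega> \<partial>M)"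
    (is "_ \<le> ?I") if n: "n \<in> {2..N}" for n
  proof -
    have swap: "(\<integral>\<^sup>+\<omega>. ennreal (f (x i \<omega>) (x j \<omega>)) * indicator (E n) \<omega> \<partial>M) = ?I"
      if ij: "i \<in> {1..n}" "j \<in> {1..n}" "i \<noteq> j" for i j
    proof -
      obtain \<pi> where \<pi>: "\<pi> permutes {1..n}" "\<pi> 1 = i" "\<pi> 2 = j"
        by (rule ex_permutes_pair[of i "{1..n}" j 1 2]) (use ij n in auto)
      have \<pi>': "\<pi> permutes {1..m}" if "n \<le> m" for m
        using \<pi>(1) that by (auto intro: permutes_subset)
      have S_perm: "S m (\<lambda>i. y (\<pi> i)) = S m y" if "n \<le> m" for m y
        unfolding S_def by (rule offdiag_sum_permute[OF \<pi>'[OF that]])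
      have Q_perm: "Q n (\<lambda>i. y (\<pi> i)) = Q n y" for y
        unfolding Q_def by (simp add: S_perm[of _ y])
      have Q_perm': "Q n (\<lambda>i. x (\<pi> i) \<omega>) = Q n (\<lambda>i. x i \<omega>)" for \<omega>
        by (rule Q_perm)
      define \<phi> where "\<phi> y = ennreal (f (y 1) (y 2)) * (if Q n y then 1 else 0)" for y
      have "(\<integral>\<^sup>+\<omega>. \<phi> (\<lambda>i. x (\<pi> i) \<omega>) \<partial>M) = (\<integral>\<^sup>+\<omega>. \<phi> (\<lambda>i. x i \<omega>) \<partial>M)"
      proof (rule exchangeable)
        show "{1..N} \<noteq> {}" "{1..N} \<subseteq> {1..}" "\<pi> permutes {1..N}" using n \<pi>' by auto
        have 1: "Measurable.pred (PiM {1..N} (\<lambda>_. borel)) (Q n)"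
        proof -
          \<comment> \<open>\<open>S m\<close> is known to be measurable on this product only for m
            \<le> N; with zero beyond, \<open>S'\<close> is measurable for every m.\<close>
          define S' where "S' m y = (if m \<le> N then S m y else 0)" for m and y :: "nat \<Rightarrow> real"
          have [measurable]: "S' m \<in> borel_measurable (PiM {1..N} (\<lambda>_. borel))" for m
            using S_meas[of m] by (cases "m \<le> N") (simp_all add: S'_def[abs_def])
          have eq: "Q n = (\<lambda>y. u * real (n * (n - 1)) < S' n y \<and> (\<forall>m\<in>{n<..N}. S' m y \<le> u * real (m * (m - 1))))"
            using n by (simp add: Q_def[abs_def] S'_def)
          show ?thesis unfolding eq by measurable
        qed
        have 2: "(\<lambda>y. f (y 1) (y 2)) \<in> borel_measurable (PiM {1..N} (\<lambda>_. borel))"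
          by (rule f_meas) (use n in \<open>auto intro!: measurable_component_singleton\<close>)
        show "\<phi> \<in> borel_measurable (PiM {1..N} (\<lambda>_. borel))"
          unfolding \<phi>_def[abs_def] using 1 2 by measurable
        show "\<phi> (restrict y {1..N}) = \<phi> y" for y
        proof -
          have "Q n (restrict y {1..N}) = Q n y" unfolding Q_def using restr n by auto
          then show ?thesis using n by (simp add: \<phi>_def)
        qed
      qed
      moreover have "(\<integral>\<^sup>+\<omega>. \<phi> (\<lambda>i. x (\<pi> i) \<omega>) \<partial>M) =
          (\<integral>\<^sup>+\<omega>. ennreal (f (x i \<omega>) (x j \<omega>)) * indicator (E n) \<omega> \<partial>M)"
        by (rule nn_integral_cong) (simp add: \<phi>_def Q_perm' \<pi>(2)[simplified] \<pi>(3) E_def indicator_def)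
      moreover have "(\<integral>\<^sup>+\<omega>. \<phi> (\<lambda>i. x i \<omega>) \<partial>M) = ?I"
        by (rule nn_integral_cong) (simp add: \<phi>_def E_def indicator_def)
      ultimately show ?thesis by (simp only:)
    qed
    \<comment> \<open>The number of ordered pairs. The estimate is proved with this factor on both
      sides; it cancels because it is finite and, as n \<ge> 2, not zero.\<close>
    define k :: ennreal where "k = of_nat (n * (n - 1))"
    have meas: "(\<lambda>\<omega>. ennreal (f (x i \<omega>) (x j \<omega>)) * indicator (E n) \<omega>) \<in> borel_measurable M"
      if "i \<in> {1..n}" "j \<in> {1..n}" for i j
    proof -
      have [measurable]: "(\<lambda>\<omega>. f (x i \<omega>) (x j \<omega>)) \<in> borel_measurable M"
        by (rule f_meas) (use that in \<open>simp_all add: rv\<close>)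
      show ?thesis by measurable
    qed
    have "k * (ennreal u * emeasure M (E n)) = (\<integral>\<^sup>+\<omega>. (k * ennreal u) * indicator (E n) \<omega> \<partial>M)"
      by (subst nn_integral_cmult_indicator) (simp_all add: mult.assoc)
    also have "\<dots> \<le> (\<integral>\<^sup>+\<omega>. ennreal (S n (\<lambda>i. x i \<omega>)) * indicator (E n) \<omega> \<partial>M)"
    proof (rule nn_integral_mono)
      fix \<omega>
      have "k * ennreal u = ennreal (u * real (n * (n - 1)))"
        using l unfolding k_def ennreal_of_nat_eq_real_of_nat
        by (subst ennreal_mult[symmetric]) (simp_all add: mult.commute)
      moreover have "ennreal (u * real (n * (n - 1))) \<le> ennreal (S n (\<lambda>i. x i \<omega>))" if "\<omega> \<in> E n"
        using that by (intro ennreal_leI) (auto simp: E_def Q_def)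
      ultimately show "k * ennreal u * indicator (E n) \<omega> \<le> ennreal (S n (\<lambda>i. x i \<omega>)) * indicator (E n) \<omega>"
        by (cases "\<omega> \<in> E n") simp_all
    qed
    also have "\<dots> = (\<integral>\<^sup>+\<omega>. (\<Sum>i\<in>{1..n}. \<Sum>j\<in>{1..n}. if i = j then 0 else
        ennreal (f (x i \<omega>) (x j \<omega>)) * indicator (E n) \<omega>) \<partial>M)"
    proof (rule nn_integral_cong)
      fix \<omega>
      have "ennreal (S n (\<lambda>i. x i \<omega>)) =
          (\<Sum>i\<in>{1..n}. \<Sum>j\<in>{1..n}. ennreal (if i = j then 0 else f (x i \<omega>) (x j \<omega>)))"
        unfolding S_def offdiag_sum_def
        by (simp add: sum_nonneg f0)
      then show "ennreal (S n (\<lambda>i. x i \<omega>)) * indicator (E n) \<omega> =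
         (\<Sum>i\<in>{1..n}. \<Sum>j\<in>{1..n}. if i = j then 0 else
            ennreal (f (x i \<omega>) (x j \<omega>)) * indicator (E n) \<omega>)"
        by (cases "\<omega> \<in> E n") (simp_all add: if_distrib[of ennreal] cong: if_cong)
    qed
    also have "\<dots> = (\<Sum>i\<in>{1..n}. \<Sum>j\<in>{1..n}. \<integral>\<^sup>+\<omega>. (if i = j then 0 else
        ennreal (f (x i \<omega>) (x j \<omega>)) * indicator (E n) \<omega>) \<partial>M)"
    proof -
      have m: "(\<lambda>\<omega>. if i = j then 0 else ennreal (f (x i \<omega>) (x j \<omega>)) * indicator (E n) \<omega>) \<in> borel_measurable M"
        if "i \<in> {1..n}" "j \<in> {1..n}" for i j
        using meas[OF that] by auto
      have "(\<integral>\<^sup>+\<omega>. (\<Sum>i\<in>{1..n}. \<Sum>j\<in>{1..n}. if i = j then 0 else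
          ennreal (f (x i \<omega>) (x j \<omega>)) * indicator (E n) \<omega>) \<partial>M) =
        (\<Sum>i\<in>{1..n}. \<integral>\<^sup>+\<omega>. (\<Sum>j\<in>{1..n}. if i = j then 0 else
          ennreal (f (x i \<omega>) (x j \<omega>)) * indicator (E n) \<omega>) \<partial>M)"
        by (intro nn_integral_sum borel_measurable_sum m)
      also have "\<dots> = (\<Sum>i\<in>{1..n}. \<Sum>j\<in>{1..n}. \<integral>\<^sup>+\<omega>. (if i = j then 0 else
          ennreal (f (x i \<omega>) (x j \<omega>)) * indicator (E n) \<omega>) \<partial>M)"
        by (intro sum.cong refl nn_integral_sum m)
      finally show ?thesis .
    qed
    also have "\<dots> = (\<Sum>i\<in>{1..n}. \<Sum>j\<in>{1..n}. if i = j then 0 else ?I)"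
    proof (intro sum.cong refl)
      fix i j assume "i \<in> {1..n}" "j \<in> {1..n}"
      from swap[OF this] show "(\<integral>\<^sup>+\<omega>. (if i = j then 0 else
          ennreal (f (x i \<omega>) (x j \<omega>)) * indicator (E n) \<omega>) \<partial>M) = (if i = j then 0 else ?I)"
        by (cases "i = j") simp_all
    qed
    also have "\<dots> = k * ?I" unfolding k_def by (rule sum_offdiag_const)
    finally have "k * (ennreal u * emeasure M (E n)) \<le> k * ?I" .
    moreover have "k \<noteq> 0" using n by (simp add: k_def del: of_nat_mult)
    moreover have "k \<noteq> \<top>" unfolding k_def by (rule ennreal_of_nat_neq_top)
    ultimately show ?thesis by (subst (asm) ennreal_mult_le_mult_iff) auto
  qed
  have Eeq: "{\<omega>\<in>space M. \<exists>n\<in>{2..N}. u * real (n * (n - 1)) < S n (\<lambda>i. x i \<omega>)} = (\<Union>n\<in>{2..N}. E n)"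
  proof (intro equalityI subsetI)
    fix \<omega> assume "\<omega> \<in> {\<omega>\<in>space M. \<exists>n\<in>{2..N}. u * real (n * (n - 1)) < S n (\<lambda>i. x i \<omega>)}"
    then obtain n where \<omega>: "\<omega> \<in> space M" and n: "n \<in> {2..N}" "u * real (n * (n - 1)) < S n (\<lambda>i. x i \<omega>)" by blast
    let ?A = "{n\<in>{2..N}. u * real (n * (n - 1)) < S n (\<lambda>i. x i \<omega>)}"
    have fin: "finite ?A" by simp
    have ne: "?A \<noteq> {}" using n by blast
    let ?m = "Max ?A"
    have m: "?m \<in> ?A" by (rule Max_in[OF fin ne])
    have "S k (\<lambda>i. x i \<omega>) \<le> u * real (k * (k - 1))" if k: "k \<in> {?m<..N}" for k
    proof (rule ccontr)
      assume "\<not> ?thesis"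
      then have "k \<in> ?A" using k m by auto
      then have "k \<le> ?m" by (rule Max_ge[OF fin])
      then show False using k by auto
    qed
    with m \<omega> have "\<omega> \<in> E ?m" unfolding E_def Q_def by blast
    with m show "\<omega> \<in> (\<Union>n\<in>{2..N}. E n)" by blast
  next
    fix \<omega> assume "\<omega> \<in> (\<Union>n\<in>{2..N}. E n)"
    then show "\<omega> \<in> {\<omega>\<in>space M. \<exists>n\<in>{2..N}. u * real (n * (n - 1)) < S n (\<lambda>i. x i \<omega>)}"
      unfolding E_def Q_def by blast
  qed
  have less: "E m \<inter> E n = {}" if "m < n" "n \<le> N" for m n
  proof -
    have n: "n \<in> {m<..N}" using that by simp
    have False if "\<omega> \<in> E m" "\<omega> \<in> E n" for \<omega>
    proof -
      have "S n (\<lambda>i. x i \<omega>) \<le> u * real (n * (n - 1))"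
        using that(1) n unfolding E_def Q_def by blast
      moreover have "u * real (n * (n - 1)) < S n (\<lambda>i. x i \<omega>)"
        using that(2) unfolding E_def Q_def by blast
      ultimately show False by linarith
    qed
    then show ?thesis by blast
  qed
  have disj: "disjoint_family_on E {2..N}"
    unfolding disjoint_family_on_def
  proof (intro ballI impI)
    fix m n assume "m \<in> {2..N}" "n \<in> {2..N}" "m \<noteq> n"
    then show "E m \<inter> E n = {}"
      using less[of m n] less[of n m] by (cases m n rule: linorder_cases) (auto simp: Int_commute)
  qed
  have "ennreal u * emeasure M (\<Union>n\<in>{2..N}. E n) = (\<Sum>n\<in>{2..N}. ennreal u * emeasure M (E n))"
    unfolding sum_distrib_left[symmetric] by (subst sum_emeasure) (use disj in auto)
  also have "\<dots> \<le> (\<Sum>n\<in>{2..N}. \<integral>\<^sup>+\<omega>. ennreal (f (x 1 \<omega>) (x 2 \<omega>)) * indicator (E n) \<omega> \<partial>M)"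
    by (rule sum_mono[OF step])
  also have "\<dots> = (\<integral>\<^sup>+\<omega>. (\<Sum>n\<in>{2..N}. ennreal (f (x 1 \<omega>) (x 2 \<omega>)) * indicator (E n) \<omega>) \<partial>M)"
  proof (rule nn_integral_sum[symmetric])
    have [measurable]: "(\<lambda>\<omega>. f (x 1 \<omega>) (x 2 \<omega>)) \<in> borel_measurable M"
      by (rule f_meas) (simp_all add: rv)
    show "(\<lambda>\<omega>. ennreal (f (x 1 \<omega>) (x 2 \<omega>)) * indicator (E n) \<omega>) \<in> borel_measurable M" for n
      by measurable
  qed
  also have "\<dots> \<le> (\<integral>\<^sup>+\<omega>. ennreal (f (x 1 \<omega>) (x 2 \<omega>)) \<partial>M)"
  proof (rule nn_integral_mono)
    fix \<omega>
    have "(\<Sum>n\<in>{2..N}. indicator (E n) \<omega> :: ennreal) = indicator (\<Union>n\<in>{2..N}. E n) \<omega>"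
      using disj by (intro indicator_UN_disjoint[symmetric]) auto
    then show "(\<Sum>n\<in>{2..N}. ennreal (f (x 1 \<omega>) (x 2 \<omega>)) * indicator (E n) \<omega>) \<le> ennreal (f (x 1 \<omega>) (x 2 \<omega>))"
      unfolding sum_distrib_left[symmetric] by (simp split: split_indicator)
  qed
  finally show ?thesis unfolding Eeq[symmetric] S_def .
qed

text \<open>The bound for n \<le> N does not depend on \<open>N\<close>, so continuity from below
  extends it to all n. As \<open>f\<close> is nonnegative, the expectation of
  \<open>f (x 1) (x 2)\<close> is its L1 norm.\<close>

lemma maximal_ineq:
  assumes f: "(\<lambda>(s, t). f s t) \<in> borel_measurable (borel :: (real \<times> real) measure)"
    and f0: "\<And>s t. f s t \<ge> 0" and l: "u > 0"
    and int: "set_integrable lborel ({0..1} \<times> {0..1}) (\<lambda>(s, t). f s t)"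
  shows "u * prob {\<omega>\<in>space M. \<exists>n\<ge>2. u * real (n * (n - 1)) < offdiag_sum f n (\<lambda>i. x i \<omega>)}
    \<le> L1_norm f"
proof -
  define A where "A N = {\<omega>\<in>space M. \<exists>n\<in>{2..N}. u * real (n * (n - 1)) < offdiag_sum f n (\<lambda>i. x i \<omega>)}" for N
  have [measurable]: "(\<lambda>\<omega>. offdiag_sum f n (\<lambda>i. x i \<omega>)) \<in> borel_measurable M" for n
    by (rule offdiag_sum_measurable[OF f]) (simp add: rv)
  have A [measurable]: "A N \<in> sets M" for N unfolding A_def by measurable
  have "(\<integral>\<^sup>+\<omega>. ennreal (f (x 1 \<omega>) (x 2 \<omega>)) \<partial>M) =
      (\<integral>\<^sup>+z. ennreal (case z of (s, t) \<Rightarrow> f s t) * indicator ({0..1} \<times> {0..1}) z \<partial>lborel)"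
    using pair_nn_integral[of "\<lambda>z. ennreal (case z of (s, t) \<Rightarrow> f s t)"] f by simp
  also have "\<dots> = (\<integral>\<^sup>+z. ennreal (indicator ({0..1} \<times> {0..1}) z *\<^sub>R (case z of (s, t) \<Rightarrow> \<bar>f s t\<bar>)) \<partial>lborel)"
    using f0 by (intro nn_integral_cong) (auto split: split_indicator)
  also have "\<dots> = ennreal (L1_norm f)"
    unfolding L1_norm_def set_lebesgue_integral_def
  proof (rule nn_integral_eq_integral)
    show "integrable lborel (\<lambda>z. indicator ({0..1} \<times> {0..1}) z *\<^sub>R (case z of (s, t) \<Rightarrow> \<bar>f s t\<bar>))"
      using int f0 unfolding set_integrable_def by simp
  qed (auto split: split_indicator)
  finally have eq: "(\<integral>\<^sup>+\<omega>. ennreal (f (x 1 \<omega>) (x 2 \<omega>)) \<partial>M) = ennreal (L1_norm f)" .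
  have L0: "L1_norm f \<ge> 0" by (rule L1_norm_nonneg)
  have le: "u * prob (A N) \<le> L1_norm f" for N
  proof -
    have "ennreal (u * prob (A N)) \<le> ennreal (L1_norm f)"
      using maximal_ineq_finite[OF f f0 l, of N] l unfolding eq A_def[symmetric]
      by (simp add: emeasure_eq_measure ennreal_mult)
    then show ?thesis using L0 by simp
  qed
  have "incseq A"
  proof (rule incseq_SucI, rule subsetI)
    fix N \<omega> assume "\<omega> \<in> A N"
    then obtain n where "\<omega> \<in> space M" "n \<in> {2..N}" "u * real (n * (n - 1)) < offdiag_sum f n (\<lambda>i. x i \<omega>)"
      unfolding A_def by blast
    then show "\<omega> \<in> A (Suc N)" unfolding A_def by (intro CollectI conjI bexI[of _ n]) auto
  qed
  then have "(\<lambda>N. u * prob (A N)) \<longlonglongrightarrow> u * prob (\<Union>N. A N)"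
    by (intro tendsto_mult_left finite_Lim_measure_incseq) auto
  then have "u * prob (\<Union>N. A N) \<le> L1_norm f"
    by (rule LIMSEQ_le_const2) (use le in auto)
  also have "(\<Union>N. A N) = {\<omega>\<in>space M. \<exists>n\<ge>2. u * real (n * (n - 1)) < offdiag_sum f n (\<lambda>i. x i \<omega>)}"
  proof (intro equalityI subsetI)
    fix \<omega> assume "\<omega> \<in> (\<Union>N. A N)"
    then obtain N n where "\<omega> \<in> space M" "n \<in> {2..N}" "u * real (n * (n - 1)) < offdiag_sum f n (\<lambda>i. x i \<omega>)"
      unfolding A_def by blast
    then show "\<omega> \<in> {\<omega>\<in>space M. \<exists>n\<ge>2. u * real (n * (n - 1)) < offdiag_sum f n (\<lambda>i. x i \<omega>)}"
      by (intro CollectI conjI exI[of _ n]) auto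
  next
    fix \<omega> assume "\<omega> \<in> {\<omega>\<in>space M. \<exists>n\<ge>2. u * real (n * (n - 1)) < offdiag_sum f n (\<lambda>i. x i \<omega>)}"
    then obtain n where "\<omega> \<in> space M" "n \<ge> 2" "u * real (n * (n - 1)) < offdiag_sum f n (\<lambda>i. x i \<omega>)"
      by blast
    then have "\<omega> \<in> A n" unfolding A_def by (intro CollectI conjI bexI[of _ n]) auto
    then show "\<omega> \<in> (\<Union>N. A N)" by blast
  qed
  finally show ?thesis .
qed

end

section \<open>Continuous kernels\<close>

lemma L1_norm_add_le:
  assumes A: "set_integrable lborel ({0..1} \<times> {0..1}) (\<lambda>(s, t). A s t)"
    and B: "set_integrable lborel ({0..1} \<times> {0..1}) (\<lambda>(s, t). B s t)"
  shows "L1_norm (\<lambda>s t. A s t + B s t) \<le> L1_norm A + L1_norm B"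
proof -
  let ?Q = "{0..1::real} \<times> {0..1::real}"
  have A': "set_integrable lborel ?Q (\<lambda>(s, t). \<bar>A s t\<bar>)"
    using set_integrable_abs[OF A] by (simp add: case_prod_unfold)
  have B': "set_integrable lborel ?Q (\<lambda>(s, t). \<bar>B s t\<bar>)"
    using set_integrable_abs[OF B] by (simp add: case_prod_unfold)
  have AB: "set_integrable lborel ?Q (\<lambda>(s, t). \<bar>A s t + B s t\<bar>)"
    using set_integrable_abs[OF set_integral_add(1)[OF A B]] by (simp add: case_prod_unfold)
  have "L1_norm (\<lambda>s t. A s t + B s t) \<le>
      set_lebesgue_integral lborel ?Q (\<lambda>z. (case z of (s, t) \<Rightarrow> \<bar>A s t\<bar>) + (case z of (s, t) \<Rightarrow> \<bar>B s t\<bar>))"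
    unfolding L1_norm_def
    by (rule set_integral_mono[OF AB set_integral_add(1)[OF A' B']]) (auto simp: abs_triangle_ineq)
  also have "\<dots> = L1_norm A + L1_norm B"
    unfolding L1_norm_def by (rule set_integral_add(2)[OF A' B'])
  finally show ?thesis .
qed

lemma L1_norm_le_const:
  assumes A: "set_integrable lborel ({0..1} \<times> {0..1}) (\<lambda>(s, t). A s t)"
    and le: "\<And>s t. s \<in> {0..1} \<Longrightarrow> t \<in> {0..1} \<Longrightarrow> \<bar>A s t\<bar> \<le> c"
  shows "L1_norm A \<le> c"
proof -
  let ?Q = "{0..1::real} \<times> {0..1::real}"
  have em: "emeasure lborel ?Q = 1"
    by (subst lborel_prod[symmetric], subst lborel.emeasure_pair_measure_Times) auto
  have A': "set_integrable lborel ?Q (\<lambda>(s, t). \<bar>A s t\<bar>)"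
    using set_integrable_abs[OF A] by (simp add: case_prod_unfold)
  have c: "set_integrable lborel ?Q (\<lambda>_. c)"
    unfolding set_integrable_def
  proof (rule integrable_scaleR_left)
    show "integrable lborel (indicator ?Q :: real \<times> real \<Rightarrow> real)"
      by (rule integrable_real_indicator) (simp_all add: em borel_prod[symmetric] del: borel_prod)
  qed
  have "L1_norm A \<le> set_lebesgue_integral lborel ?Q (\<lambda>_. c)"
    unfolding L1_norm_def by (rule set_integral_mono[OF A' c]) (use le in auto)
  also have "\<dots> = c" by (simp add: set_lebesgue_integral_def measure_def em)
  finally show ?thesis .
qed

lemma L1_norm_minus_commute: "L1_norm (\<lambda>s t. A s t - B s t) = L1_norm (\<lambda>s t. B s t - A s t)"
  by (simp add: L1_norm_def abs_minus_commute)

lemma set_integrable_diff_square: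
  assumes "set_integrable lborel Q (\<lambda>(s, t). A s t)" "set_integrable lborel Q (\<lambda>(s, t). B s t)"
  shows "set_integrable lborel Q (\<lambda>(s, t). A s t - B s t :: real)"
  using set_integral_diff(1)[OF assms] by (simp add: case_prod_unfold)

lemma L1_norm_triangle:
  assumes "set_integrable lborel ({0..1} \<times> {0..1}) (\<lambda>(s, t). A s t)"
    and "set_integrable lborel ({0..1} \<times> {0..1}) (\<lambda>(s, t). B s t)"
    and "set_integrable lborel ({0..1} \<times> {0..1}) (\<lambda>(s, t). C s t)"
  shows "L1_norm (\<lambda>s t. A s t - C s t) \<le> L1_norm (\<lambda>s t. A s t - B s t) + L1_norm (\<lambda>s t. B s t - C s t)"
  using L1_norm_add_le[OF set_integrable_diff_square[OF assms(1,2)] set_integrable_diff_square[OF assms(2,3)]]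
  by simp

lemma graph_graphon_integrable:
  "set_integrable lborel ({0..1} \<times> {0..1}) (\<lambda>(s, t). graph_graphon n y \<beta> s t)"
  by (rule graph_graphon_has_integral(1)) auto

lemma set_integrable_continuous_square:
  fixes U :: "real \<Rightarrow> real \<Rightarrow> real"
  assumes "continuous_on UNIV (\<lambda>(s, t). U s t)"
  shows "set_integrable lborel ({0..1} \<times> {0..1}) (\<lambda>(s, t). U s t)"
proof -
  have Q: "compact ({0..1::real} \<times> {0..1::real})" by (intro compact_Times) auto
  have UQ: "continuous_on ({0..1} \<times> {0..1}) (\<lambda>(s, t). U s t)"
    using assms by (rule continuous_on_subset) auto
  show ?thesis
    unfolding set_integrable_def using borel_integrable_compact[OF Q UQ] by (simp add: indicator_scaleR_eq_if)
qed

lemma continuous_bounded_square: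
  fixes U :: "real \<Rightarrow> real \<Rightarrow> real"
  assumes "continuous_on UNIV (\<lambda>(s, t). U s t)"
  obtains K where "K \<ge> 0" "\<forall>s\<in>{0..1}. \<forall>t\<in>{0..1}. \<bar>U s t\<bar> \<le> K"
proof -
  have "compact ({0..1::real} \<times> {0..1::real})" by (intro compact_Times) auto
  moreover have "continuous_on ({0..1} \<times> {0..1}) (\<lambda>(s, t). U s t)"
    using assms by (rule continuous_on_subset) auto
  ultimately have "bounded ((\<lambda>(s, t). U s t) ` ({0..1} \<times> {0..1}))"
    by (intro compact_imp_bounded compact_continuous_image)
  then obtain K where K: "\<forall>z\<in>{0..1} \<times> {0..1}. \<bar>case z of (s, t) \<Rightarrow> U s t\<bar> \<le> K"
    unfolding bounded_iff by auto
  show thesis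
  proof
    show "\<forall>s\<in>{0..1}. \<forall>t\<in>{0..1}. \<bar>U s t\<bar> \<le> K" using K by auto
    then have "\<bar>U 0 0\<bar> \<le> K" by simp
    then show "K \<ge> 0" by linarith
  qed
qed

text \<open>The empirical distribution function. For uniform points its limit is the uniform
  distribution function \<open>min 1 (max 0 q)\<close>.\<close>

definition empirical :: "nat \<Rightarrow> (nat \<Rightarrow> real) \<Rightarrow> real \<Rightarrow> real" where
  "empirical n y q = real (card {i\<in>{1..n}. y i \<le> q}) / real n"

text \<open>A Glivenko--Cantelli argument: up to ties, the rank divided by n is the empirical
  distribution function at \<open>y i\<close>. Monotonicity squeezes it between the values at
  finitely many grid points k / m, which makes the estimate uniform in i and involves rational q
  only.\<close>

lemma rank_close:
  assumes y: "\<And>i. i \<ge> 1 \<Longrightarrow> y i \<in> {0..1}"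
    and emp: "\<And>q. q \<in> \<rat> \<Longrightarrow> (\<lambda>n. empirical n y q) \<longlonglongrightarrow> min 1 (max 0 q)"
    and e: "e > 0"
  shows "eventually (\<lambda>n. \<forall>i\<in>{1..n}. \<bar>y i - real (vertex_rank n y i) / real n\<bar> \<le> e) sequentially"
proof -
  \<comment> \<open>The mesh is below e / 4: in either direction at most two mesh widths and the
    grid error e / 4 add up.\<close>
  obtain m :: nat where m: "m > 4 / e" using reals_Archimedean2 by blast
  have "4 / e > 0" using e by simp
  with m have m0: "real m > 0" by linarith
  have me: "1 / real m \<le> e / 4" using m m0 e by (simp add: field_simps)
  have "eventually (\<lambda>n. \<bar>empirical n y (real k / real m) - min 1 (max 0 (real k / real m))\<bar> < e / 4) sequentially"
    for k
    using tendstoD[OF emp, of "real k / real m" "e / 4"] e by (auto simp: dist_real_def)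
  \<comment> \<open>For y i = 1 the upper grid point is (m + 1) / m, hence the range up to m +
    1.\<close>
  then have "eventually (\<lambda>n. \<forall>k\<in>{..m+1}. \<bar>empirical n y (real k / real m) - min 1 (max 0 (real k / real m))\<bar> < e / 4) sequentially"
    by (intro eventually_ball_finite) auto
  then show ?thesis using eventually_gt_at_top[of 0]
  proof eventually_elim
    case (elim n)
    show ?case
    proof
      fix i assume i: "i \<in> {1..n}"
      let ?r = "real (vertex_rank n y i) / real n"
      define k where "k = nat \<lfloor>real m * y i\<rfloor>"
      have yi: "0 \<le> y i" "y i \<le> 1" using y[of i] i by auto
      have k: "real k \<le> real m * y i" "real m * y i < real k + 1"
        using yi m0 by (simp_all add: k_def)
      have "real k \<le> real m" using k(1) mult_left_le[of "y i" "real m"] yi by linarith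
      then have km: "k \<le> m" by simp
      have up: "?r \<le> empirical n y (real (k + 1) / real m)"
        unfolding empirical_def vertex_rank_def
      proof (intro divide_right_mono of_nat_mono card_mono)
        have "y i < real (k + 1) / real m" using k(2) m0 by (simp add: field_simps)
        then show "{j \<in> {1..n}. y j < y i \<or> y j = y i \<and> j \<le> i} \<subseteq> {j \<in> {1..n}. y j \<le> real (k + 1) / real m}"
          by auto
      qed auto
      have "\<bar>empirical n y (real (k + 1) / real m) - min 1 (max 0 (real (k + 1) / real m))\<bar> < e / 4"
        using km by (intro elim(1)[rule_format]) auto
      moreover have "min 1 (max 0 (real (k + 1) / real m)) \<le> real (k + 1) / real m"
        by (simp add: max_def)
      ultimately have "?r < real (k + 1) / real m + e / 4" using up by linarith
      also have "\<dots> = real k / real m + 1 / real m + e / 4" by (simp add: add_divide_distrib)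
      also have "real k / real m \<le> y i" using k(1) m0 by (simp add: field_simps)
      finally have 1: "?r \<le> y i + e" using me e by linarith
      have 2: "y i \<le> ?r + e"
      proof (cases "k = 0")
        case True
        then have "y i < 1 / real m" using k(2) m0 by (simp add: field_simps)
        moreover have "?r \<ge> 0" by simp
        ultimately show ?thesis using me e by linarith
      next
        case False
        \<comment> \<open>Going down to k - 1 puts the grid point strictly below \<open>y i\<close>,
          so every point up to it precedes \<open>i\<close>, however ties are broken.\<close>
        have lo: "empirical n y (real (k - 1) / real m) \<le> ?r"
          unfolding empirical_def vertex_rank_def
        proof (intro divide_right_mono of_nat_mono card_mono)
          have "real (k - 1) / real m < y i" using k(1) m0 False by (simp add: field_simps)
          then show "{j \<in> {1..n}. y j \<le> real (k - 1) / real m} \<subseteq> {j \<in> {1..n}. y j < y i \<or> y j = y i \<and> j \<le> i}"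
            by auto
        qed auto
        have "\<bar>empirical n y (real (k - 1) / real m) - min 1 (max 0 (real (k - 1) / real m))\<bar> < e / 4"
          using km by (intro elim(1)[rule_format]) auto
        moreover have "min 1 (max 0 (real (k - 1) / real m)) = real (k - 1) / real m"
          using km m0 by (simp add: field_simps)
        ultimately have "real (k - 1) / real m - e / 4 < ?r" using lo by linarith
        moreover have "y i < real (k - 1) / real m + 2 / real m"
          using k(2) m0 False by (simp add: field_simps)
        ultimately show ?thesis using me e by linarith
      qed
      show "\<bar>y i - ?r\<bar> \<le> e" using 1 2 by linarith
    qed
  qed
qed

text \<open>Every point of the block of vertex i is close to \<open>y i\<close>, so uniform
  continuity compares the graphon with \<open>U\<close> pointwise once the diagonal cells carry
  values of \<open>U\<close> too.\<close>

lemma d1_graph_graphon_continuous: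
  assumes y: "\<And>i. i \<ge> 1 \<Longrightarrow> y i \<in> {0..1}"
    and emp: "\<And>q. q \<in> \<rat> \<Longrightarrow> (\<lambda>n. empirical n y q) \<longlonglongrightarrow> min 1 (max 0 q)"
    and U: "continuous_on UNIV (\<lambda>(s, t). U s t)" and e: "e > 0"
  shows "eventually (\<lambda>n. d1 (graph_graphon n y (H_graph n U y)) U \<le> e) sequentially"
proof -
  let ?Q = "{0..1::real} \<times> {0..1::real}"
  have Qc: "compact ?Q" by (intro compact_Times) auto
  have UQ: "continuous_on ?Q (\<lambda>(s, t). U s t)" using U by (rule continuous_on_subset) auto
  obtain K where K: "\<forall>s\<in>{0..1}. \<forall>t\<in>{0..1}. \<bar>U s t\<bar> \<le> K"
    using continuous_bounded_square[OF U] .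
  have uc: "uniformly_continuous_on ?Q (\<lambda>(s, t). U s t)"
    by (rule compact_uniformly_continuous[OF UQ Qc])
  obtain d where d: "d > 0" and dU: "\<And>z z'. z \<in> ?Q \<Longrightarrow> z' \<in> ?Q \<Longrightarrow> dist z' z < d \<Longrightarrow>
      dist (case z' of (s, t) \<Rightarrow> U s t) (case z of (s, t) \<Rightarrow> U s t) < e / 2"
    using uniformly_continuous_onE[OF uc, of "e / 2"] e by (metis half_gt_zero)
  note Uint = set_integrable_continuous_square[OF U]
  have "eventually (\<lambda>n. 1 / real n < d / 8) sequentially"
    using d by real_asymp
  moreover have "eventually (\<lambda>n. K / real n < e / 2) sequentially"
    using e by real_asymp
  moreover have "eventually (\<lambda>n. \<forall>i\<in>{1..n}. \<bar>y i - real (vertex_rank n y i) / real n\<bar> \<le> d / 8) sequentially"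
    by (rule rank_close[OF y emp]) (use d in auto)
  ultimately show ?thesis using eventually_ge_at_top[of 1]
  proof eventually_elim
    case (elim n)
    \<comment> \<open>The graph is 0 on the diagonal cells, where no pointwise comparison is
      possible. \<open>full\<close> puts values of \<open>U\<close> there; the correction
      \<open>diag\<close> occupies area 1 / n and costs at most K / n.\<close>
    define full where "full i j = U (y i) (y j)" for i j
    define diag where "diag i j = (if i = j then U (y i) (y i) else 0)" for i j :: nat
    let ?g = "graph_graphon n y"
    have H: "?g (H_graph n U y) s t = ?g full s t - ?g diag s t" for s t
      unfolding graph_graphon_diff unfolding graph_graphon_def
      by (intro sum.cong refl) (auto simp: H_graph_def full_def diag_def)
    note gint = graph_graphon_integrable[of n y]
    have "L1_norm (\<lambda>s t. ?g full s t - U s t) \<le> e / 2"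
    proof (rule L1_norm_le_const[OF set_integrable_diff_square[OF gint Uint]])
      fix s t :: real assume st: "s \<in> {0..1}" "t \<in> {0..1}"
      obtain i j where ij: "i \<in> {1..n}" "j \<in> {1..n}"
        "s \<in> block n (vertex_rank n y i)" "t \<in> block n (vertex_rank n y j)"
        and g: "\<And>\<beta>. ?g \<beta> s t = \<beta> i j"
        by (rule graph_graphon_cases[OF elim(4) st, of y]) (rule that)
      have cl: "\<bar>y k - r\<bar> < d / 2" if "k \<in> {1..n}" "r \<in> block n (vertex_rank n y k)" for k r
      proof -
        have "(real (vertex_rank n y k) - 1) / real n \<le> r" "r \<le> real (vertex_rank n y k) / real n"
          using block_le[OF elim(4) that(2)] by auto
        moreover have "(real (vertex_rank n y k) - 1) / real n = real (vertex_rank n y k) / real n - 1 / real n"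
          by (simp add: diff_divide_distrib)
        moreover have "\<bar>y k - real (vertex_rank n y k) / real n\<bar> \<le> d / 8" using elim(3) that(1) by blast
        ultimately show ?thesis using elim(1) d by linarith
      qed
      have "dist (y i, y j) (s, t) \<le> \<bar>y i - s\<bar> + \<bar>y j - t\<bar>"
        unfolding dist_Pair_Pair dist_real_def by (rule sqrt_sum_squares_le_sum_abs[THEN order_trans]) simp
      also have "\<dots> < d" using cl[OF ij(1,3)] cl[OF ij(2,4)] by linarith
      finally have "dist (U (y i) (y j)) (U s t) < e / 2"
        using dU[of "(s, t)" "(y i, y j)"] st y[of i] y[of j] ij by auto
      then show "\<bar>?g full s t - U s t\<bar> \<le> e / 2"
        by (simp add: g full_def dist_real_def)
    qed
    moreover have "L1_norm (\<lambda>s t. - ?g diag s t) \<le> e / 2"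
    proof -
      have "L1_norm (\<lambda>s t. - ?g diag s t) = L1_norm (?g diag)" by (simp add: L1_norm_def)
      also have "\<dots> \<le> (\<Sum>i\<in>{1..n}. \<Sum>j\<in>{1..n}. \<bar>diag i j\<bar>) / (real n)\<^sup>2"
        by (rule L1_norm_graph_graphon_le[OF elim(4)])
      also have "(\<Sum>i\<in>{1..n}. \<Sum>j\<in>{1..n}. \<bar>diag i j\<bar>) = (\<Sum>i\<in>{1..n}. \<bar>U (y i) (y i)\<bar>)"
        unfolding diag_def by (intro sum.cong refl) (simp add: if_distrib[of abs] sum.delta cong: if_cong)
      also have "\<dots> \<le> (\<Sum>i\<in>{1..n}. K)"
        by (rule sum_mono) (use K y in auto)
      also have "(\<Sum>i\<in>{1..n}. K) / (real n)\<^sup>2 = K / real n"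
        using elim(4) by (simp add: power2_eq_square)
      finally have "L1_norm (\<lambda>s t. - ?g diag s t) \<le> K / real n" by (simp add: divide_right_mono)
      then show ?thesis using elim(2) by linarith
    qed
    moreover have "d1 (?g (H_graph n U y)) U \<le> L1_norm (\<lambda>s t. ?g full s t - U s t) + L1_norm (\<lambda>s t. - ?g diag s t)"
    proof -
      have "d1 (?g (H_graph n U y)) U = L1_norm (\<lambda>s t. (?g full s t - U s t) + - ?g diag s t)"
        unfolding d1_def H by (simp add: algebra_simps)
      also have "\<dots> \<le> L1_norm (\<lambda>s t. ?g full s t - U s t) + L1_norm (\<lambda>s t. - ?g diag s t)"
      proof (rule L1_norm_add_le[OF set_integrable_diff_square[OF gint Uint]])
        show "set_integrable lborel ?Q (\<lambda>(s, t). - ?g diag s t)"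
          using set_integrable_mult_right[OF gint, of "-1"] by (simp add: case_prod_unfold)
      qed
      finally show ?thesis .
    qed
    ultimately show ?case by linarith
  qed
qed

section \<open>Convergence in L1\<close>

text \<open>What is required of one fixed sample sequence; given this, convergence becomes a
  deterministic matter. \<open>U\<close> may vary with \<open>e\<close>, but its bound holds for
  every n: this uniformity is what the maximal inequality provides.\<close>

definition sample_good :: "(real \<Rightarrow> real \<Rightarrow> real) \<Rightarrow> (nat \<Rightarrow> real) \<Rightarrow> bool" where
  "sample_good W y \<longleftrightarrow> (\<forall>i\<ge>1. y i \<in> {0..1}) \<and>
     (\<forall>q\<in>\<rat>. (\<lambda>n. empirical n y q) \<longlonglongrightarrow> min 1 (max 0 q)) \<and>
     (\<forall>e>0. \<exists>U. continuous_on UNIV (\<lambda>(s, t). U s t) \<and> L1_norm (\<lambda>s t. W s t - U s t) \<le> e \<and>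
        (\<forall>n. offdiag_sum (\<lambda>s t. \<bar>W s t - U s t\<bar>) n y \<le> e * (real n)\<^sup>2))"

lemma sum_abs_H_graph_diff:
  "(\<Sum>i\<in>{1..n}. \<Sum>j\<in>{1..n}. \<bar>H_graph n W y i j - H_graph n U y i j\<bar>) =
    offdiag_sum (\<lambda>s t. \<bar>W s t - U s t\<bar>) n y"
  unfolding offdiag_sum_def by (intro sum.cong refl) (simp add: H_graph_def)

text \<open>Three errors of e / 4: sampled \<open>W\<close> against sampled \<open>U\<close>,
  sampled \<open>U\<close> against \<open>U\<close>, and \<open>U\<close> against \<open>W\<close>.
  Only the second relies on n being large.\<close>

lemma d1_H_graph_tendsto:
  assumes W: "set_integrable lborel ({0..1} \<times> {0..1}) (\<lambda>(s, t). W s t)" and good: "sample_good W y"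
  shows "(\<lambda>n. d1 (graph_graphon n y (H_graph n W y)) W) \<longlonglongrightarrow> 0"
proof (rule tendstoI)
  fix e :: real assume e: "e > 0"
  have "e / 4 > 0" using e by simp
  then obtain U where U: "continuous_on UNIV (\<lambda>(s, t). U s t)" "L1_norm (\<lambda>s t. W s t - U s t) \<le> e / 4"
      "\<And>n. offdiag_sum (\<lambda>s t. \<bar>W s t - U s t\<bar>) n y \<le> e / 4 * (real n)\<^sup>2"
    using good unfolding sample_good_def by blast
  note Uint = set_integrable_continuous_square[OF U(1)]
  have "eventually (\<lambda>n. d1 (graph_graphon n y (H_graph n U y)) U \<le> e / 4) sequentially"
    by (rule d1_graph_graphon_continuous[OF _ _ U(1)]) (use good e in \<open>auto simp: sample_good_def\<close>)
  then show "eventually (\<lambda>n. dist (d1 (graph_graphon n y (H_graph n W y)) W) 0 < e) sequentially"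
    using eventually_ge_at_top[of 1]
  proof eventually_elim
    case (elim n)
    let ?g = "graph_graphon n y"
    have "L1_norm (\<lambda>s t. ?g (H_graph n W y) s t - ?g (H_graph n U y) s t) \<le> e / 4"
    proof -
      have "L1_norm (\<lambda>s t. ?g (H_graph n W y) s t - ?g (H_graph n U y) s t) \<le>
          offdiag_sum (\<lambda>s t. \<bar>W s t - U s t\<bar>) n y / (real n)\<^sup>2"
        unfolding graph_graphon_diff sum_abs_H_graph_diff[symmetric]
        by (rule L1_norm_graph_graphon_le[OF elim(2)])
      also have "\<dots> \<le> e / 4" using U(3)[of n] elim(2) by (simp add: divide_le_eq)
      finally show ?thesis .
    qed
    moreover have "L1_norm (\<lambda>s t. U s t - W s t) \<le> e / 4"
      using U(2) by (simp only: L1_norm_minus_commute[of U W])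
    moreover have "d1 (?g (H_graph n W y)) W \<le>
        L1_norm (\<lambda>s t. ?g (H_graph n W y) s t - ?g (H_graph n U y) s t) +
        (L1_norm (\<lambda>s t. ?g (H_graph n U y) s t - U s t) + L1_norm (\<lambda>s t. U s t - W s t))"
      unfolding d1_def
      using L1_norm_triangle[OF graph_graphon_integrable graph_graphon_integrable W, of n y "H_graph n W y" n y "H_graph n U y"]
        L1_norm_triangle[OF graph_graphon_integrable Uint W, of n y "H_graph n U y"] by linarith
    moreover have "d1 (?g (H_graph n W y)) W \<ge> 0" unfolding d1_def by (rule L1_norm_nonneg)
    ultimately show ?case using elim(1) e by (simp add: d1_def)
  qed
qed

lemma summable_exp_neg_mult:
  assumes "(c::real) > 0" shows "summable (\<lambda>n. exp (- c * real n))"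
proof -
  have "summable (\<lambda>n. exp (- c) ^ n)" using assms by (intro summable_geometric) simp
  then show ?thesis by (simp add: exp_of_nat_mult[symmetric] mult.commute)
qed

section \<open>Almost sure properties of the sample\<close>

context iid_uniform_seq
begin

lemma expectation_indicator_atMost:
  assumes i: "i \<ge> 1"
  shows "expectation (\<lambda>\<omega>. indicator {..q} (x i \<omega>)) = (min 1 (max 0 q) :: real)"
proof -
  have "expectation (\<lambda>\<omega>. indicator {..q} (x i \<omega>)) =
      (LINT t|distr M borel (x i). indicator {..q} t :: real)"
    using integral_distr[OF rv[OF i], of "indicator {..q} :: real \<Rightarrow> real"] by simp
  also have "\<dots> = measure (uniform_measure lborel {0..1}) {..q}"
    unfolding distr_x[OF i] by simp
  also have "\<dots> = measure lborel ({0..1} \<inter> {..q})"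
    by (subst measure_uniform_measure) auto
  also have "{0..1} \<inter> {..q} = {0..min 1 q}" by auto
  also have "measure lborel \<dots> = min 1 (max 0 q)" by (auto simp: min_def max_def)
  finally show ?thesis .
qed

text \<open>The indicators are bounded, so Hoeffding's inequality gives a geometric tail for each
  tolerance and Borel--Cantelli applies; the tolerances 1 / (k + 1) then yield the limit.\<close>

lemma AE_empirical: "AE \<omega> in M. (\<lambda>n. empirical n (\<lambda>i. x i \<omega>) q) \<longlonglongrightarrow> min 1 (max 0 q)"
proof -
  define p where "p = min 1 (max 0 q)"
  define X where "X i \<omega> = (indicator {..q} (x i \<omega>) :: real)" for i \<omega>
  have X_meas [measurable]: "X i \<in> borel_measurable M" if "i \<in> {1..n}" for i n
    using that rv[of i] unfolding X_def[abs_def] by simp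
  have emp: "empirical n (\<lambda>i. x i \<omega>) q = (\<Sum>i\<in>{1..n}. X i \<omega>) / real n" for n \<omega>
    unfolding empirical_def X_def indicator_def by (simp add: sum.If_cases Int_def)
  have dev: "AE \<omega> in M. eventually (\<lambda>n. \<bar>empirical n (\<lambda>i. x i \<omega>) q - p\<bar> < d) sequentially"
    if d: "d > 0" for d
  proof -
    define A where "A n = {\<omega>\<in>space M. \<bar>(\<Sum>i\<in>{1..n}. X i \<omega>) - real n * p\<bar> \<ge> real n * d}" for n
    have A [measurable]: "A n \<in> sets M" for n
      unfolding A_def by measurable
    have le: "prob (A n) \<le> 2 * exp (- (2 * d\<^sup>2) * real n)" for n
    proof (cases "n = 0")
      \<comment> \<open>Hoeffding's bound divides by the sum of squared ranges, which is 0 for n =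
        0; the claimed bound is then 2.\<close>
      case True
      have "prob (A n) \<le> 1" by simp
      also have "\<dots> \<le> 2 * exp (- (2 * d\<^sup>2) * real n)" using True by simp
      finally show ?thesis .
    next
      case False
      interpret H: Hoeffding_ineq M "{1..n}" X "\<lambda>_. 0" "\<lambda>_. 1" "real n * p"
      proof unfold_locales
        show "indep_vars (\<lambda>_. borel) X {1..n}"
          unfolding X_def[abs_def]
          by (rule indep_vars_compose2[OF indep_vars_subset[OF indep]]) auto
        have "(\<Sum>i\<in>{1..n}. expectation (X i)) = (\<Sum>i\<in>{1..n}. p)"
          unfolding X_def[abs_def] p_def by (intro sum.cong refl expectation_indicator_atMost) simp
        then have "real n * p = (\<Sum>i\<in>{1..n}. expectation (X i))" by simp
        then show "real n * p \<equiv> (\<Sum>i\<in>{1..n}. expectation (X i))" by (rule eq_reflection)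
      qed (auto simp: X_def indicator_def)
      have "prob (A n) \<le> 2 * exp (- 2 * (real n * d)\<^sup>2 / (\<Sum>i\<in>{1..n}. (1 - 0)\<^sup>2))"
        unfolding A_def by (rule H.Hoeffding_ineq_abs_ge) (use False d in auto)
      also have "- 2 * (real n * d)\<^sup>2 / (\<Sum>i\<in>{1..n}. (1 - 0)\<^sup>2) = - (2 * d\<^sup>2) * real n"
        using False by (simp add: power2_eq_square)
      finally show ?thesis .
    qed
    have "summable (\<lambda>n. prob (A n))"
    proof (rule summable_comparison_test)
      show "summable (\<lambda>n. 2 * exp (- (2 * d\<^sup>2) * real n))"
        by (intro summable_mult summable_exp_neg_mult) (use d in simp)
    qed (use le in auto)
    then have "AE \<omega> in M. eventually (\<lambda>n. \<omega> \<in> space M - A n) sequentially"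
      by (intro borel_cantelli_AE1) (auto simp: less_top[symmetric])
    then show ?thesis
    proof eventually_elim
      case (elim \<omega>)
      then show ?case using eventually_gt_at_top[of 0]
      proof eventually_elim
        case (elim n)
        then have "\<bar>(\<Sum>i\<in>{1..n}. X i \<omega>) - real n * p\<bar> < real n * d" by (auto simp: A_def)
        moreover have "(\<Sum>i\<in>{1..n}. X i \<omega>) / real n - p = ((\<Sum>i\<in>{1..n}. X i \<omega>) - real n * p) / real n"
          using elim(2) by (simp add: field_simps)
        ultimately show ?case unfolding emp using elim(2) by (simp add: abs_divide divide_less_eq mult.commute)
      qed
    qed
  qed
  have "AE \<omega> in M. \<forall>k. eventually (\<lambda>n. \<bar>empirical n (\<lambda>i. x i \<omega>) q - p\<bar> < 1 / real (Suc k)) sequentially"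
    unfolding AE_all_countable by (intro allI dev) simp
  then show ?thesis
  proof eventually_elim
    case (elim \<omega>)
    show ?case unfolding p_def[symmetric]
    proof (rule tendstoI)
      fix e :: real assume "e > 0"
      then obtain k where "1 / real (Suc k) < e" by (rule nat_approx_posE)
      with elim[rule_format, of k] show "eventually (\<lambda>n. dist (empirical n (\<lambda>i. x i \<omega>) q) p < e) sequentially"
        by (auto elim: eventually_mono simp: dist_real_def)
    qed
  qed
qed

text \<open>With L1 error 1 / 4^k and threshold 1 / 2^k, the maximal inequality leaves an
  exceptional probability of at most 1 / 2^k. This is summable in k, so almost surely every large k
  is good for all n simultaneously.\<close>

lemma AE_sample_good:
  assumes W: "set_integrable lborel ({0..1} \<times> {0..1}) (\<lambda>(s, t). W s t)"
  shows "AE \<omega> in M. sample_good W (\<lambda>i. x i \<omega>)"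
proof -
  let ?Q = "{0..1::real} \<times> {0..1::real}"
  \<comment> \<open>\<open>W\<close> may be arbitrary off the square. Extension by zero makes it
    Borel on the whole plane, as the maximal inequality demands; the sample lies in the square
    almost surely.\<close>
  define W' where "W' s t = (if s \<in> {0..1} \<and> t \<in> {0..1} then W s t else 0)" for s t
  have W'_eq: "(\<lambda>z. case z of (s, t) \<Rightarrow> W' s t) = (\<lambda>z. indicator ?Q z *\<^sub>R (case z of (s, t) \<Rightarrow> W s t))"
    by (auto simp: W'_def fun_eq_iff indicator_def)
  have W'_meas [measurable]: "(\<lambda>(s, t). W' s t) \<in> borel_measurable borel"
    using W unfolding W'_eq set_integrable_def by (auto dest: borel_measurable_integrable)
  have Qb: "?Q \<in> sets borel" by (simp add: borel_prod[symmetric] del: borel_prod)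
  have Qf: "emeasure lborel ?Q < \<infinity>"
    by (subst lborel_prod[symmetric], subst lborel.emeasure_pair_measure_Times) auto
  have ex: "\<exists>g. continuous_on UNIV g \<and> set_integrable lborel ?Q g \<and>
     (LINT z:?Q|lborel. \<bar>(case z of (s, t) \<Rightarrow> W s t) - g z\<bar>) < (1 / 4) ^ k" for k :: nat
  proof -
    have "(1 / 4 :: real) ^ k > 0" by simp
    from continuous_L1_approx[OF W Qb Qf this] show ?thesis by blast
  qed
  have "\<exists>g. \<forall>k. continuous_on UNIV (g k) \<and> set_integrable lborel ?Q (g k) \<and>
     (LINT z:?Q|lborel. \<bar>(case z of (s, t) \<Rightarrow> W s t) - g k z\<bar>) < (1 / 4) ^ k"
    by (intro choice allI ex)
  then obtain g where g: "\<And>k. continuous_on UNIV (g k)" "\<And>k. set_integrable lborel ?Q (g k)"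
    "\<And>k. (LINT z:?Q|lborel. \<bar>(case z of (s, t) \<Rightarrow> W s t) - g k z\<bar>) < (1 / 4) ^ k"
    by blast
  define U where "U k s t = g k (s, t)" for k s t
  have U: "continuous_on UNIV (\<lambda>(s, t). U k s t)" for k
    using g(1)[of k] by (simp add: U_def)
  have L1: "L1_norm (\<lambda>s t. W s t - U k s t) \<le> (1 / 4) ^ k" for k
    using g(3)[of k] by (simp add: L1_norm_def U_def case_prod_unfold)
  define f where "f k s t = \<bar>W' s t - U k s t\<bar>" for k s t
  have f_meas: "(\<lambda>(s, t). f k s t) \<in> borel_measurable borel" for k
  proof -
    have "g k \<in> borel_measurable borel" using g(1) by (rule borel_measurable_continuous_onI)
    then have "(\<lambda>z. \<bar>(case z of (s, t) \<Rightarrow> W' s t) - g k z\<bar>) \<in> borel_measurable borel"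
      using W'_meas by measurable
    then show ?thesis by (simp add: f_def U_def case_prod_unfold)
  qed
  have f_eq: "f k s t = \<bar>W s t - U k s t\<bar>" if "s \<in> {0..1}" "t \<in> {0..1}" for k s t
    using that by (simp add: f_def W'_def)
  have fint: "set_integrable lborel ?Q (\<lambda>(s, t). f k s t)" for k
  proof -
    have "set_integrable lborel ?Q (\<lambda>z. \<bar>(case z of (s, t) \<Rightarrow> W s t) - g k z\<bar>)"
      using set_integral_diff(1)[OF W g(2)[of k]] by (rule set_integrable_abs)
    then show ?thesis
      by (rule set_integrable_cong[THEN iffD1, rotated 3]) (auto simp: f_eq U_def)
  qed
  have L1f: "L1_norm (f k) \<le> (1 / 4) ^ k" for k
  proof -
    have "L1_norm (f k) = L1_norm (\<lambda>s t. W s t - U k s t)"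
      unfolding L1_norm_def by (rule set_lebesgue_integral_cong) (use Qb in \<open>auto simp: f_eq\<close>)
    then show ?thesis using L1[of k] by simp
  qed
  define A where "A k = {\<omega>\<in>space M. \<exists>n\<ge>2. (1 / 2) ^ k * real (n * (n - 1)) < offdiag_sum (f k) n (\<lambda>i. x i \<omega>)}"
    for k
  have [measurable]: "(\<lambda>\<omega>. offdiag_sum (f k) n (\<lambda>i. x i \<omega>)) \<in> borel_measurable M" for n k
    by (rule offdiag_sum_measurable[OF f_meas]) (simp add: rv)
  have A [measurable]: "A k \<in> sets M" for k unfolding A_def by measurable
  have le: "prob (A k) \<le> (1 / 2) ^ k" for k
  proof -
    have "(1 / 2) ^ k * prob (A k) \<le> L1_norm (f k)"
      unfolding A_def by (rule maximal_ineq[OF f_meas _ _ fint]) (auto simp: f_def)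
    also note L1f[of k]
    also have "(1 / 4) ^ k = (1 / 2 :: real) ^ k * (1 / 2) ^ k" by (simp add: power_mult_distrib[symmetric])
    finally show ?thesis by simp
  qed
  have "summable (\<lambda>k. prob (A k))"
  proof (rule summable_comparison_test)
    show "summable (\<lambda>k. (1 / 2 :: real) ^ k)" by (intro summable_geometric) simp
  qed (use le in auto)
  then have "AE \<omega> in M. eventually (\<lambda>k. \<omega> \<in> space M - A k) sequentially"
    by (intro borel_cantelli_AE1) (auto simp: less_top[symmetric])
  \<comment> \<open>Restricting to countably many \<open>q\<close> allows one common null
    set.\<close>
  moreover have "AE \<omega> in M. \<forall>q\<in>\<rat>. (\<lambda>n. empirical n (\<lambda>i. x i \<omega>) q) \<longlonglongrightarrow> min 1 (max 0 q)"
    by (subst AE_ball_countable) (use AE_empirical countable_rat in auto)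
  ultimately show ?thesis using AE_range
  proof eventually_elim
    case (elim \<omega>)
    let ?y = "\<lambda>i. x i \<omega>"
    have "\<exists>U. continuous_on UNIV (\<lambda>(s, t). U s t) \<and> L1_norm (\<lambda>s t. W s t - U s t) \<le> e \<and>
        (\<forall>n. offdiag_sum (\<lambda>s t. \<bar>W s t - U s t\<bar>) n ?y \<le> e * (real n)\<^sup>2)" if e: "e > 0" for e
    proof -
      have "eventually (\<lambda>k. (1 / 2) ^ k < e) sequentially" using e by real_asymp
      with elim(1) have "eventually (\<lambda>k. \<omega> \<in> space M - A k \<and> (1 / 2) ^ k < e) sequentially"
        by (rule eventually_conj)
      then obtain k where k: "\<omega> \<in> space M - A k" "(1 / 2) ^ k < e"
        using eventually_happens by fastforce
      have "offdiag_sum (\<lambda>s t. \<bar>W s t - U k s t\<bar>) n ?y \<le> e * (real n)\<^sup>2" for n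
      proof -
        have "offdiag_sum (\<lambda>s t. \<bar>W s t - U k s t\<bar>) n ?y = offdiag_sum (f k) n ?y"
          unfolding offdiag_sum_def by (intro sum.cong refl) (use elim(3) in \<open>simp add: f_eq\<close>)
        also have "\<dots> \<le> (1 / 2) ^ k * (real n)\<^sup>2"
        proof (cases "n \<ge> 2")
          case True
          then have "offdiag_sum (f k) n ?y \<le> (1 / 2) ^ k * real (n * (n - 1))"
            using k(1) unfolding A_def by (intro leI notI) blast
          also have "\<dots> \<le> (1 / 2) ^ k * (real n)\<^sup>2"
            by (intro mult_left_mono) (simp_all add: power2_eq_square mult_left_mono)
          finally show ?thesis .
        next
          case False
          then have "n = 0 \<or> n = 1" by auto
          then show ?thesis by (auto simp: offdiag_sum_def)
        qed
        also have "\<dots> \<le> e * (real n)\<^sup>2" using k(2) by (intro mult_right_mono) auto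
        finally show ?thesis .
      qed
      moreover have "L1_norm (\<lambda>s t. W s t - U k s t) \<le> e"
      proof -
        have "(1 / 4 :: real) ^ k \<le> (1 / 2) ^ k" by (intro power_mono) auto
        then show ?thesis using L1[of k] k(2) by linarith
      qed
      ultimately show ?thesis using U by blast
    qed
    then show ?case using elim(2,3) unfolding sample_good_def by blast
  qed
qed

end

section \<open>Concentration of the random graph\<close>

definition upper_pairs :: "nat \<Rightarrow> (nat \<times> nat) set" where
  "upper_pairs n = {(i, j). 1 \<le> i \<and> i < j \<and> j \<le> n}"

lemma finite_upper_pairs [simp]: "finite (upper_pairs n)"
  by (rule finite_subset[of _ "{1..n} \<times> {1..n}"]) (auto simp: upper_pairs_def)

lemma sum_square_eq_upper_pairs:
  fixes h :: "nat \<Rightarrow> nat \<Rightarrow> real"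
  assumes "\<And>i. h i i = 0"
  shows "(\<Sum>i\<in>{1..n}. \<Sum>j\<in>{1..n}. h i j) = (\<Sum>e\<in>upper_pairs n. h (fst e) (snd e) + h (snd e) (fst e))"
proof -
  let ?N = "{1..n}"
  have "(\<Sum>i\<in>?N. \<Sum>j\<in>?N. h i j) =
      (\<Sum>i\<in>?N. \<Sum>j\<in>?N. (if i < j then h i j else 0) + (if j < i then h i j else 0))"
  proof (intro sum.cong refl)
    fix i j show "h i j = (if i < j then h i j else 0) + (if j < i then h i j else 0)"
      using assms[of i] by (cases i j rule: linorder_cases) auto
  qed
  also have "\<dots> = (\<Sum>i\<in>?N. \<Sum>j\<in>?N. if i < j then h i j else 0) + (\<Sum>i\<in>?N. \<Sum>j\<in>?N. if j < i then h i j else 0)"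
    by (simp only: sum.distrib)
  also have "(\<Sum>i\<in>?N. \<Sum>j\<in>?N. if j < i then h i j else 0) = (\<Sum>j\<in>?N. \<Sum>i\<in>?N. if j < i then h i j else 0)"
    by (rule sum.swap)
  also have "(\<Sum>i\<in>?N. \<Sum>j\<in>?N. if i < j then h i j else 0) + (\<Sum>j\<in>?N. \<Sum>i\<in>?N. if j < i then h i j else 0) =
      (\<Sum>i\<in>?N. \<Sum>j\<in>?N. if i < j then h i j + h j i else 0)"
    by (simp only: sum.distrib[symmetric]) (intro sum.cong refl, simp)
  also have "\<dots> = (\<Sum>e\<in>?N \<times> ?N. if fst e < snd e then h (fst e) (snd e) + h (snd e) (fst e) else 0)"
    by (simp add: sum.cartesian_product case_prod_unfold)
  also have "\<dots> = (\<Sum>e\<in>upper_pairs n. h (fst e) (snd e) + h (snd e) (fst e))"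
    by (rule sum.mono_neutral_cong_right) (auto simp: upper_pairs_def)
  finally show ?thesis .
qed

text \<open>For y = - z < 0 the claim reads 1 \<le> (1 - z + z^2) exp z, and the quadratic Taylor
  bound for \<open>exp z\<close> is enough, since the product of the two quadratics exceeds 1 by
  nonnegative terms.\<close>

lemma exp_le_quadratic:
  assumes "\<bar>y :: real\<bar> \<le> 1" shows "exp y \<le> 1 + y + y\<^sup>2"
proof (cases "y \<ge> 0")
  case True
  then show ?thesis using exp_bound[of y] assms by simp
next
  case False
  define z where "z = - y"
  have z: "z \<ge> 0" using False by (simp add: z_def)
  have "1 + z + z\<^sup>2 / 2 \<le> exp z" by (rule exp_lower_Taylor_quadratic[OF z])
  moreover have "1 + z + z\<^sup>2 / 2 > 0" using z by (simp add: add_pos_nonneg)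
  ultimately have "exp y \<le> 1 / (1 + z + z\<^sup>2 / 2)"
    unfolding z_def exp_minus by (simp add: field_simps exp_minus)
  also have "\<dots> \<le> 1 - z + z\<^sup>2"
  proof -
    have "(1 - z + z\<^sup>2) * (1 + z + z\<^sup>2 / 2) = 1 + z\<^sup>2 / 2 + z ^ 3 / 2 + z ^ 4 / 2"
      by (simp add: field_simps power2_eq_square power3_eq_cube power4_eq_xxxx)
    also have "\<dots> \<ge> 1" using z by simp
    finally show ?thesis using \<open>1 + z + z\<^sup>2 / 2 > 0\<close> by (simp add: divide_le_eq)
  qed
  finally show ?thesis by (simp add: z_def)
qed

text \<open>For \<rho> \<ge> 0 this is the mean of \<open>edge_pmf \<rho> b\<close>, and also
  \<open>\<rho> * b\<close> clipped to [-1, 1].\<close>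

definition edge_mean :: "real \<Rightarrow> real \<Rightarrow> real" where
  "edge_mean \<rho> b = sgn b * min (\<rho> * \<bar>b\<bar>) 1"

lemma set_edge_pmf: "set_pmf (edge_pmf \<rho> b) \<subseteq> {-1, 0, 1}"
  unfolding edge_pmf_def by (auto simp: sgn_real_def)

text \<open>Centring cancels the linear terms of the quadratic bound. What remains is the variance p
  (1 - p) \<le> \<rho> \<bar>b\<bar>, the source of the factor \<rho> in the exponent.\<close>

lemma edge_pmf_mgf:
  assumes \<rho>: "\<rho> \<ge> 0" and t: "\<bar>t\<bar> \<le> 1"
  shows "measure_pmf.expectation (edge_pmf \<rho> b) (\<lambda>v. exp (t * (v - edge_mean \<rho> b))) \<le> exp (t\<^sup>2 * (\<rho> * \<bar>b\<bar>))"
proof -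
  define p where "p = min (\<rho> * \<bar>b\<bar>) 1"
  have p: "0 \<le> p" "p \<le> 1" using \<rho> by (auto simp: p_def)
  \<comment> \<open>Absorbs the sign of the edge, which leaves a plain Bernoulli variable; b = 0
    gives s = 0.\<close>
  define s where "s = t * sgn b"
  have s: "\<bar>s\<bar> \<le> 1" "s\<^sup>2 \<le> t\<^sup>2" using t by (auto simp: s_def sgn_real_def abs_mult)
  have b1: "\<bar>s * (1 - p)\<bar> \<le> 1" "\<bar>- (s * p)\<bar> \<le> 1"
    using s(1) p by (auto simp: abs_mult intro!: mult_le_one)
  have "measure_pmf.expectation (edge_pmf \<rho> b) (\<lambda>v. exp (t * (v - edge_mean \<rho> b))) =
      exp (s * (1 - p)) * p + exp (- (s * p)) * (1 - p)"
    unfolding edge_pmf_def edge_mean_def p_def[symmetric] using p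
    by (simp add: s_def algebra_simps)
  also have "\<dots> \<le> (1 + s * (1 - p) + (s * (1 - p))\<^sup>2) * p + (1 + - (s * p) + (- (s * p))\<^sup>2) * (1 - p)"
    using p by (intro add_mono mult_right_mono exp_le_quadratic b1) auto
  also have "\<dots> = 1 + s\<^sup>2 * (p * (1 - p))"
    by (simp add: field_simps power2_eq_square)
  also have "\<dots> \<le> 1 + t\<^sup>2 * (\<rho> * \<bar>b\<bar>)"
  proof -
    have "p * (1 - p) \<le> p" using p by (simp add: mult_left_le)
    also have "p \<le> \<rho> * \<bar>b\<bar>" by (simp add: p_def)
    finally have "p * (1 - p) \<le> \<rho> * \<bar>b\<bar>" .
    with s(2) have "s\<^sup>2 * (p * (1 - p)) \<le> t\<^sup>2 * (\<rho> * \<bar>b\<bar>)"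
      by (rule mult_mono) (use p in auto)
    then show ?thesis by simp
  qed
  also have "\<dots> \<le> exp (t\<^sup>2 * (\<rho> * \<bar>b\<bar>))" by (rule exp_ge_add_one_self)
  finally show ?thesis .
qed

text \<open>The random graph before symmetrising: here the coordinates are independent and
  exponential moments factor.\<close>

definition edges_pmf :: "nat \<Rightarrow> wgraph \<Rightarrow> real \<Rightarrow> (nat \<times> nat \<Rightarrow> real) pmf" where
  "edges_pmf n \<beta> \<rho> = Pi_pmf (upper_pairs n) 0 (\<lambda>(i, j). edge_pmf \<rho> (\<beta> i j))"

definition symmetrise :: "(nat \<times> nat \<Rightarrow> real) \<Rightarrow> wgraph" where
  "symmetrise g = (\<lambda>i j. if i < j then g (i, j) else if j < i then g (j, i) else 0)"

lemma G_pmf_eq: "G_pmf n \<beta> \<rho> = map_pmf symmetrise (edges_pmf n \<beta> \<rho>)"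
  unfolding G_pmf_def edges_pmf_def symmetrise_def[abs_def] upper_pairs_def ..

text \<open>A finite set that carries \<open>G_pmf n \<beta> \<rho>\<close> for all
  \<open>\<beta>\<close> and \<open>\<rho>\<close>. It does not depend on the sample, so events
  about the graph split into finitely many values.\<close>

definition signed_graphs :: "nat \<Rightarrow> wgraph set" where
  "signed_graphs n = symmetrise ` PiE_dflt (upper_pairs n) 0 (\<lambda>_. {-1, 0, 1})"

lemma set_edges_pmf: "set_pmf (edges_pmf n \<beta> \<rho>) \<subseteq> PiE_dflt (upper_pairs n) 0 (\<lambda>_. {-1, 0, 1})"
  unfolding edges_pmf_def
  using set_Pi_pmf_subset'[OF finite_upper_pairs, of n 0 "\<lambda>(i, j). edge_pmf \<rho> (\<beta> i j)"] set_edge_pmf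
  by (fastforce simp: PiE_dflt_def split: prod.splits)

lemma finite_signed_graphs: "finite (signed_graphs n)"
  unfolding signed_graphs_def by (intro finite_imageI finite_PiE_dflt) auto

lemma set_G_pmf: "set_pmf (G_pmf n \<beta> \<rho>) \<subseteq> signed_graphs n"
  unfolding G_pmf_eq signed_graphs_def set_map_pmf by (rule image_mono[OF set_edges_pmf])

lemma finite_set_edges_pmf: "finite (set_pmf (edges_pmf n \<beta> \<rho>))"
  by (rule finite_subset[OF set_edges_pmf]) (rule finite_PiE_dflt, auto)

lemma edges_pmf_mgf:
  assumes \<rho>: "\<rho> \<ge> 0" and c: "\<And>e. e \<in> upper_pairs n \<Longrightarrow> \<bar>c e\<bar> \<le> 1"
  shows "measure_pmf.expectation (edges_pmf n \<beta> \<rho>)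
      (\<lambda>g. exp (\<Sum>e\<in>upper_pairs n. c e * (g e - edge_mean \<rho> (\<beta> (fst e) (snd e)))))
    \<le> exp (\<Sum>e\<in>upper_pairs n. (c e)\<^sup>2 * (\<rho> * \<bar>\<beta> (fst e) (snd e)\<bar>))"
proof -
  let ?E = "upper_pairs n"
  let ?p = "\<lambda>(i, j). edge_pmf \<rho> (\<beta> i j)"
  let ?f = "\<lambda>e v. exp (c e * (v - edge_mean \<rho> (\<beta> (fst e) (snd e))))"
  have fin: "finite (set_pmf (?p e))" for e
    by (rule finite_subset[of _ "{-1, 0, 1}"]) (use set_edge_pmf in \<open>auto split: prod.splits\<close>)
  have "measure_pmf.expectation (edges_pmf n \<beta> \<rho>)
      (\<lambda>g. exp (\<Sum>e\<in>?E. c e * (g e - edge_mean \<rho> (\<beta> (fst e) (snd e))))) =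
      measure_pmf.expectation (Pi_pmf ?E 0 ?p) (\<lambda>g. \<Prod>e\<in>?E. ?f e (g e))"
    by (simp add: edges_pmf_def exp_sum)
  also have "\<dots> = (\<Prod>e\<in>?E. measure_pmf.expectation (?p e) (?f e))"
    by (rule expectation_prod_Pi_pmf[OF finite_upper_pairs integrable_measure_pmf_finite[OF fin]]) simp
  also have "\<dots> \<le> (\<Prod>e\<in>?E. exp ((c e)\<^sup>2 * (\<rho> * \<bar>\<beta> (fst e) (snd e)\<bar>)))"
  proof (rule prod_mono)
    fix e assume e: "e \<in> ?E"
    have "measure_pmf.expectation (?p e) (?f e) \<le> exp ((c e)\<^sup>2 * (\<rho> * \<bar>\<beta> (fst e) (snd e)\<bar>))"
      using edge_pmf_mgf[OF \<rho> c[OF e], of "\<beta> (fst e) (snd e)"] by (simp add: case_prod_unfold)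
    moreover have "0 \<le> measure_pmf.expectation (?p e) (?f e)"
      by (rule Bochner_Integration.integral_nonneg) simp
    ultimately show "0 \<le> measure_pmf.expectation (?p e) (?f e) \<and>
        measure_pmf.expectation (?p e) (?f e) \<le> exp ((c e)\<^sup>2 * (\<rho> * \<bar>\<beta> (fst e) (snd e)\<bar>))"
      by blast
  qed
  also have "\<dots> = exp (\<Sum>e\<in>?E. (c e)\<^sup>2 * (\<rho> * \<bar>\<beta> (fst e) (snd e)\<bar>))"
    by (simp add: exp_sum)
  finally show ?thesis .
qed

text \<open>The weight of an edge in the sum over \<open>S \<times> T\<close> is the number of its orientations in \<open>S \<times> T\<close>.\<close>

lemma cut_sum_eq:
  assumes S: "S \<subseteq> {1..n}" and T: "T \<subseteq> {1..n}"
    and sym: "\<And>i j. \<beta> i j = \<beta> j i" and diag: "\<And>i. \<beta> i i = 0"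
  shows "(\<Sum>i\<in>S. \<Sum>j\<in>T. symmetrise g i j - edge_mean \<rho> (\<beta> i j)) =
    (\<Sum>e\<in>upper_pairs n. (of_bool (fst e \<in> S \<and> snd e \<in> T) + of_bool (snd e \<in> S \<and> fst e \<in> T)) *
        (g e - edge_mean \<rho> (\<beta> (fst e) (snd e))))"
proof -
  define h where "h i j = (if i \<in> S \<and> j \<in> T then symmetrise g i j - edge_mean \<rho> (\<beta> i j) else 0)" for i j
  have "(\<Sum>i\<in>S. \<Sum>j\<in>T. symmetrise g i j - edge_mean \<rho> (\<beta> i j)) = (\<Sum>i\<in>S. \<Sum>j\<in>T. h i j)"
    by (intro sum.cong refl) (simp add: h_def)
  also have "\<dots> = (\<Sum>i\<in>S. \<Sum>j\<in>{1..n}. h i j)"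
    using T by (intro sum.cong refl sum.mono_neutral_left) (auto simp: h_def)
  also have "\<dots> = (\<Sum>i\<in>{1..n}. \<Sum>j\<in>{1..n}. h i j)"
    using S by (intro sum.mono_neutral_left) (auto simp: h_def)
  also have "\<dots> = (\<Sum>e\<in>upper_pairs n. h (fst e) (snd e) + h (snd e) (fst e))"
    by (rule sum_square_eq_upper_pairs) (simp add: h_def symmetrise_def edge_mean_def diag)
  also have "\<dots> = (\<Sum>e\<in>upper_pairs n. (of_bool (fst e \<in> S \<and> snd e \<in> T) + of_bool (snd e \<in> S \<and> fst e \<in> T)) *
        (g e - edge_mean \<rho> (\<beta> (fst e) (snd e))))"
  proof (intro sum.cong refl)
    fix e assume "e \<in> upper_pairs n"
    then obtain i j where e: "e = (i, j)" "i < j" by (auto simp: upper_pairs_def)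
    then show "h (fst e) (snd e) + h (snd e) (fst e) =
        (of_bool (fst e \<in> S \<and> snd e \<in> T) + of_bool (snd e \<in> S \<and> fst e \<in> T)) *
        (g e - edge_mean \<rho> (\<beta> (fst e) (snd e)))"
      by (auto simp: h_def symmetrise_def sym[of j i])
  qed
  finally show ?thesis .
qed

text \<open>Half of the exponent \<open>l * a\<close> pays for the exponential moment; the other
  half is the decay.\<close>

lemma pmf_Chernoff:
  fixes Y :: "'b \<Rightarrow> real"
  assumes fin: "finite (set_pmf p)" and l: "l \<ge> 0"
    and mgf: "measure_pmf.expectation p (\<lambda>g. exp (l * Y g)) \<le> exp (l * a / 2)"
  shows "measure_pmf.prob p {g. Y g \<ge> a} \<le> exp (- (l * a / 2))"
proof -
  have "measure_pmf.prob p {g. Y g \<ge> a} \<le> measure_pmf.prob p {g \<in> space (measure_pmf p). exp (l * Y g) \<ge> exp (l * a)}"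
    using l by (intro measure_pmf.finite_measure_mono) (auto intro: mult_left_mono)
  also have "\<dots> \<le> measure_pmf.expectation p (\<lambda>g. exp (l * Y g)) / exp (l * a)"
    by (rule integral_Markov_inequality_measure[where A = UNIV])
       (auto intro: integrable_measure_pmf_finite[OF fin])
  also have "\<dots> \<le> exp (l * a / 2) / exp (l * a)"
    by (intro divide_right_mono mgf) simp
  also have "\<dots> = exp (- (l * a / 2))"
    by (simp add: exp_diff[symmetric])
  finally show ?thesis .
qed

text \<open>Edges enter the cut sum with weight at most 2, so l \<le> 1 / 2 keeps the exponents in
  the range of the quadratic bound. The logarithm of the moment is at most 2 l^2 \<rho> C n^2, which
  4 l C \<le> \<epsilon> brings down to half of l \<epsilon> \<rho> n^2. Thus \<open>l\<close> can
  be chosen independently of n.\<close>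

lemma G_pmf_tail:
  assumes S: "S \<subseteq> {1..n}" and T: "T \<subseteq> {1..n}"
    and sym: "\<And>i j. \<beta> i j = \<beta> j i" and diag: "\<And>i. \<beta> i i = 0"
    and \<rho>: "\<rho> > 0" and \<epsilon>: "\<epsilon> > 0" and C: "C > 0"
    and sum: "(\<Sum>i\<in>{1..n}. \<Sum>j\<in>{1..n}. \<bar>\<beta> i j\<bar>) \<le> C * (real n)\<^sup>2"
    and l: "0 < l" "l \<le> 1 / 2" "4 * l * C \<le> \<epsilon>"
  shows "measure_pmf.prob (G_pmf n \<beta> \<rho>)
      {g. \<bar>\<Sum>i\<in>S. \<Sum>j\<in>T. g i j - edge_mean \<rho> (\<beta> i j)\<bar> \<ge> \<epsilon> * \<rho> * (real n)\<^sup>2}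
    \<le> 2 * exp (- (l * (\<epsilon> * \<rho> * (real n)\<^sup>2) / 2))"
proof -
  let ?E = "upper_pairs n"
  let ?p = "edges_pmf n \<beta> \<rho>"
  define a where "a = \<epsilon> * \<rho> * (real n)\<^sup>2"
  define c where "c e = (of_bool (fst e \<in> S \<and> snd e \<in> T) + of_bool (snd e \<in> S \<and> fst e \<in> T) :: real)" for e
  have c: "0 \<le> c e" "c e \<le> 2" for e by (auto simp: c_def)
  define Y where "Y g = (\<Sum>e\<in>?E. c e * (g e - edge_mean \<rho> (\<beta> (fst e) (snd e))))" for g
  have Y: "(\<Sum>i\<in>S. \<Sum>j\<in>T. symmetrise g i j - edge_mean \<rho> (\<beta> i j)) = Y g" for g
    unfolding Y_def c_def by (rule cut_sum_eq[OF S T sym diag])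
  \<comment> \<open>The full matrix sum counts each unordered pair twice.\<close>
  have sumE: "2 * (\<Sum>e\<in>?E. \<bar>\<beta> (fst e) (snd e)\<bar>) \<le> C * (real n)\<^sup>2"
  proof -
    have "(\<Sum>i\<in>{1..n}. \<Sum>j\<in>{1..n}. \<bar>\<beta> i j\<bar>) = (\<Sum>e\<in>?E. \<bar>\<beta> (fst e) (snd e)\<bar> + \<bar>\<beta> (snd e) (fst e)\<bar>)"
      by (rule sum_square_eq_upper_pairs) (simp add: diag)
    also have "\<dots> = (\<Sum>e\<in>?E. 2 * \<bar>\<beta> (fst e) (snd e)\<bar>)"
      by (intro sum.cong refl) (simp add: sym[of "snd e" "fst e" for e])
    finally show ?thesis using sum by (simp add: sum_distrib_left)
  qed
  \<comment> \<open>The values s = 1 and s = -1 serve the upper and the lower tail.\<close>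
  have mgf: "measure_pmf.expectation ?p (\<lambda>g. exp (l * (s * Y g))) \<le> exp (l * a / 2)" if s: "\<bar>s\<bar> = 1" for s
  proof -
    have cl: "\<bar>l * s * c e\<bar> \<le> 1" for e
    proof -
      have "\<bar>l * s * c e\<bar> = l * c e" using l(1) c(1)[of e] s by (simp add: abs_mult)
      also have "\<dots> \<le> 1 / 2 * 2" using l c[of e] by (intro mult_mono) auto
      finally show ?thesis by simp
    qed
    have "measure_pmf.expectation ?p (\<lambda>g. exp (l * (s * Y g))) =
        measure_pmf.expectation ?p (\<lambda>g. exp (\<Sum>e\<in>?E. (l * s * c e) * (g e - edge_mean \<rho> (\<beta> (fst e) (snd e)))))"
      unfolding Y_def by (simp add: sum_distrib_left mult.assoc)
    also have "\<dots> \<le> exp (\<Sum>e\<in>?E. (l * s * c e)\<^sup>2 * (\<rho> * \<bar>\<beta> (fst e) (snd e)\<bar>))"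
      by (rule edges_pmf_mgf) (use \<rho> cl in auto)
    also have "\<dots> \<le> exp (l * a / 2)"
    proof -
      have "(\<Sum>e\<in>?E. (l * s * c e)\<^sup>2 * (\<rho> * \<bar>\<beta> (fst e) (snd e)\<bar>)) \<le>
          (\<Sum>e\<in>?E. 4 * l\<^sup>2 * (\<rho> * \<bar>\<beta> (fst e) (snd e)\<bar>))"
      proof (intro sum_mono mult_right_mono)
        fix e
        have "(l * s * c e)\<^sup>2 = l\<^sup>2 * (c e)\<^sup>2"
          using s by (simp add: power_mult_distrib abs_eq_iff')  (metis abs_eq_iff' mult.right_neutral one_power2 power2_abs s)
        also have "(c e)\<^sup>2 \<le> 2\<^sup>2" using c[of e] by (intro power_mono)
        finally show "(l * s * c e)\<^sup>2 \<le> 4 * l\<^sup>2" by (simp add: mult_left_mono)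
      qed (use \<rho> in auto)
      also have "\<dots> = 2 * l\<^sup>2 * \<rho> * (2 * (\<Sum>e\<in>?E. \<bar>\<beta> (fst e) (snd e)\<bar>))"
        by (simp add: sum_distrib_left mult_ac)
      also have "\<dots> \<le> 2 * l\<^sup>2 * \<rho> * (C * (real n)\<^sup>2)"
        using \<rho> by (intro mult_left_mono sumE) auto
      also have "\<dots> = (4 * l * C) * (l * \<rho> * (real n)\<^sup>2) / 2"
        by (simp add: power2_eq_square)
      also have "\<dots> \<le> \<epsilon> * (l * \<rho> * (real n)\<^sup>2) / 2"
        using l \<rho> by (intro divide_right_mono mult_right_mono) auto
      finally show ?thesis by (simp add: a_def mult_ac)
    qed
    finally show ?thesis .
  qed
  have "measure_pmf.prob (G_pmf n \<beta> \<rho>) {g. \<bar>\<Sum>i\<in>S. \<Sum>j\<in>T. g i j - edge_mean \<rho> (\<beta> i j)\<bar> \<ge> a} =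
      measure_pmf.prob ?p ({g. Y g \<ge> a} \<union> {g. - Y g \<ge> a})"
    unfolding G_pmf_eq measure_map_pmf by (rule arg_cong[of _ _ "measure_pmf.prob ?p"]) (auto simp: Y abs_if)
  also have "\<dots> \<le> measure_pmf.prob ?p {g. Y g \<ge> a} + measure_pmf.prob ?p {g. - Y g \<ge> a}"
    by (rule measure_Un_le) auto
  also have "\<dots> \<le> exp (- (l * a / 2)) + exp (- (l * a / 2))"
  proof (intro add_mono pmf_Chernoff finite_set_edges_pmf)
    show "measure_pmf.expectation ?p (\<lambda>g. exp (l * Y g)) \<le> exp (l * a / 2)" using mgf[of 1] by simp
    show "measure_pmf.expectation ?p (\<lambda>g. exp (l * - Y g)) \<le> exp (l * a / 2)" using mgf[of "-1"] by simp
  qed (use l in auto)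
  finally show ?thesis by (simp add: a_def)
qed

text \<open>The threshold carries the factor \<rho> because the graph is later multiplied by 1 /
  \<rho>: off this set all centred and rescaled cut sums are below \<epsilon> n^2 in absolute
  value.\<close>

definition bad_graphs :: "nat \<Rightarrow> wgraph \<Rightarrow> real \<Rightarrow> real \<Rightarrow> wgraph set" where
  "bad_graphs n \<beta> \<rho> \<epsilon> = (\<Union>(S, T)\<in>Pow {1..n} \<times> Pow {1..n}.
     {g. \<bar>\<Sum>i\<in>S. \<Sum>j\<in>T. g i j - edge_mean \<rho> (\<beta> i j)\<bar> \<ge> \<epsilon> * \<rho> * (real n)\<^sup>2})"

lemma G_pmf_bad_graphs:
  assumes sym: "\<And>i j. \<beta> i j = \<beta> j i" and diag: "\<And>i. \<beta> i i = 0"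
    and \<rho>: "\<rho> > 0" and \<epsilon>: "\<epsilon> > 0" and C: "C > 0"
    and sum: "(\<Sum>i\<in>{1..n}. \<Sum>j\<in>{1..n}. \<bar>\<beta> i j\<bar>) \<le> C * (real n)\<^sup>2"
    and l: "0 < l" "l \<le> 1 / 2" "4 * l * C \<le> \<epsilon>"
  shows "measure_pmf.prob (G_pmf n \<beta> \<rho>) (bad_graphs n \<beta> \<rho> \<epsilon>)
    \<le> 4 ^ n * (2 * exp (- (l * (\<epsilon> * \<rho> * (real n)\<^sup>2) / 2)))"
proof -
  let ?P = "Pow {1..n} \<times> Pow {1..n}"
  have "measure_pmf.prob (G_pmf n \<beta> \<rho>) (bad_graphs n \<beta> \<rho> \<epsilon>) \<le>
      (\<Sum>ST\<in>?P. measure_pmf.prob (G_pmf n \<beta> \<rho>)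
        (case ST of (S, T) \<Rightarrow> {g. \<bar>\<Sum>i\<in>S. \<Sum>j\<in>T. g i j - edge_mean \<rho> (\<beta> i j)\<bar> \<ge> \<epsilon> * \<rho> * (real n)\<^sup>2}))"
    unfolding bad_graphs_def by (rule measure_UNION_le) auto
  also have "\<dots> \<le> (\<Sum>ST\<in>?P. 2 * exp (- (l * (\<epsilon> * \<rho> * (real n)\<^sup>2) / 2)))"
    by (rule sum_mono) (use G_pmf_tail[OF _ _ sym diag \<rho> \<epsilon> C sum l] in auto)
  also have "\<dots> = 4 ^ n * (2 * exp (- (l * (\<epsilon> * \<rho> * (real n)\<^sup>2) / 2)))"
  proof -
    have "real (card ?P) = 4 ^ n"
      by (simp add: card_cartesian_product card_Pow power_mult_distrib[symmetric])
    then show ?thesis by (simp only: sum_constant)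
  qed
  finally show ?thesis .
qed

section \<open>Events under a conditional law\<close>

context prob_space
begin

lemma has_cond_pmf_prob:
  assumes sub: "subalgebra M F" and cond: "has_cond_pmf M F X K" and B: "B \<in> sets F"
  shows "integrable M (\<lambda>\<omega>. indicator B \<omega> * real_cond_exp M F (indicator {\<omega>. X \<omega> = b}) \<omega>)"
    and "prob {\<omega>\<in>space M. \<omega> \<in> B \<and> X \<omega> = b} =
      (LINT \<omega>|M. indicator B \<omega> * real_cond_exp M F (indicator {\<omega>. X \<omega> = b}) \<omega>)"
proof -
  interpret finite_measure_subalgebra M F by unfold_locales (rule sub)
  have X: "X \<in> measurable M (count_space UNIV)" using cond by (simp add: has_cond_pmf_def)
  have BM [measurable]: "B \<in> sets M" using B sub by (auto simp: subalgebra_def)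
  have Xb: "{\<omega>\<in>space M. X \<omega> = b} \<in> sets M"
    using measurable_sets[OF X, of "{b}"] by (simp add: vimage_def Int_def conj_commute)
  have m: "{\<omega>\<in>space M. \<omega> \<in> B \<and> X \<omega> = b} \<in> sets M"
  proof -
    have "{\<omega>\<in>space M. \<omega> \<in> B \<and> X \<omega> = b} = {\<omega>\<in>space M. X \<omega> = b} \<inter> B" by auto
    then show ?thesis using Xb BM by simp
  qed
  have eq: "indicator B \<omega> * indicator {\<omega>. X \<omega> = b} \<omega> = (indicator {\<omega>\<in>space M. \<omega> \<in> B \<and> X \<omega> = b} \<omega> :: real)"
    if "\<omega> \<in> space M" for \<omega>
    using that by (auto simp: indicator_def)
  have int: "integrable M (\<lambda>\<omega>. indicator B \<omega> * indicator {\<omega>. X \<omega> = b} \<omega> :: real)"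
    using integrable_real_indicator[OF m] emeasure_finite by (subst Bochner_Integration.integrable_cong[OF refl eq]) (auto simp: less_top[symmetric])
  \<comment> \<open>This indicator lives on the whole type; it is measurable because on
    \<open>space M\<close> it agrees with the indicator of an event.\<close>
  have g: "(indicator {\<omega>. X \<omega> = b} :: 'a \<Rightarrow> real) \<in> borel_measurable M"
    using Xb by (subst measurable_cong[of M _ "indicator {\<omega>\<in>space M. X \<omega> = b}"]) (auto simp: indicator_def)
  have f: "(indicator B :: 'a \<Rightarrow> real) \<in> borel_measurable F" using B by simp
  show "integrable M (\<lambda>\<omega>. indicator B \<omega> * real_cond_exp M F (indicator {\<omega>. X \<omega> = b}) \<omega>)"
    by (rule real_cond_exp_intg(1)[OF int f g])
  have "(LINT \<omega>|M. indicator B \<omega> * real_cond_exp M F (indicator {\<omega>. X \<omega> = b}) \<omega>) =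
      (LINT \<omega>|M. indicator B \<omega> * indicator {\<omega>. X \<omega> = b} \<omega>)"
    by (rule real_cond_exp_intg(2)[OF int f g])
  also have "\<dots> = (LINT \<omega>|M. indicator {\<omega>\<in>space M. \<omega> \<in> B \<and> X \<omega> = b} \<omega>)"
    by (rule Bochner_Integration.integral_cong[OF refl eq])
  also have "\<dots> = prob {\<omega>\<in>space M. \<omega> \<in> B \<and> X \<omega> = b}"
    using m by (simp add: Int_absorb2[OF sets.sets_into_space])
  finally show "prob {\<omega>\<in>space M. \<omega> \<in> B \<and> X \<omega> = b} =
      (LINT \<omega>|M. indicator B \<omega> * real_cond_exp M F (indicator {\<omega>. X \<omega> = b}) \<omega>)" by simp
qed

lemma has_cond_pmf_event:
  assumes "subalgebra M F" "has_cond_pmf M F X K" "B \<in> sets F"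
  shows "{\<omega>\<in>space M. \<omega> \<in> B \<and> X \<omega> = b} \<in> sets M"
proof -
  have X: "X \<in> measurable M (count_space UNIV)" using assms(2) by (simp add: has_cond_pmf_def)
  have "{\<omega>\<in>space M. \<omega> \<in> B \<and> X \<omega> = b} = (X -` {b} \<inter> space M) \<inter> B" by auto
  then show ?thesis
    using measurable_sets[OF X, of "{b}"] assms(1,3) by (auto simp: subalgebra_def)
qed

text \<open>The conditional law is prescribed one value at a time. Over the finite \<open>V\<close>
  the conditional probabilities add up to 1, and integrating this leaves no mass for other
  values.\<close>

lemma has_cond_pmf_AE_in:
  assumes sub: "subalgebra M F" and cond: "has_cond_pmf M F X K"
    and V: "finite V" "AE \<omega> in M. set_pmf (K \<omega>) \<subseteq> V"
  shows "AE \<omega> in M. X \<omega> \<in> V"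
proof -
  have spF: "space M \<in> sets F" using sub sets.top[of F] by (simp add: subalgebra_def)
  let ?r = "\<lambda>b. real_cond_exp M F (indicator {\<omega>. X \<omega> = b})"
  have Xb: "{\<omega>\<in>space M. X \<omega> = b} \<in> sets M" for b
    using has_cond_pmf_event[OF sub cond spF, of b] by (simp cong: conj_cong)
  have "AE \<omega> in M. \<forall>b\<in>V. ?r b \<omega> = pmf (K \<omega>) b"
    using cond V(1) by (intro AE_finite_allI) (auto simp: has_cond_pmf_def)
  then have one: "AE \<omega> in M. (\<Sum>b\<in>V. indicator (space M) \<omega> * ?r b \<omega>) = 1"
    using V(2) AE_space
    by eventually_elim (simp add: sum_pmf_eq_1[OF V(1)])
  have "prob (\<Union>b\<in>V. {\<omega>\<in>space M. X \<omega> = b}) = (\<Sum>b\<in>V. prob {\<omega>\<in>space M. X \<omega> = b})"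
    by (rule finite_measure_finite_Union) (use V(1) Xb in \<open>auto simp: disjoint_family_on_def\<close>)
  also have "\<dots> = (\<Sum>b\<in>V. LINT \<omega>|M. indicator (space M) \<omega> * ?r b \<omega>)"
    using has_cond_pmf_prob(2)[OF sub cond spF] by (intro sum.cong refl) (simp cong: conj_cong)
  also have "\<dots> = (LINT \<omega>|M. (\<Sum>b\<in>V. indicator (space M) \<omega> * ?r b \<omega>))"
    by (rule Bochner_Integration.integral_sum[symmetric]) (rule has_cond_pmf_prob(1)[OF sub cond spF])
  also have "\<dots> = (LINT \<omega>|M. 1)"
  proof (rule integral_cong_AE[OF _ _ one])
    show "(\<lambda>\<omega>. \<Sum>b\<in>V. indicator (space M) \<omega> * ?r b \<omega>) \<in> borel_measurable M"
      by (intro borel_measurable_sum borel_measurable_integrable has_cond_pmf_prob(1)[OF sub cond spF])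
  qed simp
  also have "\<dots> = 1" by (simp add: prob_space)
  finally have "AE \<omega> in M. \<omega> \<in> (\<Union>b\<in>V. {\<omega>\<in>space M. X \<omega> = b})"
    by (subst (asm) prob_eq_1) (use V(1) Xb in auto)
  then show ?thesis by eventually_elim auto
qed

text \<open>The set of bad values depends on \<omega>. For each value b the condition
  \<open>\<omega> \<in> A b\<close> is an event of \<open>F\<close>, to which conditional
  expectation applies; summed over the disjoint values of \<open>X\<close>, the terms reassemble
  into the conditional probability of the random set.\<close>

lemma has_cond_pmf_prob_le:
  assumes sub: "subalgebra M F" and cond: "has_cond_pmf M F X K" and V: "finite V"
    and A: "\<And>b. b \<in> V \<Longrightarrow> A b \<in> sets F"
    and le: "AE \<omega> in M. measure_pmf.prob (K \<omega>) {b\<in>V. \<omega> \<in> A b} \<le> c"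
  shows "prob {\<omega>\<in>space M. \<exists>b\<in>V. \<omega> \<in> A b \<and> X \<omega> = b} \<le> c"
proof -
  let ?r = "\<lambda>b. real_cond_exp M F (indicator {\<omega>. X \<omega> = b})"
  have "AE \<omega> in M. \<forall>b\<in>V. ?r b \<omega> = pmf (K \<omega>) b"
    using cond V by (intro AE_finite_allI) (auto simp: has_cond_pmf_def)
  then have AE_le: "AE \<omega> in M. (\<Sum>b\<in>V. indicator (A b) \<omega> * ?r b \<omega>) \<le> c"
    using le
  proof eventually_elim
    case (elim \<omega>)
    have "(\<Sum>b\<in>V. indicator (A b) \<omega> * ?r b \<omega>) = (\<Sum>b\<in>V. if \<omega> \<in> A b then pmf (K \<omega>) b else 0)"
      using elim(1) by (intro sum.cong refl) (auto simp: indicator_def)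
    also have "\<dots> = (\<Sum>b\<in>{b\<in>V. \<omega> \<in> A b}. pmf (K \<omega>) b)"
      using V by (simp add: sum.inter_filter)
    also have "\<dots> = measure_pmf.prob (K \<omega>) {b\<in>V. \<omega> \<in> A b}"
      using V by (intro measure_measure_pmf_finite[symmetric]) auto
    finally show ?case using elim(2) by simp
  qed
  have "{\<omega>\<in>space M. \<exists>b\<in>V. \<omega> \<in> A b \<and> X \<omega> = b} = (\<Union>b\<in>V. {\<omega>\<in>space M. \<omega> \<in> A b \<and> X \<omega> = b})" by auto
  also have "prob \<dots> = (\<Sum>b\<in>V. prob {\<omega>\<in>space M. \<omega> \<in> A b \<and> X \<omega> = b})"
    by (rule finite_measure_finite_Union)
       (use V has_cond_pmf_event[OF sub cond A] in \<open>auto simp: disjoint_family_on_def\<close>)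
  also have "\<dots> = (\<Sum>b\<in>V. LINT \<omega>|M. indicator (A b) \<omega> * ?r b \<omega>)"
    by (intro sum.cong refl has_cond_pmf_prob(2)[OF sub cond A])
  also have "\<dots> = (LINT \<omega>|M. (\<Sum>b\<in>V. indicator (A b) \<omega> * ?r b \<omega>))"
    by (rule Bochner_Integration.integral_sum[symmetric]) (rule has_cond_pmf_prob(1)[OF sub cond A])
  also have "\<dots> \<le> (LINT \<omega>|M. c)"
    by (rule integral_mono_AE[OF _ _ AE_le])
       (intro Bochner_Integration.integrable_sum has_cond_pmf_prob(1)[OF sub cond A], auto)
  also have "\<dots> = c" by (simp add: prob_space)
  finally show ?thesis .
qed

end

section \<open>Convergence in the cut norm\<close>

text \<open>\<open>inverse \<rho> * edge_mean \<rho> b\<close> is the point of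
  [- 1 / \<rho>, 1 / \<rho>] nearest to \<open>b\<close>, and \<open>u\<close> is another point of
  this interval.\<close>

lemma edge_mean_approx:
  assumes \<rho>: "\<rho> > 0" and u: "\<bar>u\<bar> \<le> inverse \<rho>"
  shows "\<bar>inverse \<rho> * edge_mean \<rho> b - b\<bar> \<le> \<bar>b - u\<bar>"
proof (cases "\<rho> * \<bar>b\<bar> \<le> 1")
  case True
  have "inverse \<rho> * edge_mean \<rho> b = inverse \<rho> * \<rho> * (sgn b * \<bar>b\<bar>)"
    using True by (simp add: edge_mean_def min_def mult_ac)
  also have "\<dots> = b" using \<rho> by (simp add: sgn_mult_abs)
  finally show ?thesis by simp
next
  case False
  then have b: "inverse \<rho> < \<bar>b\<bar>" using \<rho> by (simp add: field_simps)
  have "inverse \<rho> * edge_mean \<rho> b = inverse \<rho> * sgn b" using False by (simp add: edge_mean_def min_def)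
  then have "\<bar>inverse \<rho> * edge_mean \<rho> b - b\<bar> = \<bar>b\<bar> - inverse \<rho>"
    using b \<rho> by (auto simp: sgn_real_def)
  also have "\<dots> \<le> \<bar>b - u\<bar>" using u by linarith
  finally show ?thesis .
qed

text \<open>Split at the conditional mean: the fluctuation is controlled by the subset sums that
  \<open>bad_graphs\<close> excludes, the rest by the L1 norm, which dominates every rectangle
  integral.\<close>

lemma d_cut_graph_graphon_le:
  assumes n: "n \<ge> 1" and \<rho>: "\<rho> > 0" and g: "g \<notin> bad_graphs n \<beta> \<rho> \<epsilon>"
    and W: "set_integrable lborel ({0..1} \<times> {0..1}) (\<lambda>(s, t). W s t)"
  shows "0 \<le> d_cut (graph_graphon n y (\<lambda>i j. inverse \<rho> * g i j)) W \<and>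
    d_cut (graph_graphon n y (\<lambda>i j. inverse \<rho> * g i j)) W \<le>
      \<epsilon> + L1_norm (\<lambda>s t. graph_graphon n y (\<lambda>i j. inverse \<rho> * edge_mean \<rho> (\<beta> i j)) s t - W s t)"
    (is "_ \<and> _ \<le> \<epsilon> + ?L")
proof -
  define T where "T i j = inverse \<rho> * edge_mean \<rho> (\<beta> i j)" for i j
  let ?gg = "graph_graphon n y"
  let ?D = "\<lambda>i j. inverse \<rho> * g i j - T i j"
  have le: "\<bar>set_lebesgue_integral lborel (A \<times> B) (\<lambda>(s, t). ?gg (\<lambda>i j. inverse \<rho> * g i j) s t - W s t)\<bar> \<le> \<epsilon> + ?L"
    if AB: "A \<in> sets borel" "B \<in> sets borel" "A \<subseteq> {0..1}" "B \<subseteq> {0..1}" for A B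
  proof -
    have mAB: "A \<times> B \<in> sets lborel"
      unfolding sets_lborel borel_prod[symmetric] using AB by (intro pair_measureI)
    have 1: "\<bar>set_lebesgue_integral lborel (A \<times> B) (\<lambda>(s, t). ?gg ?D s t)\<bar> \<le> \<epsilon>"
    proof (rule graph_graphon_cut_le[OF n _ AB])
      fix S R assume SR: "S \<subseteq> {1..n}" "R \<subseteq> {1..n}"
      then have "\<bar>\<Sum>i\<in>S. \<Sum>j\<in>R. g i j - edge_mean \<rho> (\<beta> i j)\<bar> < \<epsilon> * \<rho> * (real n)\<^sup>2"
        using g unfolding bad_graphs_def by (auto simp: not_le)
      then have "inverse \<rho> * \<bar>\<Sum>i\<in>S. \<Sum>j\<in>R. g i j - edge_mean \<rho> (\<beta> i j)\<bar> \<le>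
          inverse \<rho> * (\<epsilon> * \<rho> * (real n)\<^sup>2)"
        using \<rho> by (intro mult_left_mono) auto
      also have "\<dots> = \<epsilon> * (real n)\<^sup>2" using \<rho> by simp
      finally have "\<bar>inverse \<rho> * (\<Sum>i\<in>S. \<Sum>j\<in>R. g i j - edge_mean \<rho> (\<beta> i j))\<bar> \<le> \<epsilon> * (real n)\<^sup>2"
        using \<rho> by (simp add: abs_mult)
      moreover have "(\<Sum>i\<in>S. \<Sum>j\<in>R. ?D i j) = inverse \<rho> * (\<Sum>i\<in>S. \<Sum>j\<in>R. g i j - edge_mean \<rho> (\<beta> i j))"
        by (simp add: T_def sum_distrib_left right_diff_distrib)
      ultimately show "\<bar>\<Sum>i\<in>S. \<Sum>j\<in>R. ?D i j\<bar> \<le> \<epsilon> * (real n)\<^sup>2"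
        by (simp only:)
    qed
    have dint: "set_integrable lborel ({0..1} \<times> {0..1}) (\<lambda>(s, t). ?gg T s t - W s t)"
      by (rule set_integrable_diff_square[OF graph_graphon_integrable W])
    have 2: "\<bar>set_lebesgue_integral lborel (A \<times> B) (\<lambda>(s, t). ?gg T s t - W s t)\<bar> \<le> ?L"
      unfolding T_def[symmetric] by (rule set_integral_rectangle_le_L1_norm[OF dint AB])
    have "set_integrable lborel (A \<times> B) (\<lambda>(s, t). ?gg T s t - W s t)"
      by (rule set_integrable_subset[OF dint mAB]) (use AB in auto)
    note set_integral_add(2)[OF graph_graphon_has_integral(1)[OF AB, of n y ?D] this]
    moreover have "(case z of (s, t) \<Rightarrow> ?gg ?D s t) + (case z of (s, t) \<Rightarrow> ?gg T s t - W s t) =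
        (case z of (s, t) \<Rightarrow> ?gg (\<lambda>i j. inverse \<rho> * g i j) s t - W s t)" for z
      unfolding graph_graphon_diff[symmetric] by (simp split: prod.splits)
    ultimately have "set_lebesgue_integral lborel (A \<times> B) (\<lambda>(s, t). ?gg (\<lambda>i j. inverse \<rho> * g i j) s t - W s t) =
        set_lebesgue_integral lborel (A \<times> B) (\<lambda>(s, t). ?gg ?D s t) +
        set_lebesgue_integral lborel (A \<times> B) (\<lambda>(s, t). ?gg T s t - W s t)"
      by simp
    with 1 2 show ?thesis by linarith
  qed
  show ?thesis using d_cut_bounds[OF le] by blast
qed

text \<open>Supplies the constant \<open>C\<close> of the tail bound. It depends on the sample, and
  it is taken to be an integer so that countably many almost sure events cover all cases;
  \<open>Suc\<close> keeps it positive.\<close>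

lemma sum_abs_H_graph_bounded:
  assumes good: "sample_good W y"
  obtains c :: nat where "\<forall>n. (\<Sum>i\<in>{1..n}. \<Sum>j\<in>{1..n}. \<bar>H_graph n W y i j\<bar>) \<le> real (Suc c) * (real n)\<^sup>2"
proof -
  obtain U where U: "continuous_on UNIV (\<lambda>(s, t). U s t)"
      "\<And>n. offdiag_sum (\<lambda>s t. \<bar>W s t - U s t\<bar>) n y \<le> 1 * (real n)\<^sup>2"
    using good zero_less_one[where 'a = real] unfolding sample_good_def by blast
  obtain K where K0: "K \<ge> 0" and K: "\<forall>s\<in>{0..1}. \<forall>t\<in>{0..1}. \<bar>U s t\<bar> \<le> K"
    using continuous_bounded_square[OF U(1)] .
  have y: "y i \<in> {0..1}" if "i \<ge> 1" for i using good that by (auto simp: sample_good_def)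
  obtain c :: nat where c: "1 + K \<le> real c" using real_arch_simple by blast
  have "(\<Sum>i\<in>{1..n}. \<Sum>j\<in>{1..n}. \<bar>H_graph n W y i j\<bar>) \<le> real (Suc c) * (real n)\<^sup>2" for n
  proof -
    have "(\<Sum>i\<in>{1..n}. \<Sum>j\<in>{1..n}. \<bar>H_graph n W y i j\<bar>) \<le>
        (\<Sum>i\<in>{1..n}. \<Sum>j\<in>{1..n}. \<bar>H_graph n W y i j - H_graph n U y i j\<bar> + K)"
    proof (intro sum_mono)
      fix i j assume ij: "i \<in> {1..n}" "j \<in> {1..n}"
      have "\<bar>H_graph n U y i j\<bar> \<le> K"
        using K y[of i] y[of j] ij K0 by (simp add: H_graph_def)
      then show "\<bar>H_graph n W y i j\<bar> \<le> \<bar>H_graph n W y i j - H_graph n U y i j\<bar> + K" by linarith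
    qed
    also have "\<dots> = offdiag_sum (\<lambda>s t. \<bar>W s t - U s t\<bar>) n y + K * (real n)\<^sup>2"
      unfolding sum.distrib sum_abs_H_graph_diff by (simp add: power2_eq_square)
    also have "\<dots> \<le> (1 + K) * (real n)\<^sup>2" using U(2)[of n] by (simp add: distrib_right)
    also have "\<dots> \<le> real (Suc c) * (real n)\<^sup>2" using c by (intro mult_right_mono) auto
    finally show ?thesis .
  qed
  then show thesis by (intro that allI)
qed

text \<open>The pathwise half of (b): \<open>\<rho> \<longlonglongrightarrow> 0\<close> makes the
  truncation harmless, while the growth of n \<rho> is hidden in the assumption on
  \<open>g\<close>.\<close>

lemma d_cut_G_graph_tendsto:
  assumes W: "set_integrable lborel ({0..1} \<times> {0..1}) (\<lambda>(s, t). W s t)" and good: "sample_good W y"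
    and \<rho>: "\<And>n. n \<ge> 1 \<Longrightarrow> \<rho> n > 0" and \<rho>0: "\<rho> \<longlonglongrightarrow> 0"
    and g: "\<And>k. eventually (\<lambda>n. g n \<notin> bad_graphs n (H_graph n W y) (\<rho> n) (1 / real (Suc k))) sequentially"
  shows "(\<lambda>n. d_cut (graph_graphon n y (\<lambda>i j. inverse (\<rho> n) * g n i j)) W) \<longlonglongrightarrow> 0"
proof (rule tendstoI)
  fix e :: real assume e: "e > 0"
  then have e4: "e / 4 > 0" by simp
  obtain k where k: "1 / real (Suc k) < e / 4" using e4 by (rule nat_approx_posE)
  obtain U where U: "continuous_on UNIV (\<lambda>(s, t). U s t)"
      "\<And>n. offdiag_sum (\<lambda>s t. \<bar>W s t - U s t\<bar>) n y \<le> e / 4 * (real n)\<^sup>2"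
    using good e4 unfolding sample_good_def by blast
  obtain K where K0: "K \<ge> 0" and K: "\<forall>s\<in>{0..1}. \<forall>t\<in>{0..1}. \<bar>U s t\<bar> \<le> K"
    using continuous_bounded_square[OF U(1)] .
  have y: "y i \<in> {0..1}" if "i \<ge> 1" for i using good that by (auto simp: sample_good_def)
  \<comment> \<open>From then on \<open>U\<close> is bounded by 1 / \<rho> n on the square, so
    truncating \<open>W\<close> there costs at most \<bar>W - U\<bar>. The + 1 covers K = 0.\<close>
  have "eventually (\<lambda>n. \<rho> n < 1 / (K + 1)) sequentially"
    by (rule order_tendstoD(2)[OF \<rho>0]) (use K0 in simp)
  moreover have "eventually (\<lambda>n. dist (d1 (graph_graphon n y (H_graph n W y)) W) 0 < e / 4) sequentially"
    by (rule tendstoD[OF d1_H_graph_tendsto[OF W good] e4])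
  ultimately show "eventually (\<lambda>n. dist (d_cut (graph_graphon n y (\<lambda>i j. inverse (\<rho> n) * g n i j)) W) 0 < e) sequentially"
    using g[of k] eventually_ge_at_top[of 1]
  proof eventually_elim
    case (elim n)
    note n = elim(4)
    have \<rho>n: "\<rho> n > 0" using \<rho>[OF n] .
    have K\<rho>: "K \<le> inverse (\<rho> n)"
    proof -
      have "K + 1 \<le> inverse (\<rho> n)" using elim(1) \<rho>n K0 by (simp add: field_simps)
      then show ?thesis by simp
    qed
    let ?H = "H_graph n W y"
    let ?T = "\<lambda>i j. inverse (\<rho> n) * edge_mean (\<rho> n) (?H i j)"
    let ?gg = "graph_graphon n y"
    have "L1_norm (\<lambda>s t. ?gg ?T s t - ?gg ?H s t) \<le> e / 4"
    proof -
      have "L1_norm (\<lambda>s t. ?gg ?T s t - ?gg ?H s t) \<le>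
          (\<Sum>i\<in>{1..n}. \<Sum>j\<in>{1..n}. \<bar>?T i j - ?H i j\<bar>) / (real n)\<^sup>2"
        unfolding graph_graphon_diff by (rule L1_norm_graph_graphon_le[OF n])
      also have "\<dots> \<le> (\<Sum>i\<in>{1..n}. \<Sum>j\<in>{1..n}. \<bar>H_graph n W y i j - H_graph n U y i j\<bar>) / (real n)\<^sup>2"
      proof (intro divide_right_mono sum_mono)
        fix i j assume ij: "i \<in> {1..n}" "j \<in> {1..n}"
        have "\<bar>H_graph n U y i j\<bar> \<le> inverse (\<rho> n)"
          using order_trans[OF K[rule_format, OF y y, of i j] K\<rho>] ij \<rho>n by (simp add: H_graph_def)
        then show "\<bar>?T i j - ?H i j\<bar> \<le> \<bar>H_graph n W y i j - H_graph n U y i j\<bar>"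
          by (rule edge_mean_approx[OF \<rho>n])
      qed simp
      also have "\<dots> \<le> e / 4"
        unfolding sum_abs_H_graph_diff using U(2)[of n] n by (simp add: divide_le_eq)
      finally show ?thesis .
    qed
    moreover have "L1_norm (\<lambda>s t. ?gg ?T s t - W s t) \<le>
        L1_norm (\<lambda>s t. ?gg ?T s t - ?gg ?H s t) + d1 (?gg ?H) W"
      unfolding d1_def by (rule L1_norm_triangle[OF graph_graphon_integrable graph_graphon_integrable W])
    moreover have "d1 (?gg ?H) W < e / 4" using elim(2) by (simp add: dist_real_def)
    moreover note d_cut_graph_graphon_le[OF n \<rho>n elim(3) W, of y]
    ultimately show ?case using k by (simp add: dist_real_def)
  qed
qed

section \<open>Almost sure bounds for the graphs sampled from the points\<close>

context iid_uniform_seq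
begin

lemma sample_algebra_measurable:
  assumes "i \<in> {1..n}" shows "x i \<in> borel_measurable (sample_algebra M x n)"
proof -
  have "(\<lambda>\<omega>. \<lambda>i\<in>{1..n}. x i \<omega>) \<in> measurable (sample_algebra M x n) (PiM {1..n} (\<lambda>_. borel))"
    unfolding sample_algebra_def by (rule measurable_vimage_algebra1) (auto simp: space_PiM)
  from measurable_compose[OF this measurable_component_singleton[OF assms]]
  show ?thesis using assms by simp
qed

lemma subalgebra_sample_algebra: "subalgebra M (sample_algebra M x n)"
proof -
  have m: "(\<lambda>\<omega>. \<lambda>i\<in>{1..n}. x i \<omega>) \<in> measurable M (PiM {1..n} (\<lambda>_. borel))"
    by (rule measurable_restrict) (simp add: rv)
  have "(\<lambda>\<omega>. \<lambda>i\<in>{1..n}. x i \<omega>) \<in> space M \<rightarrow> space (PiM {1..n} (\<lambda>_. borel))"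
    by (auto simp: space_PiM)
  then show ?thesis
    unfolding subalgebra_def sample_algebra_def
    using measurable_sets[OF m] by (auto simp: sets_vimage_algebra2)
qed

text \<open>For a deterministic \<open>C\<close> the bound on the weights may fail at some samples,
  so it stays a premise inside the event. It depends on the points alone, and where it holds the
  tail bound applies conditionally on them.\<close>

lemma AE_not_bad_graphs:
  assumes W: "graphon W" and \<rho>: "\<And>n. n \<ge> 1 \<Longrightarrow> \<rho> n > 0"
    and n\<rho>: "filterlim (\<lambda>n. real n * \<rho> n) at_top sequentially"
    and G: "\<And>n. n \<ge> 1 \<Longrightarrow> is_G_graph M x n W (\<rho> n) (G n)"
    and C: "C > 0" and \<epsilon>: "\<epsilon> > 0"
  shows "AE \<omega> in M. eventually (\<lambda>n.
      (\<Sum>i\<in>{1..n}. \<Sum>j\<in>{1..n}. \<bar>H_graph n W (\<lambda>i. x i \<omega>) i j\<bar>) \<le> C * (real n)\<^sup>2 \<longrightarrow>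
      G n \<omega> \<notin> bad_graphs n (H_graph n W (\<lambda>i. x i \<omega>)) (\<rho> n) \<epsilon>) sequentially"
proof -
  \<comment> \<open>Extension by zero gives measurability and makes the weight matrix symmetric at
    every sample, also where points leave [0, 1].\<close>
  define W' where "W' s t = (if s \<in> {0..1} \<and> t \<in> {0..1} then W s t else 0)" for s t
  have W'_eq: "(\<lambda>z. case z of (s, t) \<Rightarrow> W' s t) = (\<lambda>z. indicator ({0..1} \<times> {0..1}) z *\<^sub>R (case z of (s, t) \<Rightarrow> W s t))"
    by (auto simp: W'_def fun_eq_iff indicator_def)
  have W'_meas: "(\<lambda>(s, t). W' s t) \<in> borel_measurable borel"
    using W unfolding W'_eq set_integrable_def graphon_def by (auto dest: borel_measurable_integrable)
  have W'_sym: "W' s t = W' t s" for s t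
    using W by (auto simp: W'_def graphon_def)
  define H where "H n \<omega> = H_graph n W' (\<lambda>i. x i \<omega>)" for n \<omega>
  have H_sym: "H n \<omega> i j = H n \<omega> j i" and H_diag: "H n \<omega> i i = 0" for n \<omega> i j
    by (auto simp: H_def H_graph_def W'_sym)
  have H_eq: "H_graph n W (\<lambda>i. x i \<omega>) = H n \<omega>" if "\<And>i. i \<in> {1..n} \<Longrightarrow> x i \<omega> \<in> {0..1}" for n \<omega>
    using that by (auto simp: H_def H_graph_def W'_def fun_eq_iff)
  have H_meas: "(\<lambda>\<omega>. H n \<omega> i j) \<in> borel_measurable (sample_algebra M x n)" for n i j
  proof (cases "i \<in> {1..n} \<and> j \<in> {1..n}")
    case True
    then have "(\<lambda>\<omega>. (x i \<omega>, x j \<omega>)) \<in> borel_measurable (sample_algebra M x n)"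
      by (intro borel_measurable_Pair sample_algebra_measurable) auto
    from measurable_compose[OF this W'_meas] show ?thesis
      using True by (simp add: H_def H_graph_def)
  qed (auto simp: H_def H_graph_def)
  have space_F: "space (sample_algebra M x n) = space M" for n
    using subalgebra_sample_algebra[of n] by (simp add: subalgebra_def)
  \<comment> \<open>For a fixed value b of the graph, all conditions concern the points and form an
    event of \<open>sample_algebra\<close>. Requiring the points in [0, 1] makes the matrices of
    \<open>W\<close> and \<open>W'\<close> coincide there.\<close>
  define A where "A n b = {\<omega>\<in>space M. (\<forall>i\<in>{1..n}. x i \<omega> \<in> {0..1}) \<and>
      (\<Sum>i\<in>{1..n}. \<Sum>j\<in>{1..n}. \<bar>H n \<omega> i j\<bar>) \<le> C * (real n)\<^sup>2 \<and> b \<in> bad_graphs n (H n \<omega>) (\<rho> n) \<epsilon>}" for n b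
  have A: "A n b \<in> sets (sample_algebra M x n)" for n b
  proof -
    let ?F = "sample_algebra M x n"
    let ?P = "Pow {1..n} \<times> Pow {1..n}"
    note H_meas[measurable]
    have [measurable]: "edge_mean r \<in> borel_measurable borel" for r
      unfolding edge_mean_def[abs_def] by measurable
    have "{\<omega>\<in>space ?F. \<forall>i\<in>{1..n}. x i \<omega> \<in> {0..1}} \<in> sets ?F"
    proof (rule sets.sets_Collect_finite_All)
      fix i assume "i \<in> {1..n}"
      note sample_algebra_measurable[OF this, measurable]
      show "{\<omega>\<in>space ?F. x i \<omega> \<in> {0..1}} \<in> sets ?F" by measurable
    qed simp
    moreover have "{\<omega>\<in>space ?F. (\<Sum>i\<in>{1..n}. \<Sum>j\<in>{1..n}. \<bar>H n \<omega> i j\<bar>) \<le> C * (real n)\<^sup>2} \<in> sets ?F"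
      by measurable
    moreover have "(\<Union>ST\<in>?P. {\<omega>\<in>space ?F. \<epsilon> * \<rho> n * (real n)\<^sup>2 \<le>
        \<bar>\<Sum>i\<in>fst ST. \<Sum>j\<in>snd ST. b i j - edge_mean (\<rho> n) (H n \<omega> i j)\<bar>}) \<in> sets ?F"
      by (intro sets.finite_UN) (auto, measurable)
    ultimately have "{\<omega>\<in>space ?F. \<forall>i\<in>{1..n}. x i \<omega> \<in> {0..1}} \<inter>
       {\<omega>\<in>space ?F. (\<Sum>i\<in>{1..n}. \<Sum>j\<in>{1..n}. \<bar>H n \<omega> i j\<bar>) \<le> C * (real n)\<^sup>2} \<inter>
       (\<Union>ST\<in>?P. {\<omega>\<in>space ?F. \<epsilon> * \<rho> n * (real n)\<^sup>2 \<le>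
        \<bar>\<Sum>i\<in>fst ST. \<Sum>j\<in>snd ST. b i j - edge_mean (\<rho> n) (H n \<omega> i j)\<bar>}) \<in> sets ?F"
      by (intro sets.Int)
    moreover have "A n b = {\<omega>\<in>space ?F. \<forall>i\<in>{1..n}. x i \<omega> \<in> {0..1}} \<inter>
       {\<omega>\<in>space ?F. (\<Sum>i\<in>{1..n}. \<Sum>j\<in>{1..n}. \<bar>H n \<omega> i j\<bar>) \<le> C * (real n)\<^sup>2} \<inter>
       (\<Union>ST\<in>?P. {\<omega>\<in>space ?F. \<epsilon> * \<rho> n * (real n)\<^sup>2 \<le>
        \<bar>\<Sum>i\<in>fst ST. \<Sum>j\<in>snd ST. b i j - edge_mean (\<rho> n) (H n \<omega> i j)\<bar>})"
      unfolding A_def space_F bad_graphs_def case_prod_unfold by blast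
    ultimately show ?thesis by (simp only:)
  qed
  \<comment> \<open>The largest value that the tail bound admits.\<close>
  define l where "l = min (1 / 2) (\<epsilon> / (4 * C))"
  have l: "0 < l" "l \<le> 1 / 2" "4 * l * C \<le> \<epsilon>"
    using C \<epsilon> by (auto simp: l_def min_def field_simps)
  define bound where "bound n = 4 ^ n * (2 * exp (- (l * (\<epsilon> * \<rho> n * (real n)\<^sup>2) / 2)))" for n
  have cond: "has_cond_pmf M (sample_algebra M x n) (G n) (\<lambda>\<omega>. G_pmf n (H_graph n W (\<lambda>i. x i \<omega>)) (\<rho> n))"
    if "n \<ge> 1" for n
    using G[OF that] by (simp add: is_G_graph_def)
  define B where "B n = {\<omega>\<in>space M. \<exists>b\<in>signed_graphs n. \<omega> \<in> A n b \<and> G n \<omega> = b}" for n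
  have B_meas: "B n \<in> sets M" if "n \<ge> 1" for n
  proof -
    have "B n = (\<Union>b\<in>signed_graphs n. {\<omega>\<in>space M. \<omega> \<in> A n b \<and> G n \<omega> = b})" by (auto simp: B_def)
    then show ?thesis
      using has_cond_pmf_event[OF subalgebra_sample_algebra cond[OF that] A] finite_signed_graphs by auto
  qed
  have B_le: "prob (B n) \<le> bound n" if n: "n \<ge> 1" for n
    unfolding B_def
  proof (rule has_cond_pmf_prob_le[OF subalgebra_sample_algebra cond[OF n] finite_signed_graphs A])
    show "AE \<omega> in M. measure_pmf.prob (G_pmf n (H_graph n W (\<lambda>i. x i \<omega>)) (\<rho> n)) {b \<in> signed_graphs n. \<omega> \<in> A n b} \<le> bound n"
    proof (rule AE_I2)
      fix \<omega>
      show "measure_pmf.prob (G_pmf n (H_graph n W (\<lambda>i. x i \<omega>)) (\<rho> n)) {b \<in> signed_graphs n. \<omega> \<in> A n b} \<le> bound n"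
      proof (cases "(\<forall>i\<in>{1..n}. x i \<omega> \<in> {0..1}) \<and> (\<Sum>i\<in>{1..n}. \<Sum>j\<in>{1..n}. \<bar>H n \<omega> i j\<bar>) \<le> C * (real n)\<^sup>2")
        case True
        then have "H_graph n W (\<lambda>i. x i \<omega>) = H n \<omega>" by (intro H_eq) blast
        moreover have "measure_pmf.prob (G_pmf n (H n \<omega>) (\<rho> n)) {b \<in> signed_graphs n. \<omega> \<in> A n b} \<le>
            measure_pmf.prob (G_pmf n (H n \<omega>) (\<rho> n)) (bad_graphs n (H n \<omega>) (\<rho> n) \<epsilon>)"
          by (rule measure_pmf.finite_measure_mono) (auto simp: A_def)
        moreover have "\<dots> \<le> bound n"
          unfolding bound_def by (rule G_pmf_bad_graphs[OF H_sym H_diag \<rho>[OF n] \<epsilon> C _ l]) (use True in blast)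
        ultimately show ?thesis by simp
      next
        case False
        then have "{b \<in> signed_graphs n. \<omega> \<in> A n b} = {}" unfolding A_def by blast
        then show ?thesis by (simp only: measure_empty) (simp add: bound_def)
      qed
    qed
  qed
  \<comment> \<open>The shift by \<open>Suc\<close> avoids n = 0, where nothing is assumed about
    \<open>\<rho>\<close> and \<open>G\<close>.\<close>
  have "eventually (\<lambda>n. norm (prob (B (Suc n))) \<le> 2 * exp (- 1 * real (Suc n))) sequentially"
  proof -
    \<comment> \<open>Beyond this threshold the Chernoff exponent is at least n (ln 4 + 1): the part
      n ln 4 pays for the 4^n pairs of sets, and exp (- n) is left over.\<close>
    have "eventually (\<lambda>n. 2 * (ln 4 + 1) / (l * \<epsilon>) \<le> real n * \<rho> n) sequentially"
      using n\<rho> unfolding filterlim_at_top by blast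
    then have "eventually (\<lambda>n. 2 * (ln 4 + 1) / (l * \<epsilon>) \<le> real (Suc n) * \<rho> (Suc n)) sequentially"
      by (subst eventually_sequentially_Suc)
    then show ?thesis
    proof eventually_elim
      case (elim m)
      define n where "n = Suc m"
      have "(ln 4 + 1) * 2 \<le> (real n * \<rho> n) * (l * \<epsilon>)"
        using elim l \<epsilon> by (simp add: n_def divide_le_eq mult.commute)
      then have "(ln 4 + 1) * 2 * real n \<le> (real n * \<rho> n) * (l * \<epsilon>) * real n"
        by (intro mult_right_mono) auto
      then have le: "real n * ln 4 - l * (\<epsilon> * \<rho> n * (real n)\<^sup>2) / 2 \<le> - 1 * real n"
        by (simp add: power2_eq_square algebra_simps)
      have "(4::real) ^ n = exp (real n * ln 4)" by (simp add: exp_of_nat_mult)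
      then have "bound n = 2 * (exp (real n * ln 4) * exp (- (l * (\<epsilon> * \<rho> n * (real n)\<^sup>2) / 2)))"
        by (simp only: bound_def mult.left_commute)
      also have "\<dots> = 2 * exp (real n * ln 4 - l * (\<epsilon> * \<rho> n * (real n)\<^sup>2) / 2)"
        by (simp only: exp_add[symmetric] diff_conv_add_uminus)
      also have "\<dots> \<le> 2 * exp (- 1 * real n)" using le by (subst mult_le_cancel_left_pos) simp_all
      finally show ?case using B_le[of n] by (simp add: n_def)
    qed
  qed
  moreover have "summable (\<lambda>n. 2 * exp (- 1 * real (Suc n)))"
  proof -
    have "summable (\<lambda>n. 2 * exp (- 1 * real n))" by (intro summable_mult summable_exp_neg_mult) simp
    then show ?thesis by (rule summable_Suc_iff[THEN iffD2])
  qed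
  ultimately have "summable (\<lambda>n. prob (B (Suc n)))"
    by (rule summable_comparison_test_ev)
  then have "AE \<omega> in M. eventually (\<lambda>n. \<omega> \<in> space M - B (Suc n)) sequentially"
    by (intro borel_cantelli_AE1) (auto simp: less_top[symmetric] intro: B_meas)
  \<comment> \<open>\<open>B n\<close> records only graphs in \<open>signed_graphs n\<close>; almost
    surely no others occur.\<close>
  moreover have "AE \<omega> in M. \<forall>n. G (Suc n) \<omega> \<in> signed_graphs (Suc n)"
    unfolding AE_all_countable
    by (intro allI has_cond_pmf_AE_in[OF subalgebra_sample_algebra cond finite_signed_graphs])
       (use set_G_pmf in auto)
  ultimately show ?thesis using AE_range AE_space
  proof eventually_elim
    case (elim \<omega>)
    from elim(1) have "eventually (\<lambda>n.
      (\<Sum>i\<in>{1..Suc n}. \<Sum>j\<in>{1..Suc n}. \<bar>H_graph (Suc n) W (\<lambda>i. x i \<omega>) i j\<bar>) \<le> C * (real (Suc n))\<^sup>2 \<longrightarrow>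
      G (Suc n) \<omega> \<notin> bad_graphs (Suc n) (H_graph (Suc n) W (\<lambda>i. x i \<omega>)) (\<rho> (Suc n)) \<epsilon>) sequentially"
    proof eventually_elim
      case (elim m)
      have r: "\<forall>i\<in>{1..Suc m}. x i \<omega> \<in> {0..1}" using \<open>\<forall>i\<ge>1. x i \<omega> \<in> {0..1}\<close> by simp
      then have Heq: "H_graph (Suc m) W (\<lambda>i. x i \<omega>) = H (Suc m) \<omega>" by (intro H_eq) blast
      have "G (Suc m) \<omega> \<in> signed_graphs (Suc m)" using \<open>\<forall>n. G (Suc n) \<omega> \<in> signed_graphs (Suc n)\<close> by blast
      with elim have "\<omega> \<notin> A (Suc m) (G (Suc m) \<omega>)" unfolding B_def by blast
      then show ?case
        unfolding Heq A_def using r \<open>\<omega> \<in> space M\<close> by blast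
    qed
    then show ?case by (subst (asm) eventually_sequentially_Suc)
  qed
qed

text \<open>The events for all integer bounds c and all tolerances 1 / (k + 1) hold together almost
  surely, so the bound that fits the given sample can be chosen afterwards.\<close>

lemma AE_d_cut_G_graph_tendsto:
  assumes W: "graphon W" and \<rho>: "\<And>n. n \<ge> 1 \<Longrightarrow> \<rho> n > 0" and \<rho>0: "\<rho> \<longlonglongrightarrow> 0"
    and n\<rho>: "filterlim (\<lambda>n. real n * \<rho> n) at_top sequentially"
    and G: "\<And>n. n \<ge> 1 \<Longrightarrow> is_G_graph M x n W (\<rho> n) (G n)"
  shows "AE \<omega> in M.
    (\<lambda>n. d_cut (graph_graphon n (\<lambda>i. x i \<omega>) (\<lambda>i j. inverse (\<rho> n) * G n \<omega> i j)) W) \<longlonglongrightarrow> 0"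
proof -
  have Wint: "set_integrable lborel ({0..1} \<times> {0..1}) (\<lambda>(s, t). W s t)" using W by (simp add: graphon_def)
  have "AE \<omega> in M. \<forall>c k. eventually (\<lambda>n.
      (\<Sum>i\<in>{1..n}. \<Sum>j\<in>{1..n}. \<bar>H_graph n W (\<lambda>i. x i \<omega>) i j\<bar>) \<le> real (Suc c) * (real n)\<^sup>2 \<longrightarrow>
      G n \<omega> \<notin> bad_graphs n (H_graph n W (\<lambda>i. x i \<omega>)) (\<rho> n) (1 / real (Suc k))) sequentially"
    unfolding AE_all_countable by (intro allI AE_not_bad_graphs[OF W \<rho> n\<rho> G]) auto
  then show ?thesis using AE_sample_good[OF Wint]
  proof eventually_elim
    case (elim \<omega>)
    obtain c where c: "\<forall>n. (\<Sum>i\<in>{1..n}. \<Sum>j\<in>{1..n}. \<bar>H_graph n W (\<lambda>i. x i \<omega>) i j\<bar>) \<le> real (Suc c) * (real n)\<^sup>2"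
      using sum_abs_H_graph_bounded[OF elim(2)] .
    show ?case
    proof (rule d_cut_G_graph_tendsto[OF Wint elim(2) \<rho> \<rho>0])
      show "eventually (\<lambda>n. G n \<omega> \<notin> bad_graphs n (H_graph n W (\<lambda>i. x i \<omega>)) (\<rho> n) (1 / real (Suc k))) sequentially" for k
        using elim(1)[rule_format, of c k] by (rule eventually_mono) (use c in blast)
    qed
  qed
qed

end

theorem theorem2p14:
  fixes M :: "'a measure" and x :: "nat \<Rightarrow> 'a \<Rightarrow> real" and W :: "real \<Rightarrow> real \<Rightarrow> real"
  assumes "prob_space M"
    and "iid_uniform M x"
    and "graphon W"
  shows "(AE \<omega> in M.
            (\<lambda>n. d1 (graph_graphon n (\<lambda>i. x i \<omega>) (H_graph n W (\<lambda>i. x i \<omega>))) W) \<longlonglongrightarrow> 0) \<and>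
         (\<forall>(\<rho> :: nat \<Rightarrow> real) (G :: nat \<Rightarrow> 'a \<Rightarrow> wgraph).
            (\<forall>n\<ge>1. \<rho> n > 0) \<longrightarrow>
            \<rho> \<longlonglongrightarrow> 0 \<longrightarrow>
            filterlim (\<lambda>n. real n * \<rho> n) at_top sequentially \<longrightarrow>
            (\<forall>n\<ge>1. is_G_graph M x n W (\<rho> n) (G n)) \<longrightarrow>
            (AE \<omega> in M.
               (\<lambda>n. d_cut (graph_graphon n (\<lambda>i. x i \<omega>) (\<lambda>i j. inverse (\<rho> n) * G n \<omega> i j)) W)
                 \<longlonglongrightarrow> 0))"
proof (intro conjI allI impI)
  interpret prob_space M by fact
  interpret iid_uniform_seq M x by unfold_locales fact
  have W: "set_integrable lborel ({0..1} \<times> {0..1}) (\<lambda>(s, t). W s t)"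
    using assms(3) by (simp add: graphon_def)
  show "AE \<omega> in M. (\<lambda>n. d1 (graph_graphon n (\<lambda>i. x i \<omega>) (H_graph n W (\<lambda>i. x i \<omega>))) W) \<longlonglongrightarrow> 0"
    using AE_sample_good[OF W] by eventually_elim (rule d1_H_graph_tendsto[OF W])
  fix \<rho> :: "nat \<Rightarrow> real" and G :: "nat \<Rightarrow> 'a \<Rightarrow> wgraph"
  assume "\<forall>n\<ge>1. \<rho> n > 0" "\<rho> \<longlonglongrightarrow> 0" "filterlim (\<lambda>n. real n * \<rho> n) at_top sequentially"
    "\<forall>n\<ge>1. is_G_graph M x n W (\<rho> n) (G n)"
  then show "AE \<omega> in M.
      (\<lambda>n. d_cut (graph_graphon n (\<lambda>i. x i \<omega>) (\<lambda>i j. inverse (\<rho> n) * G n \<omega> i j)) W) \<longlonglongrightarrow> 0"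
    by (intro AE_d_cut_G_graph_tendsto[OF assms(3)]) auto
qed

end
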